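(* Let $d\ge1$, let $K:\mathbb{T}^d\times\mathbb{T}^d\to\mathbb{R}^d$ be a kernel whose Fourier modes are summable, i.e. $$\Vert\hat K\Vert_{l^1}:=\sum_{\eta,\lambda\in\mathbb{Z}^d}|\hat K(\eta,\lambda)|<+\infty,$$ and let $\rho_0\in L^2(\mathbb{T}^d)$ be a probability density. There exists a constant $C=C(K)$ (depending only on $K$) such that the following holds. If $\sigma>C$, then for every integer $N\ge 1$, letting $(f_{[j],N})_{1\le j\le N}$ be the solution of the BBGKY hierarchy $$\partial_tf_{[j],N}-\sigma\sum_{k=1}^j\Delta_{x_k}f_{[j],N}+\frac{1}{N}\sum_{k,l=1}^jS_{k,l}f_{[j],N}=-\frac{N-j}{N}\sum_{k=1}^jH_kf_{[j]\cup\{*\},N},\qquad 1\le j\le N,$$ with chaotic initial data $f_{[j],N}|_{t=0}=\rho_0^{\otimes j}$, and letting $g_{[m],N}$, $1\le m\le N$, be the corresponding correlation functions, one has $$\Vert g_{[m],N}(t)\Vert_{\hat l^\infty(\mathbb{T}^{dm})}\le\frac{2\,(m-1)!}{m^2N^{m-1}}$$ for all $m=1,\dots,N$ and all $t\ge0$.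
   Context: $\mathbb{T}^d=\mathbb{R}^d/\mathbb{Z}^d$ is the torus of unit volume, $[j]=\{1,\dots,j\}$, and $*$ is an extra index not in $\mathbb{N}$. Fourier coefficients: $h(x)=\sum_{\xi\in\mathbb{Z}^D}\hat h(\xi)e^{2\pi i\xi\cdot x}$ on $\mathbb{T}^D$, and $K(x,y)=\sum_{\lambda,\eta\in\mathbb{Z}^d}\hat K(\lambda,\eta)e^{2\pi i(\lambda\cdot x+\eta\cdot y)}$ (so $K$ is continuous). For measurable $h$ on $\mathbb{T}^D$, $\Vert h\Vert_{\hat l^\infty}:=\sup_{k\in\mathbb{Z}^D}|\hat h(k)|$. For a finite set $P\subset\mathbb{N}\cup\{*\}$ and $h_P:(\mathbb{T}^d)^P\to\mathbb{R}$, define (divergences in the sense of distributions) $$(S_{k,l}h_P)(x_\alpha;\alpha\in P)=\mathrm{div}_{x_k}\big(K(x_k,x_l)h_P(x_\alpha;\alpha\in P)\big)\quad (k,l\in P),$$ and, if $*,k\in P$, $k\neq *$, $$(H_kh_P)(x_\alpha;\alpha\in P-\{*\})=\mathrm{div}_{x_k}\Big(\int_{\mathbb{T}^d} K(x_k,x_* )h_P(x_\alpha;\alpha\in P)\,dx_*\Big).$$ The $f_{[j],N}$ are the marginals of the joint density $f_N=f_N(t,x_1,\dots,x_N)$ of $N$ exchangeable particles: $f_N$ is symmetric in $x_1,\dots,x_N$ and is the (weak, energy-class $C([0,\infty);L^2)\cap L^2_{loc}([0,\infty);H^1)$) solution of the Liouville equation $$\partial_t f_N+\sum_{i=1}^N\mathrm{div}_{x_i}\Big(f_N\frac1N\sum_{j=1}^NK(x_i,x_j)\Big)=\sigma\sum_{i=1}^N\Delta_{x_i}f_N,\qquad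 f_N|_{t=0}=\rho_0^{\otimes N},$$ and $f_{[j],N}(x_1,\dots,x_j)=\int\cdots\int f_N\,dx_{j+1}\cdots dx_N$ (so $f_{[N],N}=f_N$). For a finite index set $P$ with $|P|\le N$, $f_{P,N}$ denotes the $|P|$-marginal evaluated at the variables $(x_\alpha)_{\alpha\in P}$. The term with the factor $N-j$ is zero for $j=N$. The $m$-particle correlation function is $$g_{[m],N}=\sum_{\pi\vdash[m]}(-1)^{|\pi|-1}(|\pi|-1)!\prod_{P\in\pi}f_{P,N},$$ where the sum is over all set partitions $\pi$ of $[m]$, and $|\pi|$ is the number of blocks. *)

theory Defs
  imports "HOL-Analysis.Analysis" "HOL-Combinatorics.Permutations"
begin

section \<open>Functions on tori\<close>

text \<open>
  The torus \<open>R^d / Z^d\<close> is represented by its fundamental domain \<open>[0,1)^d\<close>; the dimension \<open>d\<close> is the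
  cardinality of a finite index type \<open>'d\<close>. Particle labels are positive integers, so that
  \<open>0\<close> is free to play the role of the extra index \<open>*\<close>. A point of \<open>(R^d / Z^d)^P\<close> is a
  function on labels, of which only the values on \<open>P\<close> matter.
\<close>

definition torus :: "(real ^ 'd) measure" where
  "torus = restrict_space lborel {x. \<forall>i. 0 \<le> x $ i \<and> x $ i < 1}"

definition star :: nat where
  "star = 0"

definition conf :: "nat set \<Rightarrow> (nat \<Rightarrow> real ^ 'd) measure" where
  "conf P = (\<Pi>\<^sub>M k\<in>P. torus)"

definition freq_inner :: "int ^ 'd \<Rightarrow> real ^ 'd \<Rightarrow> real" where
  "freq_inner \<xi> x = (\<Sum>i\<in>UNIV. real_of_int (\<xi> $ i) * x $ i)"

definition fourier_coeff ::
  "nat set \<Rightarrow> ((nat \<Rightarrow> real ^ 'd) \<Rightarrow> real) \<Rightarrow> (nat \<Rightarrow> int ^ 'd) \<Rightarrow> complex" where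
  "fourier_coeff P h \<xi> =
     (LINT x|conf P. complex_of_real (h x) * cis (- (2 * pi * (\<Sum>k\<in>P. freq_inner (\<xi> k) (x k)))))"

text \<open>
  The supremum is over all \<open>\<xi>\<close>, of which only the values on \<open>P\<close> matter. It is taken in the
  extended nonnegative reals, so that it is meaningful without a boundedness assumption.
\<close>

definition fourier_sup_norm :: "nat set \<Rightarrow> ((nat \<Rightarrow> real ^ 'd) \<Rightarrow> real) \<Rightarrow> ennreal" where
  "fourier_sup_norm P h = (SUP \<xi>. ennreal (cmod (fourier_coeff P h \<xi>)))"

definition kernel_coeff ::
  "(real ^ 'd \<Rightarrow> real ^ 'd \<Rightarrow> real ^ 'd) \<Rightarrow> int ^ 'd \<Rightarrow> int ^ 'd \<Rightarrow> complex ^ 'd" where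
  "kernel_coeff K \<kappa> \<eta> =
     (\<chi> i. LINT z|(torus \<Otimes>\<^sub>M torus). complex_of_real (K (fst z) (snd z) $ i)
              * cis (- (2 * pi * (freq_inner \<kappa> (fst z) + freq_inner \<eta> (snd z)))))"

text \<open>
  A kernel with summable Fourier modes is identified with its continuous representative, the
  pointwise sum of its Fourier series; in particular it is 1-periodic in every coordinate.
\<close>

definition summable_fourier_kernel :: "(real ^ 'd \<Rightarrow> real ^ 'd \<Rightarrow> real ^ 'd) \<Rightarrow> bool" where
  "summable_fourier_kernel K \<longleftrightarrow>
     (\<lambda>(\<kappa>, \<eta>). norm (kernel_coeff K \<kappa> \<eta>)) summable_on UNIV \<and>
     (\<forall>x y i. ((\<lambda>(\<kappa>, \<eta>). kernel_coeff K \<kappa> \<eta> $ i * cis (2 * pi * (freq_inner \<kappa> x + freq_inner \<eta> y)))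
                has_sum complex_of_real (K x y $ i)) UNIV)"

definition square_integrable :: "'a measure \<Rightarrow> ('a \<Rightarrow> real) \<Rightarrow> bool" where
  "square_integrable M h \<longleftrightarrow> h \<in> borel_measurable M \<and> integrable M (\<lambda>x. (h x)\<^sup>2)"

definition probability_density :: "'a measure \<Rightarrow> ('a \<Rightarrow> real) \<Rightarrow> bool" where
  "probability_density M h \<longleftrightarrow> integrable M h \<and> (AE x in M. 0 \<le> h x) \<and> (LINT x|M. h x) = 1"

section \<open>Test functions and distributions\<close>

definition partial_deriv ::
  "nat \<Rightarrow> 'd \<Rightarrow> ((nat \<Rightarrow> real ^ 'd) \<Rightarrow> real) \<Rightarrow> (nat \<Rightarrow> real ^ 'd) \<Rightarrow> real" where
  "partial_deriv k i \<phi> x = deriv (\<lambda>s. \<phi> (x(k := x k + s *\<^sub>R axis i 1))) 0"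

primrec cont_diff :: "nat set \<Rightarrow> nat \<Rightarrow> ((nat \<Rightarrow> real ^ 'd) \<Rightarrow> real) \<Rightarrow> bool" where
  "cont_diff P 0 \<phi> \<longleftrightarrow> continuous_on UNIV \<phi>"
| "cont_diff P (Suc n) \<phi> \<longleftrightarrow> continuous_on UNIV \<phi> \<and>
     (\<forall>k\<in>P. \<forall>i. (\<forall>x. (\<lambda>s. \<phi> (x(k := x k + s *\<^sub>R axis i 1))) differentiable (at 0)) \<and>
                cont_diff P n (partial_deriv k i \<phi>))"

definition test_function :: "nat set \<Rightarrow> ((nat \<Rightarrow> real ^ 'd) \<Rightarrow> real) \<Rightarrow> bool" where
  "test_function P \<phi> \<longleftrightarrow>
     (\<forall>x y. (\<forall>k\<in>P. x k = y k) \<longrightarrow> \<phi> x = \<phi> y) \<and>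
     (\<forall>x. \<forall>k\<in>P. \<forall>i. \<phi> (x(k := x k + axis i 1)) = \<phi> x) \<and>
     (\<forall>n. cont_diff P n \<phi>)"

text \<open>Distributions on \<open>(R^d / Z^d)^P\<close> are given by their values on test functions.\<close>

definition pairing ::
  "nat set \<Rightarrow> ((nat \<Rightarrow> real ^ 'd) \<Rightarrow> real) \<Rightarrow> ((nat \<Rightarrow> real ^ 'd) \<Rightarrow> real) \<Rightarrow> real" where
  "pairing P h \<phi> = (LINT x|conf P. h x * \<phi> x)"

definition dist_div ::
  "nat set \<Rightarrow> nat \<Rightarrow> ((nat \<Rightarrow> real ^ 'd) \<Rightarrow> real ^ 'd) \<Rightarrow> ((nat \<Rightarrow> real ^ 'd) \<Rightarrow> real) \<Rightarrow> real" where
  "dist_div P k F \<phi> = - (LINT x|conf P. F x \<bullet> (\<chi> i. partial_deriv k i \<phi> x))"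

definition dist_laplacian ::
  "nat set \<Rightarrow> nat \<Rightarrow> ((nat \<Rightarrow> real ^ 'd) \<Rightarrow> real) \<Rightarrow> ((nat \<Rightarrow> real ^ 'd) \<Rightarrow> real) \<Rightarrow> real" where
  "dist_laplacian P k h \<phi> =
     (LINT x|conf P. h x * (\<Sum>i\<in>UNIV. partial_deriv k i (partial_deriv k i \<phi>) x))"

definition op_S ::
  "(real ^ 'd \<Rightarrow> real ^ 'd \<Rightarrow> real ^ 'd) \<Rightarrow> nat set \<Rightarrow> nat \<Rightarrow> nat \<Rightarrow>
   ((nat \<Rightarrow> real ^ 'd) \<Rightarrow> real) \<Rightarrow> ((nat \<Rightarrow> real ^ 'd) \<Rightarrow> real) \<Rightarrow> real" where
  "op_S K P k l h = dist_div P k (\<lambda>x. h x *\<^sub>R K (x k) (x l))"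

definition op_H ::
  "(real ^ 'd \<Rightarrow> real ^ 'd \<Rightarrow> real ^ 'd) \<Rightarrow> nat set \<Rightarrow> nat \<Rightarrow>
   ((nat \<Rightarrow> real ^ 'd) \<Rightarrow> real) \<Rightarrow> ((nat \<Rightarrow> real ^ 'd) \<Rightarrow> real) \<Rightarrow> real" where
  "op_H K P k h = dist_div (P - {star}) k (\<lambda>x. LINT y|torus. h (x(star := y)) *\<^sub>R K (x k) y)"

section \<open>The energy class\<close>

definition weak_gradient ::
  "nat set \<Rightarrow> nat \<Rightarrow> ((nat \<Rightarrow> real ^ 'd) \<Rightarrow> real) \<Rightarrow> ((nat \<Rightarrow> real ^ 'd) \<Rightarrow> real ^ 'd) \<Rightarrow> bool" where
  "weak_gradient P k h G \<longleftrightarrow>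
     (\<forall>\<phi>. test_function P \<phi> \<longrightarrow> (\<forall>i. (LINT x|conf P. h x * partial_deriv k i \<phi> x)
                                      = - (LINT x|conf P. G x $ i * \<phi> x)))"

text \<open>\<open>u \<in> C([0,\<infinity>); L\<^sup>2) \<inter> L\<^sup>2\<^sub>l\<^sub>o\<^sub>c([0,\<infinity>); H\<^sup>1)\<close>; \<open>G k\<close> is the gradient of \<open>u\<close> in the variable \<open>x\<^sub>k\<close>.\<close>

definition energy_class :: "nat set \<Rightarrow> (real \<Rightarrow> (nat \<Rightarrow> real ^ 'd) \<Rightarrow> real) \<Rightarrow> bool" where
  "energy_class P u \<longleftrightarrow>
     (\<forall>t\<ge>0. square_integrable (conf P) (u t)) \<and>
     (\<forall>t\<ge>0. ((\<lambda>s. LINT x|conf P. (u s x - u t x)\<^sup>2) \<longlongrightarrow> 0) (at t within {0..})) \<and>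
     (\<exists>G. \<forall>k\<in>P.
        (\<lambda>(t, x). G k t x) \<in> borel_measurable (lborel \<Otimes>\<^sub>M conf P) \<and>
        (AE t in lborel. 0 \<le> t \<longrightarrow> weak_gradient P k (u t) (G k t)) \<and>
        (\<forall>T. (\<integral>\<^sup>+t\<in>{0..T}. (\<integral>\<^sup>+x. ennreal ((norm (G k t x))\<^sup>2) \<partial>conf P) \<partial>lborel) < \<infinity>))"

section \<open>Marginals, the BBGKY hierarchy and correlation functions\<close>

definition exchangeable :: "nat \<Rightarrow> ((nat \<Rightarrow> real ^ 'd) \<Rightarrow> real) \<Rightarrow> bool" where
  "exchangeable N h \<longleftrightarrow> (\<forall>p. p permutes {1..N} \<longrightarrow> (AE x in conf {1..N}. h (x \<circ> p) = h x))"

text \<open>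
  \<open>marginal N F P\<close> is the \<open>|P|\<close>-particle marginal of the \<open>N\<close>-particle function \<open>F\<close>, evaluated at the
  variables with labels in \<open>P\<close>, listed in increasing order (the order is irrelevant for
  exchangeable \<open>F\<close>). It is meaningful for finite \<open>P\<close> with \<open>|P| \<le> N\<close>.
\<close>

definition marginal ::
  "nat \<Rightarrow> ((nat \<Rightarrow> real ^ 'd) \<Rightarrow> real) \<Rightarrow> nat set \<Rightarrow> (nat \<Rightarrow> real ^ 'd) \<Rightarrow> real" where
  "marginal N F P x =
     (LINT y|conf {card P + 1..N}.
        F (merge {1..card P} {card P + 1..N} (\<lambda>i. x (sorted_list_of_set P ! (i - 1)), y)))"

text \<open>
  Weak form of the hierarchy for the marginals of \<open>f\<close>: tested against smooth functions of space and
  integrated in time. For \<open>j = N\<close> the marginal is \<open>f\<close> itself and the last term vanishes, so that this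
  equation, with its initial condition, is the Liouville equation.
\<close>

definition bbgky_solution ::
  "(real ^ 'd \<Rightarrow> real ^ 'd \<Rightarrow> real ^ 'd) \<Rightarrow> real \<Rightarrow> (real ^ 'd \<Rightarrow> real) \<Rightarrow> nat \<Rightarrow>
   (real \<Rightarrow> (nat \<Rightarrow> real ^ 'd) \<Rightarrow> real) \<Rightarrow> bool" where
  "bbgky_solution K \<sigma> \<rho>\<^sub>0 N f \<longleftrightarrow>
     (\<forall>j\<in>{1..N}.
        (AE x in conf {1..j}. marginal N (f 0) {1..j} x = (\<Prod>k=1..j. \<rho>\<^sub>0 (x k))) \<and>
        (\<forall>\<phi>. test_function {1..j} \<phi> \<longrightarrow> (\<forall>t\<ge>0.
          ((\<lambda>s. \<sigma> * (\<Sum>k=1..j. dist_laplacian {1..j} k (marginal N (f s) {1..j}) \<phi>)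
                - 1 / real N * (\<Sum>k=1..j. \<Sum>l=1..j. op_S K {1..j} k l (marginal N (f s) {1..j}) \<phi>)
                - (real N - real j) / real N *
                    (\<Sum>k=1..j. op_H K ({1..j} \<union> {star}) k (marginal N (f s) ({1..j} \<union> {star})) \<phi>))
            has_integral
              (pairing {1..j} (marginal N (f t) {1..j}) \<phi>
                - pairing {1..j} (marginal N (f 0) {1..j}) \<phi>)) {0..t})))"

definition correlation ::
  "nat \<Rightarrow> ((nat \<Rightarrow> real ^ 'd) \<Rightarrow> real) \<Rightarrow> nat \<Rightarrow> (nat \<Rightarrow> real ^ 'd) \<Rightarrow> real" where
  "correlation N F m x =
     (\<Sum>\<pi> | partition_on {1..m} \<pi>.
        (- 1) ^ (card \<pi> - 1) * fact (card \<pi> - 1) * (\<Prod>P\<in>\<pi>. marginal N F P x))"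

end

theory Submission
  imports Defs "HOL-Probability.Probability"
begin

text \<open>
  The Fourier coefficients of the marginals are joint moments of characters evaluated at the particle
  positions, and those of the correlation functions are the joint cumulants. Moments and cumulants are
  functions of a finite set of labels, and in the algebra of such functions under the subset convolution
  the moments are the exponential of the cumulants. Each Fourier mode of \<open>K\<close> only shifts two frequencies,
  so the hierarchy turns into differential equations for the moments, and dividing by the moments gives
  equations for the cumulants: diffusion damps the cumulant of frequency \<open>\<xi>\<close> at rate \<open>4\<pi>\<^sup>2\<sigma>|\<xi>|\<^sup>2\<close>, while the
  interaction is at most \<open>\<Sum>\<^sub>k |\<xi>\<^sub>k|\<close> times the norm of \<open>K\<close> times a polynomial in cumulants. The bounds
  \<open>2 (m - 1)! / (m\<^sup>2 N\<^sup>m\<^sup>-\<^sup>1)\<close> reproduce themselves, up to a universal factor, under that polynomial, so a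
  large \<open>\<sigma>\<close> closes the estimate.
\<close>

section \<open>Functions of finite label sets\<close>

text \<open>The obstacle is that the equation for the cumulant of order m contains the one of order
  m + 1, through the extra particle, so induction on m is impossible. All orders up to N and all
  frequencies are therefore controlled together, and the hierarchy closes at the top because N - m
  vanishes at m = N. A set function f is read as the polynomial with terms f(A) x^A and x_k^2 = 0; M
  has constant term 1, so it can be cancelled from M \<kappa>' = M R. The drift loses nothing
  against the damping: its derivative costs |\<xi>_k|, and |\<xi>_k|^2 is at least as large on
  integer frequencies; at frequency zero both vanish. The threshold on \<sigma> is 307 times the
  norm of K, with 307 = 1 + 17 + 17 + 272, one summand for each kind of term in
  \<open>cum_flow\<close>. The factor 2 in the bound leaves room for the continuity argument: order
  one holds with a factor of two to spare, as moments are at most 1, and higher orders start from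
  0.\<close>

definition conv :: "('a set \<Rightarrow> 'b) \<Rightarrow> ('a set \<Rightarrow> 'b) \<Rightarrow> 'a set \<Rightarrow> 'b::comm_ring_1" where
  "conv f g A = (\<Sum>B\<in>Pow A. f B * g (A - B))"

lemma conv_cong:
  assumes "\<And>B. B \<subseteq> A \<Longrightarrow> f B = f' B" "\<And>B. B \<subseteq> A \<Longrightarrow> g B = g' B"
  shows "conv f g A = conv f' g' A"
  unfolding conv_def by (rule sum.cong) (use assms in auto)

lemma conv_empty [simp]: "conv f g {} = f {} * g {}"
  by (simp add: conv_def)

lemma conv_commute: "conv f g A = conv g f A"
proof -
  have "bij_betw (\<lambda>B. A - B) (Pow A) (Pow A)"
    by (rule bij_betw_byWitness[where f' = "\<lambda>B. A - B"]) auto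
  then have "(\<Sum>B\<in>Pow A. g B * f (A - B)) = (\<Sum>B\<in>Pow A. g (A - B) * f (A - (A - B)))"
    by (rule sum.reindex_bij_betw[symmetric])
  also have "\<dots> = (\<Sum>B\<in>Pow A. f B * g (A - B))"
    by (rule sum.cong) (auto simp: double_diff mult.commute)
  finally show ?thesis
    by (simp add: conv_def)
qed

lemma conv_assoc:
  assumes "finite A"
  shows "conv (conv f g) h A = conv f (conv g h) A"
proof -
  have "conv (conv f g) h A
      = (\<Sum>(B, C)\<in>(SIGMA B:Pow A. Pow B). f C * g (B - C) * h (A - B))"
    unfolding conv_def using assms
    by (subst sum.Sigma[symmetric]) (auto simp: sum_distrib_right finite_subset)
  also have "\<dots> = (\<Sum>(C, D)\<in>(SIGMA C:Pow A. Pow (A - C)). f C * g D * h (A - C - D))"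
    by (rule sum.reindex_bij_witness[where i = "\<lambda>(C, D). (C \<union> D, C)" and j = "\<lambda>(B, C). (C, B - C)"])
       (auto simp: Un_absorb1 intro!: arg_cong2[where f = "(*)"] arg_cong[where f = h] arg_cong[where f = g])
  also have "\<dots> = conv f (conv g h) A"
    unfolding conv_def using assms
    by (subst sum.Sigma[symmetric]) (auto simp: sum_distrib_left finite_subset mult.assoc)
  finally show ?thesis .
qed

lemma conv_left_commute:
  assumes "finite A"
  shows "conv f (conv g h) A = conv g (conv f h) A"
proof -
  have "conv f (conv g h) A = conv (conv f g) h A" "conv g (conv f h) A = conv (conv g f) h A"
    by (simp_all add: assms conv_assoc)
  moreover have "conv f g = conv g f"
    by (rule ext) (rule conv_commute)
  ultimately show ?thesis
    by simp
qed

lemma conv_add_right: "conv f (\<lambda>B. g B + h B) A = conv f g A + conv f h A"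
  by (simp add: conv_def algebra_simps sum.distrib)

lemma conv_diff_right: "conv f (\<lambda>B. g B - h B) A = conv f g A - conv f h A"
  by (simp add: conv_def algebra_simps sum_subtractf)

lemma conv_cmult_right: "conv f (\<lambda>B. c * g B) A = c * conv f g A"
  by (simp add: conv_def algebra_simps sum_distrib_left)

lemma sum_Pow_insert:
  fixes f :: "'a set \<Rightarrow> 'b::comm_monoid_add"
  assumes "finite A" "k \<notin> A"
  shows "(\<Sum>B\<in>Pow (insert k A). f B) = (\<Sum>B\<in>Pow A. f (insert k B)) + (\<Sum>B\<in>Pow A. f B)"
proof -
  have "inj_on (insert k) (Pow A)"
    using assms(2) by (intro inj_onI) (auto simp: insert_eq_iff)
  moreover have "Pow A \<inter> insert k ` Pow A = {}"
    using assms(2) by auto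
  ultimately show ?thesis
    using assms by (simp add: Pow_insert sum.union_disjoint sum.reindex add.commute)
qed

text \<open>Adjoining a fixed label acts on set functions as a derivation.\<close>

lemma conv_insert:
  assumes "finite A" "k \<notin> A"
  shows "conv f g (insert k A) = conv (\<lambda>B. f (insert k B)) g A + conv f (\<lambda>B. g (insert k B)) A"
  unfolding conv_def sum_Pow_insert[OF assms]
proof (intro arg_cong2[where f = "(+)"] sum.cong refl)
  fix B assume "B \<in> Pow A"
  then have "insert k A - insert k B = A - B" "insert k A - B = insert k (A - B)"
    using assms(2) by auto
  then show "f (insert k B) * g (insert k A - insert k B) = f (insert k B) * g (A - B)"
    "f B * g (insert k A - B) = f B * g (insert k (A - B))"
    by simp_all
qed

text \<open>A set function with value 1 at the empty set is invertible for \<open>conv\<close>.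
  Instead of constructing the inverse, the triangular system is solved: in \<open>conv M f A\<close>
  the empty first factor contributes \<open>f A\<close>, and everything else involves smaller
  sets.\<close>

lemma conv_cancel:
  assumes "finite S" "M {} = 1" "\<And>A. A \<subseteq> S \<Longrightarrow> conv M f A = conv M g A" "A \<subseteq> S"
  shows "f A = g A"
  using finite_subset[OF assms(4,1)] assms(4)
proof (induction A rule: finite_psubset_induct)
  case (psubset A)
  have split: "conv M h A = h A + (\<Sum>B\<in>Pow A - {{}}. M B * h (A - B))" for h
    unfolding conv_def using psubset.hyps
    by (subst sum.remove[of "Pow A" "{}"]) (auto simp: assms(2))
  have "(\<Sum>B\<in>Pow A - {{}}. M B * f (A - B)) = (\<Sum>B\<in>Pow A - {{}}. M B * g (A - B))"
    by (rule sum.cong) (use psubset in \<open>auto intro!: arg_cong2[where f = "(*)"] psubset.IH\<close>)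
  with assms(3)[OF psubset.prems] show ?case
    by (simp add: split)
qed

text \<open>Both sides run over a set and a label outside it, the set going to \<open>M\<close>.
  Summing over particles an operator that touches one particle thus leaves \<open>M\<close> as a
  common factor.\<close>

lemma sum_conv_remove:
  assumes "finite A"
  shows "(\<Sum>k\<in>A. conv M (q k) (A - {k})) = conv M (\<lambda>B. \<Sum>k\<in>B. q k (B - {k})) A"
proof -
  have "(\<Sum>k\<in>A. conv M (q k) (A - {k}))
      = (\<Sum>(k, B)\<in>(SIGMA k:A. Pow (A - {k})). M B * q k (A - {k} - B))"
    unfolding conv_def using assms by (subst sum.Sigma) auto
  also have "\<dots> = (\<Sum>(B, k)\<in>(SIGMA B:Pow A. A - B). M B * q k (A - B - {k}))"
    by (rule sum.reindex_bij_witness[where i = "\<lambda>(B, k). (k, B)" and j = "\<lambda>(k, B). (B, k)"])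
       (auto intro!: arg_cong2[where f = "(*)"] arg_cong[where f = "q _"])
  also have "\<dots> = conv M (\<lambda>B. \<Sum>k\<in>B. q k (B - {k})) A"
    unfolding conv_def using assms
    by (subst sum.Sigma[symmetric]) (auto simp: sum_distrib_left)
  finally show ?thesis .
qed

section \<open>Cumulants\<close>

text \<open>The weights are the values of the Moebius function of the partition lattice between a
  partition and the one-block partition.\<close>

definition cum :: "('a set \<Rightarrow> 'b) \<Rightarrow> 'a set \<Rightarrow> 'b::{comm_ring_1,ring_char_0}" where
  "cum M A = (\<Sum>\<pi> | partition_on A \<pi>. (-1) ^ (card \<pi> - 1) * fact (card \<pi> - 1) * (\<Prod>P\<in>\<pi>. M P))"

text \<open>An artefact of natural subtraction: \<open>card \<pi> - 1\<close> is 0 for the empty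
  partition, whereas the logarithm of \<open>M\<close> has no constant term. The evolution formulas
  meet this value only with a weight that vanishes at the empty set, or as a constant under a
  derivative.\<close>

lemma cum_empty [simp]: "cum M {} = 1"
  by (simp add: cum_def partition_on_empty)

text \<open>
  A partition of a proper subset containing \<open>k\<close> extends to a partition \<open>\<pi>\<close> of the whole set with a
  marked block that avoids \<open>k\<close>. There are \<open>|\<pi>| - 1\<close> choices of the mark, so the weights
  telescope and only the one-block partition survives.
\<close>

lemma moment_insert:
  fixes M :: "'a set \<Rightarrow> 'b::{comm_ring_1,ring_char_0}"
  assumes "finite A" "k \<notin> A" "M {} = 1"
  shows "M (insert k A) = conv M (\<lambda>B. cum M (insert k B)) A"
proof -
  define c :: "nat \<Rightarrow> 'b" where "c n = (-1) ^ (n - 1) * fact (n - 1)" for n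
  define S where "S = {\<pi>. partition_on (insert k A) \<pi>}"
  define X where "X = (SIGMA B:Pow A - {{}}. {\<pi>. partition_on (insert k (A - B)) \<pi>})"
  define Y where "Y = (SIGMA \<pi>:S. {Q\<in>\<pi>. k \<notin> Q})"
  have finS: "finite S"
    unfolding S_def using assms(1) by (simp add: finitely_many_partition_on)
  have fin\<pi>: "finite \<pi>" if "\<pi> \<in> S" for \<pi>
    using that assms(1) finite_elements[of "insert k A"] by (auto simp: S_def)
  have X_insert: "insert B \<pi> \<in> S" "B \<notin> \<pi>" "finite \<pi>" "k \<notin> B" if "(B, \<pi>) \<in> X" for B \<pi>
  proof -
    have B: "B \<subseteq> A" "B \<noteq> {}" "partition_on (insert k (A - B)) \<pi>"
      using that by (auto simp: X_def)
    show "k \<notin> B"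
      using B assms by auto
    have "disjnt B (insert k (A - B))"
      using B assms by (auto simp: disjnt_def)
    moreover have "insert k A - B = insert k (A - B)"
      using \<open>k \<notin> B\<close> by auto
    ultimately have "partition_on (insert k A) (insert B \<pi>)"
      using B by (subst partition_on_insert) (auto simp: partition_onD1[OF B(3), symmetric])
    then show "insert B \<pi> \<in> S"
      by (simp add: S_def)
    show "B \<notin> \<pi>"
      using B \<open>disjnt B _\<close> partition_onD1[OF B(3)] by (auto simp: disjnt_def)
    show "finite \<pi>"
      using B(3) assms(1) finite_elements[of "insert k (A - B)"] by auto
  qed
  have Y_remove: "(Q, \<pi> - {Q}) \<in> X" if "(\<pi>, Q) \<in> Y" for Q \<pi>
  proof -
    have Q: "partition_on (insert k A) \<pi>" "Q \<in> \<pi>" "k \<notin> Q"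
      using that by (auto simp: Y_def S_def)
    then have "Q \<subseteq> A" "Q \<noteq> {}"
      using partition_onD1[OF Q(1)] partition_onD3[OF Q(1)] by auto
    moreover have "partition_on (insert k A - Q) (\<pi> - {Q})"
      by (rule partition_onI)
         (use Q partition_onD1[OF Q(1)] partition_onD2[OF Q(1)] partition_onD3[OF Q(1)] in
          \<open>auto simp: disjoint_def disjnt_def\<close>)
    moreover have "insert k A - Q = insert k (A - Q)"
      using Q by auto
    ultimately show ?thesis
      by (auto simp: X_def)
  qed
  have count: "card {Q\<in>\<pi>. k \<notin> Q} = card \<pi> - 1" if "\<pi> \<in> S" for \<pi>
  proof -
    have \<pi>: "partition_on (insert k A) \<pi>"
      using that by (simp add: S_def)
    then obtain P where P: "P \<in> \<pi>" "k \<in> P"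
      using partition_onD1[OF \<pi>] by auto
    then have "{Q\<in>\<pi>. k \<notin> Q} = \<pi> - {P}"
      using partition_onD2[OF \<pi>] by (auto simp: disjoint_def)
    then show ?thesis
      using P(1) by simp
  qed
  have "conv M (\<lambda>B. cum M (insert k B)) A
      = (\<Sum>B\<in>Pow A. M B * (\<Sum>\<pi> | partition_on (insert k (A - B)) \<pi>. c (card \<pi>) * (\<Prod>P\<in>\<pi>. M P)))"
    by (simp add: conv_def cum_def c_def)
  also have "\<dots> = (\<Sum>\<pi>\<in>S. c (card \<pi>) * (\<Prod>P\<in>\<pi>. M P)) +
      (\<Sum>B\<in>Pow A - {{}}. \<Sum>\<pi> | partition_on (insert k (A - B)) \<pi>. M B * (c (card \<pi>) * (\<Prod>P\<in>\<pi>. M P)))"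
    using assms(1) by (subst sum.remove[of _ "{}"]) (auto simp: assms(3) S_def sum_distrib_left)
  also have "(\<Sum>B\<in>Pow A - {{}}. \<Sum>\<pi> | partition_on (insert k (A - B)) \<pi>. M B * (c (card \<pi>) * (\<Prod>P\<in>\<pi>. M P)))
      = (\<Sum>(B, \<pi>)\<in>X. M B * (c (card \<pi>) * (\<Prod>P\<in>\<pi>. M P)))"
    unfolding X_def using assms(1)
    by (subst sum.Sigma) (auto intro!: finitely_many_partition_on)
  also have "\<dots> = (\<Sum>(\<pi>, Q)\<in>Y. c (card \<pi> - 1) * (\<Prod>P\<in>\<pi>. M P))"
  proof (rule sum.reindex_bij_witness[where j = "\<lambda>(B, \<pi>). (insert B \<pi>, B)" and i = "\<lambda>(\<pi>, Q). (Q, \<pi> - {Q})"])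
    fix p assume "p \<in> X"
    then show "(case case p of (B, \<pi>) \<Rightarrow> (insert B \<pi>, B) of (\<pi>, Q) \<Rightarrow> (Q, \<pi> - {Q})) = p"
      "(case p of (B, \<pi>) \<Rightarrow> (insert B \<pi>, B)) \<in> Y"
      "(case case p of (B, \<pi>) \<Rightarrow> (insert B \<pi>, B) of (\<pi>, Q) \<Rightarrow> c (card \<pi> - 1) * prod M \<pi>) =
       (case p of (B, \<pi>) \<Rightarrow> M B * (c (card \<pi>) * prod M \<pi>))"
      using X_insert by (auto simp: Y_def split: prod.splits)
  next
    fix p assume "p \<in> Y"
    then show "(case case p of (\<pi>, Q) \<Rightarrow> (Q, \<pi> - {Q}) of (B, \<pi>) \<Rightarrow> (insert B \<pi>, B)) = p"
      "(case p of (\<pi>, Q) \<Rightarrow> (Q, \<pi> - {Q})) \<in> X"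
      using Y_remove by (auto simp: Y_def)
  qed
  also have "\<dots> = (\<Sum>\<pi>\<in>S. of_nat (card \<pi> - 1) * (c (card \<pi> - 1) * (\<Prod>P\<in>\<pi>. M P)))"
    unfolding Y_def using finS fin\<pi>
    by (subst sum.Sigma[symmetric]) (auto simp: count)
  also have "(\<Sum>\<pi>\<in>S. c (card \<pi>) * (\<Prod>P\<in>\<pi>. M P)) + \<dots>
      = (\<Sum>\<pi>\<in>S. (if \<pi> = {insert k A} then M (insert k A) else 0))"
    unfolding sum.distrib[symmetric]
  proof (rule sum.cong[OF refl])
    fix \<pi> assume "\<pi> \<in> S"
    then have \<pi>: "partition_on (insert k A) \<pi>" "finite \<pi>"
      using fin\<pi> by (auto simp: S_def)
    have ne: "\<pi> \<noteq> {}"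
      using partition_onD1[OF \<pi>(1)] by auto
    show "c (card \<pi>) * prod M \<pi> + of_nat (card \<pi> - 1) * (c (card \<pi> - 1) * prod M \<pi>)
        = (if \<pi> = {insert k A} then M (insert k A) else 0)"
    proof (cases "card \<pi> = 1")
      case True
      then obtain P where "\<pi> = {P}"
        by (auto simp: card_1_singleton_iff)
      with partition_onD1[OF \<pi>(1)] have "\<pi> = {insert k A}"
        by simp
      then show ?thesis
        by (simp add: c_def)
    next
      case False
      then obtain n where n: "card \<pi> = Suc (Suc n)"
        using ne \<pi>(2) by (metis One_nat_def card_eq_0_iff not0_implies_Suc)
      then have "\<pi> \<noteq> {insert k A}"
        by auto
      then show ?thesis
        by (simp add: n c_def algebra_simps)
    qed
  qed
  also have "\<dots> = M (insert k A)"
    using finS partition_on_space[of "insert k A"] by (simp add: S_def sum.delta)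
  finally show ?thesis ..
qed


lemma moment_remove:
  fixes M :: "'a set \<Rightarrow> 'b::{comm_ring_1,ring_char_0}"
  assumes "finite A" "k \<in> A" "M {} = 1"
  shows "M A = conv M (\<lambda>B. cum M (insert k B)) (A - {k})"
  using moment_insert[of "A - {k}" k M] assms by (simp add: insert_absorb)

text \<open>The recursion \<open>moment_insert\<close> determines cumulants from moments, so it
  suffices that the transported cumulants satisfy it; no partitions have to be carried along
  \<open>f\<close>.\<close>

lemma cum_image:
  fixes M :: "'a set \<Rightarrow> 'b::{comm_ring_1,ring_char_0}" and M' :: "'c set \<Rightarrow> 'b"
  assumes "finite A" "inj_on f A" "M {} = 1" "\<And>B. B \<subseteq> A \<Longrightarrow> M B = M' (f ` B)"
  shows "cum M A = cum M' (f ` A)"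
proof (cases "A = {}")
  case False
  then obtain k S where A: "A = insert k S" "k \<notin> S" "finite S"
    by (metis assms(1) finite_insert mk_disjoint_insert ex_in_conv)
  have "cum M (insert k S) = cum M' (f ` insert k S)"
  proof (rule conv_cancel[of S M "\<lambda>B. cum M (insert k B)" "\<lambda>B. cum M' (f ` insert k B)" S])
    fix B assume B: "B \<subseteq> S"
    then have fin: "finite B" and k: "k \<notin> B"
      using A by (auto intro: finite_subset)
    have inj: "inj_on f (insert k B)"
      using assms(2) B by (rule_tac inj_on_subset[of f A]) (auto simp: A)
    have fk: "f k \<notin> f ` B"
      using inj k by (auto simp: inj_on_def)
    have "conv M (\<lambda>B. cum M (insert k B)) B = M' (f ` insert k B)"
      using moment_insert[of B k M, OF fin k assms(3)] assms(4)[of "insert k B"] B by (auto simp: A)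
    also have "\<dots> = conv M' (\<lambda>C. cum M' (insert (f k) C)) (f ` B)"
      using moment_insert[of "f ` B" "f k" M'] fin fk assms(3) assms(4)[of "{}"] by simp
    also have "\<dots> = (\<Sum>C\<in>Pow B. M' (f ` C) * cum M' (insert (f k) (f ` B - f ` C)))"
    proof -
      have "inj_on ((`) f) (Pow B)"
        using inj by (intro inj_on_image_Pow) (auto intro: inj_on_subset)
      moreover have "Pow (f ` B) = (`) f ` Pow B"
        by (rule image_Pow_surj[symmetric]) simp
      ultimately show ?thesis
        unfolding conv_def by (simp add: sum.reindex)
    qed
    also have "\<dots> = conv M (\<lambda>B. cum M' (f ` insert k B)) B"
      unfolding conv_def
    proof (rule sum.cong[OF refl])
      fix C assume C: "C \<in> Pow B"
      then have "f ` B - f ` C = f ` (B - C)"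
        using inj by (intro inj_on_image_set_diff[symmetric, of f B]) (auto intro: inj_on_subset)
      moreover have "M' (f ` C) = M C"
        using C B A by (intro assms(4)[symmetric]) auto
      ultimately show "M' (f ` C) * cum M' (insert (f k) (f ` B - f ` C)) =
          M C * cum M' (f ` insert k (B - C))"
        by simp
    qed
    finally show "conv M (\<lambda>B. cum M (insert k B)) B = conv M (\<lambda>B. cum M' (f ` insert k B)) B" .
  qed (use A assms in auto)
  then show ?thesis
    by (simp add: A)
qed simp

text \<open>The constant \<open>c\<close>, placed at the empty set, already solves the recursion
  \<open>moment_insert\<close>, and solutions are unique. In probabilistic terms, a particle
  independent of the others has no joint cumulants with them.\<close>

lemma cum_eq_0_of_factor:
  fixes M :: "'a set \<Rightarrow> 'b::{comm_ring_1,ring_char_0}"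
  assumes "finite S" "k \<notin> S" "S \<noteq> {}" "M {} = 1"
    and fac: "\<And>A. A \<subseteq> S \<Longrightarrow> M (insert k A) = M A * c"
  shows "cum M (insert k S) = 0"
proof -
  have "cum M (insert k S) = (if S = {} then c else 0)"
  proof (rule conv_cancel[of S M "\<lambda>B. cum M (insert k B)" "\<lambda>B. if B = {} then c else 0" S])
    fix B assume B: "B \<subseteq> S"
    then have fin: "finite B" and k: "k \<notin> B"
      using assms by (auto intro: finite_subset)
    have "conv M (\<lambda>B. if B = {} then c else 0) B = (\<Sum>C\<in>Pow B. if C = B then M B * c else 0)"
      unfolding conv_def by (rule sum.cong) auto
    also have "\<dots> = M (insert k B)"
      using fin B by (simp add: fac)
    also have "\<dots> = conv M (\<lambda>B. cum M (insert k B)) B"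
      by (intro moment_insert fin k assms(4))
    finally show "conv M (\<lambda>B. cum M (insert k B)) B = conv M (\<lambda>B. if B = {} then c else 0) B" ..
  qed (use assms in auto)
  with assms(3) show ?thesis
    by simp
qed

text \<open>An additive weight acts as a derivation and so maps exp \<kappa> to exp \<kappa> times
  the weighted \<kappa>. It serves with constant weight for the particle count and with |\<xi>_k|^2
  for the Laplacian.\<close>

lemma moment_weight:
  fixes M :: "'a set \<Rightarrow> 'b::{comm_ring_1,ring_char_0}"
  assumes "finite A" "M {} = 1"
  shows "sum w A * M A = conv M (\<lambda>B. sum w B * cum M B) A"
proof -
  have "sum w A * M A = (\<Sum>k\<in>A. conv M (\<lambda>B. w k * cum M (insert k B)) (A - {k}))"
    using assms by (simp add: sum_distrib_right conv_cmult_right flip: moment_remove)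
  also have "\<dots> = conv M (\<lambda>B. \<Sum>k\<in>B. w k * cum M (insert k (B - {k}))) A"
    using assms(1) by (rule sum_conv_remove)
  also have "\<dots> = conv M (\<lambda>B. sum w B * cum M B) A"
    by (rule conv_cong) (simp_all add: insert_absorb sum_distrib_right)
  finally show ?thesis .
qed

text \<open>A second derivative of exp \<kappa>: the two labels lie either in one cumulant or in two
  different ones.\<close>

lemma moment_insert2:
  fixes M :: "'a set \<Rightarrow> 'b::{comm_ring_1,ring_char_0}"
  assumes "finite A" "k \<notin> A" "l \<notin> A" "k \<noteq> l" "M {} = 1"
  shows "M (insert k (insert l A)) = conv M (\<lambda>B. cum M (insert k (insert l B)) +
    conv (\<lambda>C. cum M (insert k C)) (\<lambda>C. cum M (insert l C)) B) A"
proof -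
  have "M (insert k (insert l A)) = conv M (\<lambda>B. cum M (insert k B)) (insert l A)"
    using assms by (intro moment_insert) auto
  also have "\<dots> = conv (\<lambda>B. M (insert l B)) (\<lambda>B. cum M (insert k B)) A +
      conv M (\<lambda>B. cum M (insert k (insert l B))) A"
    using assms by (intro conv_insert) auto
  also have "conv (\<lambda>B. M (insert l B)) (\<lambda>B. cum M (insert k B)) A
      = conv (conv M (\<lambda>B. cum M (insert l B))) (\<lambda>B. cum M (insert k B)) A"
    using assms by (intro conv_cong refl moment_insert) (auto intro: finite_subset)
  also have "\<dots> = conv M (conv (\<lambda>B. cum M (insert l B)) (\<lambda>B. cum M (insert k B))) A"
    using assms by (simp add: conv_assoc)
  also have "\<dots> = conv M (conv (\<lambda>B. cum M (insert k B)) (\<lambda>B. cum M (insert l B))) A"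
    by (rule conv_cong[OF refl]) (rule conv_commute)
  finally show ?thesis
    by (simp add: conv_add_right add.commute)
qed

text \<open>The logarithmic derivative: differentiating \<open>M = exp \<kappa>\<close> gives \<open>M' = M \<kappa>'\<close>.\<close>

lemma moment_derivative:
  fixes M :: "'a set \<Rightarrow> 'b::{comm_ring_1,ring_char_0}"
  assumes "finite A" "M {} = 1" "dM {} = 0" "d\<kappa> {} = 0"
    and d: "\<And>B k. insert k B \<subseteq> A \<Longrightarrow> k \<notin> B \<Longrightarrow>
      dM (insert k B) = conv dM (\<lambda>C. cum M (insert k C)) B + conv M (\<lambda>C. d\<kappa> (insert k C)) B"
  shows "dM A = conv M d\<kappa> A"
  using assms(1) d
proof (induction A rule: finite_psubset_induct)
  case (psubset A)
  show ?case
  proof (cases "A = {}")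
    case False
    then obtain k B where A: "A = insert k B" "k \<notin> B" "finite B"
      by (metis psubset.hyps finite_insert mk_disjoint_insert ex_in_conv)
    have IH: "dM C = conv M d\<kappa> C" if "C \<subseteq> B" for C
    proof (rule psubset.IH)
      show "C \<subset> A"
        using that A by auto
      show "dM (insert j D) = conv dM (\<lambda>C. cum M (insert j C)) D + conv M (\<lambda>C. d\<kappa> (insert j C)) D"
        if "insert j D \<subseteq> C" "j \<notin> D" for j D
        using that \<open>C \<subset> A\<close> by (intro psubset.prems) auto
    qed
    have "conv dM (\<lambda>C. cum M (insert k C)) B = conv (conv M d\<kappa>) (\<lambda>C. cum M (insert k C)) B"
      by (intro conv_cong refl IH)
    also have "\<dots> = conv (\<lambda>C. cum M (insert k C)) (conv M d\<kappa>) B"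
      by (rule conv_commute)
    also have "\<dots> = conv M (conv (\<lambda>C. cum M (insert k C)) d\<kappa>) B"
      using A by (intro conv_left_commute) auto
    also have "\<dots> = conv (conv M (\<lambda>C. cum M (insert k C))) d\<kappa> B"
      using A by (simp add: conv_assoc)
    also have "\<dots> = conv (\<lambda>C. M (insert k C)) d\<kappa> B"
      using A assms(2) by (intro conv_cong refl moment_insert[symmetric]) (auto intro: finite_subset)
    finally show ?thesis
      using psubset.prems[of k B] A by (simp add: conv_insert)
  qed (simp add: assms)
qed

section \<open>One kernel mode acting on cumulants\<close>

definition cum_pair :: "('a set \<Rightarrow> complex) \<Rightarrow> 'a \<Rightarrow> 'a \<Rightarrow> 'a set \<Rightarrow> complex" where
  "cum_pair M k l B = cum M (insert k (insert l B)) +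
    conv (\<lambda>C. cum M (insert k C)) (\<lambda>C. cum M (insert l C)) B"

text \<open>
  \<open>flow\<close> is what one Fourier mode of the kernel, acting on particle \<open>k\<close>, contributes to the evolution
  of the moments, \<open>z\<close> being the extra particle \<open>*\<close>; \<open>cum_flow\<close> is its counterpart for cumulants. The last
  term of \<open>cum_flow\<close> stems from the factor \<open>N - |A|\<close>: multiplication by \<open>|A|\<close> is a derivation and maps
  \<open>M = exp \<kappa>\<close> to \<open>M\<close> times \<open>|A| \<kappa>(A)\<close>.
\<close>

definition flow ::
  "nat \<Rightarrow> 'a \<Rightarrow> 'a \<Rightarrow> ('a set \<Rightarrow> complex) \<Rightarrow> ('a \<Rightarrow> 'a set \<Rightarrow> complex) \<Rightarrow> ('a set \<Rightarrow> complex) \<Rightarrow>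
   'a set \<Rightarrow> complex" where
  "flow N k z M\<^sub>1 M\<^sub>2 M\<^sub>3 A =
     (1 / of_nat N) * (M\<^sub>1 A + (\<Sum>l\<in>A - {k}. M\<^sub>2 l A)) +
     ((of_nat N - of_nat (card A)) / of_nat N) * M\<^sub>3 (insert z A)"

definition cum_flow ::
  "nat \<Rightarrow> 'a \<Rightarrow> 'a \<Rightarrow> ('a set \<Rightarrow> complex) \<Rightarrow> ('a set \<Rightarrow> complex) \<Rightarrow> ('a \<Rightarrow> 'a set \<Rightarrow> complex) \<Rightarrow>
   ('a set \<Rightarrow> complex) \<Rightarrow> 'a set \<Rightarrow> complex" where
  "cum_flow N k z M M\<^sub>1 M\<^sub>2 M\<^sub>3 B =
     (1 / of_nat N) * (cum M\<^sub>1 (insert k B) + (\<Sum>l\<in>B. cum_pair (M\<^sub>2 l) k l (B - {l}))) +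
     ((of_nat N - 1 - of_nat (card B)) / of_nat N) * cum_pair M\<^sub>3 k z B -
     (1 / of_nat N) * conv (\<lambda>C. of_nat (card C) * cum M C) (cum_pair M\<^sub>3 k z) B"

text \<open>Each family of moments in \<open>flow\<close> has its own frequencies, but a kernel mode
  changes only those of the particles it touches. On the untouched labels all families agree with
  \<open>M\<close>, which therefore comes out as the same factor in every term.\<close>

lemma flow_eq_conv:
  assumes "finite B" "k \<notin> B" "z \<notin> B" "k \<noteq> z" "M {} = 1"
    and M\<^sub>1: "\<And>C. C \<subseteq> B \<Longrightarrow> M\<^sub>1 C = M C"
    and M\<^sub>2: "\<And>C l. C \<subseteq> B - {l} \<Longrightarrow> l \<in> B \<Longrightarrow> M\<^sub>2 l C = M C"
    and M\<^sub>3: "\<And>C. C \<subseteq> B \<Longrightarrow> M\<^sub>3 C = M C"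
  shows "flow N k z M\<^sub>1 M\<^sub>2 M\<^sub>3 (insert k B) = conv M (cum_flow N k z M M\<^sub>1 M\<^sub>2 M\<^sub>3) B"
proof -
  have fin: "finite C" if "C \<subseteq> B" for C
    using that assms(1) by (rule finite_subset)
  have 1: "M\<^sub>1 (insert k B) = conv M (\<lambda>C. cum M\<^sub>1 (insert k C)) B"
  proof -
    have "M\<^sub>1 (insert k B) = conv M\<^sub>1 (\<lambda>C. cum M\<^sub>1 (insert k C)) B"
      using assms by (intro moment_insert) auto
    also have "\<dots> = conv M (\<lambda>C. cum M\<^sub>1 (insert k C)) B"
      by (intro conv_cong refl M\<^sub>1)
    finally show ?thesis .
  qed
  have 2: "M\<^sub>2 l (insert k B) = conv M (cum_pair (M\<^sub>2 l) k l) (B - {l})" if l: "l \<in> B" for l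
  proof -
    have "M\<^sub>2 l (insert k (insert l (B - {l}))) = conv (M\<^sub>2 l) (cum_pair (M\<^sub>2 l) k l) (B - {l})"
      unfolding cum_pair_def using assms(1,2,5) l M\<^sub>2[of "{}" l] by (intro moment_insert2) auto
    also have "\<dots> = conv M (cum_pair (M\<^sub>2 l) k l) (B - {l})"
      using l by (intro conv_cong refl M\<^sub>2) auto
    finally show ?thesis
      using l by (simp add: insert_absorb)
  qed
  have 3: "M\<^sub>3 (insert z (insert k B)) = conv M (cum_pair M\<^sub>3 k z) B"
  proof -
    have "M\<^sub>3 (insert k (insert z B)) = conv M\<^sub>3 (cum_pair M\<^sub>3 k z) B"
      unfolding cum_pair_def using assms(1-5) M\<^sub>3[of "{}"] by (intro moment_insert2) auto
    also have "\<dots> = conv M (cum_pair M\<^sub>3 k z) B"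
      by (intro conv_cong refl M\<^sub>3)
    finally show ?thesis
      by (simp add: insert_commute)
  qed
  \<comment> \<open>The count splits as |B| = |C| + |B - C|; the share that falls on the factor
    \<open>M\<close> is rewritten by \<open>moment_weight\<close>.\<close>
  have euler: "of_nat (card B) * conv M W B =
      conv M (\<lambda>C. of_nat (card C) * W C) B + conv M (conv (\<lambda>C. of_nat (card C) * cum M C) W) B"
    for W :: "'a set \<Rightarrow> complex"
  proof -
    have "of_nat (card B) * conv M W B
        = (\<Sum>C\<in>Pow B. M C * (of_nat (card (B - C)) * W (B - C)) + of_nat (card C) * M C * W (B - C))"
      unfolding conv_def sum_distrib_left
    proof (rule sum.cong[OF refl])
      fix C assume "C \<in> Pow B"
      then have "card B = card (B - C) + card C"
        using fin[of C] card_mono[OF assms(1), of C] by (simp add: card_Diff_subset)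
      then show "of_nat (card B) * (M C * W (B - C)) =
          M C * (of_nat (card (B - C)) * W (B - C)) + of_nat (card C) * M C * W (B - C)"
        by (simp add: algebra_simps)
    qed
    also have "\<dots> = conv M (\<lambda>C. of_nat (card C) * W C) B + conv (\<lambda>C. of_nat (card C) * M C) W B"
      by (simp add: conv_def sum.distrib)
    also have "conv (\<lambda>C. of_nat (card C) * M C) W B = conv (conv M (\<lambda>C. of_nat (card C) * cum M C)) W B"
    proof (rule conv_cong)
      fix C assume "C \<subseteq> B"
      then show "of_nat (card C) * M C = conv M (\<lambda>C. of_nat (card C) * cum M C) C"
        using moment_weight[of C M "\<lambda>_. 1"] fin assms(5) by simp
    qed simp
    also have "\<dots> = conv M (conv (\<lambda>C. of_nat (card C) * cum M C) W) B"
      using assms(1) by (rule conv_assoc)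
    finally show ?thesis .
  qed
  have s: "insert k B - {k} = B" "card (insert k B) = Suc (card B)"
    using assms by auto
  \<comment> \<open>Here N minus the number of labels is (N - 1) - |B|: the first part stays a
    coefficient, the second is left to \<open>euler\<close>.\<close>
  have "flow N k z M\<^sub>1 M\<^sub>2 M\<^sub>3 (insert k B) =
    (1 / of_nat N) * (M\<^sub>1 (insert k B) + (\<Sum>l\<in>B. M\<^sub>2 l (insert k B))) +
    ((of_nat N - 1 - of_nat (card B)) / of_nat N) * M\<^sub>3 (insert z (insert k B))"
    unfolding flow_def s by (simp add: algebra_simps)
  also have "\<dots> = (1 / of_nat N) * (conv M (\<lambda>C. cum M\<^sub>1 (insert k C)) B +
       conv M (\<lambda>C. \<Sum>l\<in>C. cum_pair (M\<^sub>2 l) k l (C - {l})) B) +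
     ((of_nat N - 1) / of_nat N) * conv M (cum_pair M\<^sub>3 k z) B -
     (1 / of_nat N) * (of_nat (card B) * conv M (cum_pair M\<^sub>3 k z) B)"
    by (simp add: 1 2 3 sum_conv_remove[OF assms(1)] diff_divide_distrib add_divide_distrib algebra_simps)
  also have "\<dots> = conv M (\<lambda>C. (1 / of_nat N) * (cum M\<^sub>1 (insert k C) +
      (\<Sum>l\<in>C. cum_pair (M\<^sub>2 l) k l (C - {l}))) +
     ((of_nat N - 1) / of_nat N) * cum_pair M\<^sub>3 k z C -
     (1 / of_nat N) * (of_nat (card C) * cum_pair M\<^sub>3 k z C +
       conv (\<lambda>C. of_nat (card C) * cum M C) (cum_pair M\<^sub>3 k z) C)) B"
    by (simp only: conv_add_right conv_diff_right conv_cmult_right euler)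
  also have "\<dots> = conv M (cum_flow N k z M M\<^sub>1 M\<^sub>2 M\<^sub>3) B"
    unfolding cum_flow_def
    by (intro conv_cong refl) (simp add: diff_divide_distrib add_divide_distrib algebra_simps)
  finally show ?thesis .
qed

section \<open>Size estimates\<close>

text \<open>For n = 0 division by zero gives the value 0, which is no bound for
  \<open>cum M {} = 1\<close>; hence the empty set is left out of \<open>small_cum\<close>.\<close>

definition cum_bound :: "nat \<Rightarrow> nat \<Rightarrow> real" where
  "cum_bound N n = 2 * fact (n - 1) / (real n ^ 2 * real N ^ (n - 1))"

lemma cum_bound_nonneg: "0 \<le> cum_bound N n"
  by (simp add: cum_bound_def)

lemma cum_bound_pos: "1 \<le> N \<Longrightarrow> 1 \<le> n \<Longrightarrow> 0 < cum_bound N n"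
  by (simp add: cum_bound_def)

text \<open>Adding a label to m others costs a factor of at most m / N, which stays below 1 as long
  as m does not exceed N. This absorbs the coupling to the next order.\<close>

lemma cum_bound_Suc_le:
  assumes "Suc n \<le> N"
  shows "cum_bound N (Suc (Suc n)) \<le> cum_bound N (Suc n)"
proof -
  have "cum_bound N (Suc (Suc n))
      = (2 * fact n / real N ^ n) * (real (Suc n) / real N) * (1 / real (Suc (Suc n)) ^ 2)"
    by (simp add: cum_bound_def field_simps)
  also have "\<dots> \<le> (2 * fact n / real N ^ n) * 1 * (1 / real (Suc n) ^ 2)"
    using assms by (intro mult_mono frac_le power_mono) auto
  also have "\<dots> = cum_bound N (Suc n)"
    by (simp add: cum_bound_def)
  finally show ?thesis .
qed

text \<open>The term \<open>- 1 / real (Suc n)\<close> makes the induction a telescoping sum, as 1 /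
  (k + 1)^2 is at most 1 / k - 1 / (k + 1).\<close>

lemma sum_inverse_squares_le: "(\<Sum>c\<le>n. 1 / real (Suc c) ^ 2) \<le> 2 - 1 / real (Suc n)"
proof (induction n)
  case (Suc n)
  have "1 / real (Suc (Suc n)) ^ 2 \<le> 1 / real (Suc n) - 1 / real (Suc (Suc n))"
    by (simp add: divide_simps power2_eq_square)
  with Suc show ?case
    by simp
qed simp

text \<open>The factors \<open>1 / m\<^sup>2\<close> in the bound are there because they are stable under convolution.\<close>

lemma sum_inverse_squares_conv_le:
  "(\<Sum>c\<le>n. 1 / (real (Suc c) ^ 2 * real (Suc (n - c)) ^ 2)) \<le> 8 / real (n + 2) ^ 2"
proof -
  define s where "s = (\<Sum>c\<le>n. 1 / real (Suc c) ^ 2)"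
  \<comment> \<open>Since x + y = n + 2 is constant along the sum, this pulls out the weight 1 / (n
    + 2)^2. Each of the two sums that remain is at most 2, whence 8 = 2 * (2 + 2).\<close>
  have pair: "1 / (x\<^sup>2 * y\<^sup>2) \<le> 2 / (x + y)\<^sup>2 * (1 / x\<^sup>2 + 1 / y\<^sup>2)" if "0 < x" "0 < y" for x y :: real
  proof -
    have "(x + y)\<^sup>2 \<le> 2 * (x\<^sup>2 + y\<^sup>2)"
      using zero_le_power2[of "x - y"] by (simp add: power2_eq_square algebra_simps)
    then have "(x + y)\<^sup>2 / ((x + y)\<^sup>2 * (x\<^sup>2 * y\<^sup>2)) \<le> 2 * (x\<^sup>2 + y\<^sup>2) / ((x + y)\<^sup>2 * (x\<^sup>2 * y\<^sup>2))"
      using that by (intro divide_right_mono) auto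
    moreover have "x + y \<noteq> 0"
      using that by simp
    ultimately show ?thesis
      using that by (simp add: field_simps)
  qed
  have "(\<Sum>c\<le>n. 1 / (real (Suc c) ^ 2 * real (Suc (n - c)) ^ 2))
      \<le> (\<Sum>c\<le>n. 2 / real (n + 2) ^ 2 * (1 / real (Suc c) ^ 2 + 1 / real (Suc (n - c)) ^ 2))"
  proof (rule sum_mono)
    fix c assume "c \<in> {..n}"
    then have "real (Suc c) + real (Suc (n - c)) = real (n + 2)"
      by simp
    then show "1 / (real (Suc c) ^ 2 * real (Suc (n - c)) ^ 2)
        \<le> 2 / real (n + 2) ^ 2 * (1 / real (Suc c) ^ 2 + 1 / real (Suc (n - c)) ^ 2)"
      using pair[of "real (Suc c)" "real (Suc (n - c))"] by simp
  qed
  also have "\<dots> = 2 / real (n + 2) ^ 2 * (s + (\<Sum>c\<le>n. 1 / real (Suc (n - c)) ^ 2))"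
    by (simp only: s_def sum_distrib_left[symmetric] sum.distrib)
  also have "(\<Sum>c\<le>n. 1 / real (Suc (n - c)) ^ 2) = s"
    unfolding s_def by (rule sum.reindex_bij_witness[where i = "\<lambda>c. n - c" and j = "\<lambda>c. n - c"]) auto
  also have "2 / real (n + 2) ^ 2 * (s + s) \<le> 2 / real (n + 2) ^ 2 * 4"
    using sum_inverse_squares_le[of n] by (intro mult_left_mono) (auto simp: s_def intro: order_trans)
  finally show ?thesis
    by simp
qed

section \<open>Polynomials in cumulants against the bound\<close>

lemma sum_Pow_card:
  assumes "finite B"
  shows "(\<Sum>C\<in>Pow B. h (card C)) = (\<Sum>c\<le>card B. real (card B choose c) * h c)"
proof -
  have "(\<Sum>C\<in>Pow B. h (card C)) = (\<Sum>c\<le>card B. \<Sum>C\<in>{C\<in>Pow B. card C = c}. h (card C))"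
    using assms by (intro sum.group[symmetric]) (auto intro: card_mono)
  also have "\<dots> = (\<Sum>c\<le>card B. real (card B choose c) * h c)"
  proof (rule sum.cong[OF refl])
    fix c
    have "card {C\<in>Pow B. card C = c} = card B choose c"
      using n_subsets[OF assms, of c] by simp
    then show "(\<Sum>C\<in>{C\<in>Pow B. card C = c}. h (card C)) = real (card B choose c) * h c"
      by simp
  qed
  finally show ?thesis .
qed

lemma norm_conv_le:
  fixes f g :: "'a set \<Rightarrow> complex"
  assumes "finite B" "\<And>C. C \<subseteq> B \<Longrightarrow> cmod (f C * g (B - C)) \<le> h (card C)"
  shows "cmod (conv f g B) \<le> (\<Sum>c\<le>card B. real (card B choose c) * h c)"
  unfolding conv_def sum_Pow_card[OF assms(1), symmetric]
  by (rule sum_norm_le) (use assms in auto)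

definition small_cum :: "nat \<Rightarrow> ('a set \<Rightarrow> complex) \<Rightarrow> bool" where
  "small_cum N M \<longleftrightarrow>
     (\<forall>A. finite A \<longrightarrow> A \<noteq> {} \<longrightarrow> card A \<le> N \<longrightarrow> cmod (cum M A) \<le> cum_bound N (card A))"

lemma small_cumD: "small_cum N M \<Longrightarrow> finite A \<Longrightarrow> card A = Suc n \<Longrightarrow> Suc n \<le> N \<Longrightarrow>
    cmod (cum M A) \<le> cum_bound N (Suc n)"
  by (auto simp: small_cum_def)

text \<open>The binomial coefficient merges c! (n - c)! into n!, the powers of N add up, and what
  remains is the convolution of inverse squares, whence 32 = 4 * 8. Two separate cumulants carry one
  power of 1 / N less than the joint one.\<close>

lemma norm_cum_pair_le:
  assumes M: "small_cum N M" and B: "finite B" "k \<notin> B" "l \<notin> B" "k \<noteq> l" "card B + 2 \<le> N"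
  shows "cmod (cum_pair M k l B) \<le>
    cum_bound N (card B + 2) + 32 * fact (card B) / (real N ^ card B * real (card B + 2) ^ 2)"
proof -
  define n where "n = card B"
  have "cmod (conv (\<lambda>C. cum M (insert k C)) (\<lambda>C. cum M (insert l C)) B)
      \<le> (\<Sum>c\<le>card B. real (card B choose c) * (cum_bound N (Suc c) * cum_bound N (Suc (n - c))))"
  proof (rule norm_conv_le[OF B(1)])
    fix C assume C: "C \<subseteq> B"
    then have fin: "finite C" "card C \<le> n" "card (B - C) = n - card C"
      using B(1) by (auto simp: n_def card_mono card_Diff_subset finite_subset)
    have "cmod (cum M (insert k C)) \<le> cum_bound N (Suc (card C))"
      using C B fin by (intro small_cumD[OF M]) (auto simp: card_insert_if n_def)
    moreover have "cmod (cum M (insert l (B - C))) \<le> cum_bound N (Suc (n - card C))"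
      using C B fin by (intro small_cumD[OF M]) (auto simp: card_insert_if n_def)
    ultimately show "cmod (cum M (insert k C) * cum M (insert l (B - C)))
        \<le> cum_bound N (Suc (card C)) * cum_bound N (Suc (n - card C))"
      unfolding norm_mult by (intro mult_mono) (auto simp: cum_bound_nonneg)
  qed
  also have "\<dots> = (\<Sum>c\<le>n. 4 * fact n / real N ^ n * (1 / (real (Suc c) ^ 2 * real (Suc (n - c)) ^ 2)))"
    unfolding n_def[symmetric]
  proof (rule sum.cong[OF refl])
    fix c assume c: "c \<in> {..n}"
    then have "real N ^ n = real N ^ c * real N ^ (n - c)"
      by (simp flip: power_add)
    moreover have "(fact n :: real) = fact c * fact (n - c) * real (n choose c)"
      using c binomial_fact_lemma[of c n] by (metis atMost_iff of_nat_fact of_nat_mult)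
    ultimately show "real (n choose c) * (cum_bound N (Suc c) * cum_bound N (Suc (n - c)))
        = 4 * fact n / real N ^ n * (1 / (real (Suc c) ^ 2 * real (Suc (n - c)) ^ 2))"
      by (simp add: cum_bound_def field_simps)
  qed
  also have "\<dots> \<le> 4 * fact n / real N ^ n * (8 / real (n + 2) ^ 2)"
    unfolding sum_distrib_left[symmetric]
    by (intro mult_left_mono sum_inverse_squares_conv_le) auto
  finally have "cmod (conv (\<lambda>C. cum M (insert k C)) (\<lambda>C. cum M (insert l C)) B)
      \<le> 32 * fact n / (real N ^ n * real (n + 2) ^ 2)"
    by simp
  moreover have "cmod (cum M (insert k (insert l B))) \<le> cum_bound N (Suc (Suc n))"
    using B by (intro small_cumD[OF M]) (auto simp: card_insert_if n_def)
  ultimately show ?thesis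
    unfolding cum_pair_def n_def[symmetric] by (intro norm_triangle_le add_mono) auto
qed

text \<open>Measured against the bound for |B| + 1 labels, the product term has the right power of N
  and the joint cumulant is smaller, so that 17 = 16 + 1 suffices.\<close>

lemma norm_cum_pair_le':
  assumes "small_cum N M" "finite B" "k \<notin> B" "l \<notin> B" "k \<noteq> l" "card B + 2 \<le> N"
  shows "cmod (cum_pair M k l B) \<le> 17 * cum_bound N (Suc (card B))"
proof -
  define n where "n = card B"
  have "32 * fact n / (real N ^ n * real (n + 2) ^ 2) \<le> 32 * fact n / (real N ^ n * real (Suc n) ^ 2)"
    using assms by (intro divide_left_mono mult_left_mono power_mono) auto
  also have "\<dots> = 16 * cum_bound N (Suc n)"
    by (simp add: cum_bound_def)
  finally have "32 * fact n / (real N ^ n * real (n + 2) ^ 2) \<le> 16 * cum_bound N (Suc n)" .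
  with norm_cum_pair_le[OF assms] cum_bound_Suc_le[of n N] assms(6) show ?thesis
    by (simp add: n_def[symmetric])
qed

text \<open>The right-hand side is measured by the bound for |B| + 1 labels, the order of the
  cumulant being evolved, so the estimate closes. The self-interaction gives 1, the pairs 17, the
  extra particle 17 and the correction for N - |A| gives 272, in sum 307.\<close>

lemma norm_cum_flow_le:
  fixes M M\<^sub>1 M\<^sub>3 :: "'a set \<Rightarrow> complex"
  assumes M: "small_cum N M" "small_cum N M\<^sub>1" "\<And>l. small_cum N (M\<^sub>2 l)" "small_cum N M\<^sub>3"
    and B: "finite B" "k \<notin> B" "z \<notin> B" "k \<noteq> z" and N: "Suc (card B) \<le> N"
  shows "cmod (cum_flow N k z M M\<^sub>1 M\<^sub>2 M\<^sub>3 B) \<le> 307 * cum_bound N (Suc (card B))"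
proof -
  define n where "n = card B"
  define b where "b = cum_bound N (Suc n)"
  have b: "0 \<le> b"
    by (simp add: b_def cum_bound_nonneg)
  have N0: "0 < real N" "1 \<le> real N"
    using N by auto
  have 1: "cmod (cum M\<^sub>1 (insert k B)) \<le> b"
    unfolding b_def using B N by (intro small_cumD[OF M(2)]) (auto simp: n_def)
  \<comment> \<open>There are n = j + 1 terms, and n j! = n! while N^j = N^n / N: the sum over
    \<open>l\<close> costs a factor N, which the prefactor 1 / N repays.\<close>
  have 2: "cmod (\<Sum>l\<in>B. cum_pair (M\<^sub>2 l) k l (B - {l})) \<le> real N * (17 * b)"
  proof (cases n)
    case 0
    then show ?thesis
      using B b by (simp add: n_def)
  next
    case (Suc j)
    have "cmod (\<Sum>l\<in>B. cum_pair (M\<^sub>2 l) k l (B - {l}))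
        \<le> real (card B) * (b + 32 * fact j / (real N ^ j * real (j + 2) ^ 2))"
    proof (rule order_trans[OF sum_norm_bound])
      fix l assume l: "l \<in> B"
      then have "card (B - {l}) = j"
        using B Suc by (simp add: n_def)
      then show "cmod (cum_pair (M\<^sub>2 l) k l (B - {l})) \<le> b + 32 * fact j / (real N ^ j * real (j + 2) ^ 2)"
        using norm_cum_pair_le[OF M(3), of "B - {l}" k l l] B N l Suc
        by (auto simp: b_def n_def)
    qed simp
    also have "\<dots> = real n * b + real N * (16 * b)"
      using N0 by (simp add: b_def cum_bound_def Suc n_def[symmetric] field_simps)
    also have "\<dots> \<le> real N * b + real N * (16 * b)"
      using N b by (intro add_right_mono mult_right_mono) (auto simp: n_def)
    finally show ?thesis
      by (simp add: algebra_simps)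
  qed
  \<comment> \<open>For \<open>Suc n = N\<close> the pair would comprise N + 1 labels, beyond the
    reach of \<open>small_cum\<close>, but the coefficient is then zero.\<close>
  have 3: "cmod (((of_nat N - 1 - of_nat (card B)) / of_nat N) * cum_pair M\<^sub>3 k z B) \<le> 17 * b"
  proof (cases "Suc n = N")
    case True
    then have "(of_nat N - 1 - of_nat (card B) :: complex) = 0"
      by (auto simp: n_def)
    then show ?thesis
      using b by simp
  next
    case False
    have "(of_nat N - 1 - of_nat (card B) :: complex) = of_real (real N - 1 - real n)"
      by (simp add: n_def)
    then have "cmod ((of_nat N - 1 - of_nat (card B)) / of_nat N) = (real N - 1 - real n) / real N"
      using N by (simp add: norm_divide n_def del: of_real_diff)
    also have "\<dots> \<le> 1"
      using N0 by simp
    finally have "cmod ((of_nat N - 1 - of_nat (card B)) / of_nat N) \<le> 1" .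
    moreover have "cmod (cum_pair M\<^sub>3 k z B) \<le> 17 * b"
      unfolding b_def n_def using B N False by (intro norm_cum_pair_le' M(4)) (auto simp: n_def)
    ultimately show ?thesis
      unfolding norm_mult using mult_mono[of _ 1] by (metis norm_ge_zero mult_1 zero_le_one)
  qed
  \<comment> \<open>The factor |C| removes the empty C, so the pair never has more than n + 1
    labels, hence at most N. It also turns (c - 1)! into c!, after which the constants are 68 = 17 *
    2 * 2 and 272 = 68 * 8 / 2.\<close>
  have 4: "cmod (conv (\<lambda>C. of_nat (card C) * cum M C) (cum_pair M\<^sub>3 k z) B) \<le> real N * (272 * b)"
  proof (cases n)
    case 0
    then show ?thesis
      using B b by (simp add: n_def)
  next
    case (Suc j)
    have "cmod (conv (\<lambda>C. of_nat (card C) * cum M C) (cum_pair M\<^sub>3 k z) B)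
        \<le> (\<Sum>c\<le>card B. real (card B choose c) * (real c * cum_bound N c * (17 * cum_bound N (Suc (n - c)))))"
    proof (rule norm_conv_le[OF B(1)])
      fix C assume C: "C \<subseteq> B"
      then have fin: "finite C" "card C \<le> n" "card (B - C) = n - card C"
        using B(1) by (auto simp: n_def card_mono card_Diff_subset finite_subset)
      show "cmod (of_nat (card C) * cum M C * cum_pair M\<^sub>3 k z (B - C))
          \<le> real (card C) * cum_bound N (card C) * (17 * cum_bound N (Suc (n - card C)))"
      proof (cases "C = {}")
        case False
        then have pos: "0 < card C"
          using fin by (simp add: card_gt_0_iff)
        have "cmod (cum M C) \<le> cum_bound N (card C)"
          using M(1) fin False N by (auto simp: small_cum_def n_def)
        moreover have "cmod (cum_pair M\<^sub>3 k z (B - C)) \<le> 17 * cum_bound N (Suc (n - card C))"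
          unfolding fin(3)[symmetric] using B N fin pos
          by (intro norm_cum_pair_le' M(4)) (auto simp: n_def)
        ultimately show ?thesis
          unfolding norm_mult norm_of_nat
          by (intro mult_mono mult_left_mono mult_nonneg_nonneg) (auto simp: cum_bound_nonneg)
      qed simp
    qed
    also have "\<dots> = (\<Sum>c\<le>j. real (n choose Suc c) *
        (real (Suc c) * cum_bound N (Suc c) * (17 * cum_bound N (Suc (j - c)))))"
      unfolding n_def[symmetric] Suc by (subst sum.atMost_Suc_shift) simp
    also have "\<dots> = (\<Sum>c\<le>j. 68 * fact n / real N ^ j * (1 / (real (Suc c) ^ 2 * real (Suc (j - c)) ^ 2)))"
    proof (rule sum.cong[OF refl])
      fix c assume c: "c \<in> {..j}"
      then have "real N ^ j = real N ^ c * real N ^ (j - c)"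
        by (simp flip: power_add)
      moreover have "(fact n :: real) = fact (Suc c) * fact (j - c) * real (n choose Suc c)"
        using c binomial_fact_lemma[of "Suc c" n] Suc
        by (metis Suc_le_mono atMost_iff diff_Suc_Suc of_nat_fact of_nat_mult)
      ultimately show "real (n choose Suc c) *
          (real (Suc c) * cum_bound N (Suc c) * (17 * cum_bound N (Suc (j - c))))
          = 68 * fact n / real N ^ j * (1 / (real (Suc c) ^ 2 * real (Suc (j - c)) ^ 2))"
        by (simp add: cum_bound_def field_simps)
    qed
    also have "\<dots> \<le> 68 * fact n / real N ^ j * (8 / real (j + 2) ^ 2)"
      unfolding sum_distrib_left[symmetric]
      by (intro mult_left_mono sum_inverse_squares_conv_le) auto
    also have "\<dots> = real N * (272 * b)"
      using N0 by (simp add: b_def cum_bound_def Suc field_simps)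
    finally show ?thesis .
  qed
  have "cmod (cum_flow N k z M M\<^sub>1 M\<^sub>2 M\<^sub>3 B) \<le>
      1 / real N * (b + real N * (17 * b)) + 17 * b + 1 / real N * (real N * (272 * b))"
    unfolding cum_flow_def
  proof (intro norm_triangle_le_diff norm_triangle_le add_mono 3)
    show "cmod (1 / of_nat N * (cum M\<^sub>1 (insert k B) + (\<Sum>l\<in>B. cum_pair (M\<^sub>2 l) k l (B - {l}))))
        \<le> 1 / real N * (b + real N * (17 * b))"
      unfolding norm_mult norm_divide norm_one norm_of_nat
      by (intro mult_left_mono norm_triangle_le add_mono 1 2) auto
    show "cmod (1 / of_nat N * conv (\<lambda>C. of_nat (card C) * cum M C) (cum_pair M\<^sub>3 k z) B)
        \<le> 1 / real N * (real N * (272 * b))"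
      unfolding norm_mult norm_divide norm_one norm_of_nat
      by (intro mult_left_mono 4) auto
  qed
  also have "\<dots> = b / real N + 306 * b"
    using N0 by (simp add: field_simps)
  also have "\<dots> \<le> 307 * b"
    using b N0 by (simp add: divide_le_eq mult_left_mono mult_le_cancel_left1)
  finally show ?thesis
    by (simp add: b_def n_def)
qed

section \<open>Fourier coefficients of marginals\<close>

declare One_nat_def [simp del]

lemma unit_box_sets: "{x :: real ^ 'd. \<forall>i. 0 \<le> x $ i \<and> x $ i < 1} \<in> sets lborel"
  by measurable

text \<open>The half-open cube lies between the open and the closed unit cube, both of volume
  one.\<close>

lemma prob_space_torus: "prob_space (torus :: (real ^ 'd) measure)"
  unfolding torus_def
proof (rule prob_space_restrict_space[OF unit_box_sets], rule antisym)
  have unit: "(\<Prod>b\<in>Basis. (1 - 0 :: real ^ 'd) \<bullet> b) = 1"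
    by (rule prod.neutral) (auto simp: Basis_vec_def inner_axis)
  let ?H = "{x :: real ^ 'd. \<forall>i. 0 \<le> x $ i \<and> x $ i < 1}"
  have "emeasure lborel ?H \<le> emeasure lborel (cbox 0 (1 :: real ^ 'd))"
    by (rule emeasure_mono) (auto simp: mem_box_cart less_imp_le)
  also have "\<dots> = 1"
    using unit by (subst emeasure_lborel_cbox) (auto simp: Basis_vec_def inner_axis)
  finally show "emeasure lborel ?H \<le> 1" .
  have "1 = emeasure lborel (box 0 (1 :: real ^ 'd))"
    using unit by (subst emeasure_lborel_box) (auto simp: Basis_vec_def inner_axis)
  also have "\<dots> \<le> emeasure lborel ?H"
    using unit_box_sets by (intro emeasure_mono) (auto simp: mem_box_cart less_imp_le)
  finally show "1 \<le> emeasure lborel ?H" .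
qed

interpretation torus: prob_space torus
  by (rule prob_space_torus)

interpretation tori: product_prob_space "\<lambda>_ :: nat. torus" UNIV
  by unfold_locales

lemma prob_space_conf: "prob_space (conf P)"
  unfolding conf_def by (intro prob_space_PiM prob_space_torus)

lemma measurable_torus_id [measurable]: "(\<lambda>x. x) \<in> torus \<rightarrow>\<^sub>M borel"
  unfolding torus_def by (rule measurable_restrict_space1) simp

lemma measurable_torusI: "f \<in> borel_measurable borel \<Longrightarrow> f \<in> borel_measurable torus"
  unfolding torus_def by (rule measurable_restrict_space1) simp

lemma measurable_conf_component: "k \<in> P \<Longrightarrow> (\<lambda>x. x k) \<in> conf P \<rightarrow>\<^sub>M torus"
  unfolding conf_def by (rule measurable_component_singleton)

lemma borel_measurable_conf_component:
  "k \<in> P \<Longrightarrow> (\<lambda>x. x k) \<in> borel_measurable (conf P)"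
  by (rule measurable_compose[OF measurable_conf_component measurable_torus_id])

lemma borel_measurable_freq_inner [measurable]: "freq_inner \<xi> \<in> borel_measurable borel"
  unfolding freq_inner_def by measurable

lemma borel_measurable_freq_inner_component:
  "k \<in> P \<Longrightarrow> (\<lambda>x. freq_inner \<xi> (x k)) \<in> borel_measurable (conf P)"
  by (rule measurable_compose[OF borel_measurable_conf_component]) auto

section \<open>Fourier coefficients of functions of several particles\<close>

definition phase :: "nat set \<Rightarrow> (nat \<Rightarrow> int ^ 'd) \<Rightarrow> (nat \<Rightarrow> real ^ 'd) \<Rightarrow> real" where
  "phase P \<xi> x = 2 * pi * (\<Sum>k\<in>P. freq_inner (\<xi> k) (x k))"

lemma borel_measurable_phase [measurable]: "phase P \<xi> \<in> borel_measurable (conf P)"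
  unfolding phase_def
  by (intro borel_measurable_times borel_measurable_const borel_measurable_sum
      borel_measurable_freq_inner_component)

lemma borel_measurable_cis [measurable]: "cis \<in> borel_measurable borel"
  by (intro borel_measurable_continuous_onI continuous_intros)

lemma fourier_coeff_phase: "fourier_coeff P h \<xi> = (LINT x|conf P. complex_of_real (h x) * cis (- phase P \<xi> x))"
  by (simp add: fourier_coeff_def phase_def)

lemma integrable_mult_bounded:
  fixes f g :: "'a \<Rightarrow> 'b::{real_normed_field,banach,second_countable_topology}"
  assumes "integrable M f" "g \<in> borel_measurable M" "\<And>x. x \<in> space M \<Longrightarrow> norm (g x) \<le> c"
  shows "integrable M (\<lambda>x. f x * g x)"
proof (rule Bochner_Integration.integrable_bound)
  show "integrable M (\<lambda>x. c * norm (f x))"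
    using assms(1) by simp
  show "(\<lambda>x. f x * g x) \<in> borel_measurable M"
    using assms by (intro borel_measurable_times) auto
  have "norm (f x * g x) \<le> norm (c * norm (f x))" if "x \<in> space M" for x
  proof -
    have "norm (f x) * norm (g x) \<le> norm (f x) * c"
      using assms(3)[OF that] by (intro mult_left_mono) auto
    also have "\<dots> \<le> norm (c * norm (f x))"
      by (simp add: abs_mult mult.commute[of _ c] mult_right_mono)
    finally show ?thesis
      by (simp add: norm_mult)
  qed
  then show "AE x in M. norm (f x * g x) \<le> norm (c * norm (f x))"
    by auto
qed

lemma integrable_fourier:
  assumes "integrable (conf P) h"
  shows "integrable (conf P) (\<lambda>x. complex_of_real (h x) * cis (- phase P \<xi> x))"
  using assms by (intro integrable_mult_bounded[where c = 1]) auto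

lemma norm_fourier_coeff_le: "cmod (fourier_coeff P h \<xi>) \<le> (LINT x|conf P. \<bar>h x\<bar>)"
proof -
  have "cmod (fourier_coeff P h \<xi>) \<le> (LINT x|conf P. cmod (complex_of_real (h x) * cis (- phase P \<xi> x)))"
    unfolding fourier_coeff_phase by (rule integral_norm_bound)
  then show ?thesis
    by (simp add: norm_mult)
qed

lemma fourier_coeff_diff:
  assumes "integrable (conf P) h" "integrable (conf P) h'"
  shows "fourier_coeff P (\<lambda>x. h x - h' x) \<xi> = fourier_coeff P h \<xi> - fourier_coeff P h' \<xi>"
  using integrable_fourier[OF assms(1), of \<xi>] integrable_fourier[OF assms(2), of \<xi>]
  unfolding fourier_coeff_phase by (simp add: left_diff_distrib)

text \<open>Follows the labelling in \<open>marginal\<close>: the labels in increasing order become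
  1, ..., |P|. Frequency zero on the other coordinates integrates them out, so that a coefficient of
  a marginal is a coefficient of the full density.\<close>

definition relabel :: "nat set \<Rightarrow> (nat \<Rightarrow> 'a) \<Rightarrow> nat \<Rightarrow> 'a::zero" where
  "relabel P \<xi> i = (if i \<in> {1..card P} then \<xi> (sorted_list_of_set P ! (i - 1)) else 0)"

text \<open>
  For \<open>card P > N\<close> this is a junk value; it occurs in the hierarchy only for \<open>j = N\<close>, with coefficient zero.
\<close>

definition moment :: "nat \<Rightarrow> ((nat \<Rightarrow> real ^ 'd) \<Rightarrow> real) \<Rightarrow> (nat \<Rightarrow> int ^ 'd) \<Rightarrow> nat set \<Rightarrow> complex" where
  "moment N F \<xi> P = fourier_coeff {1..N} F (relabel P \<xi>)"

lemma bij_betw_sorted_list: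
  assumes "finite P"
  shows "bij_betw (\<lambda>i. sorted_list_of_set P ! (i - 1)) {1..card P} P"
proof -
  have "bij_betw (\<lambda>i. i - 1) {1..card P} {..<card P}"
    by (rule bij_betw_byWitness[where f' = Suc]) auto
  moreover have "bij_betw ((!) (sorted_list_of_set P)) {..<card P} P"
    using assms by (intro bij_betw_nth) auto
  ultimately show ?thesis
    using bij_betw_trans by (fastforce simp: comp_def)
qed

lemma borel_measurable_marginal_inner:
  fixes F :: "(nat \<Rightarrow> real ^ 'd) \<Rightarrow> real"
  assumes "integrable (conf {1..N}) F" "p \<le> N"
  shows "(\<lambda>w. LINT y|conf {p + 1..N}. F (merge {1..p} {p + 1..N} (w, y))) \<in> borel_measurable (conf {1..p})"
    and "integrable (conf {1..p}) (\<lambda>w. LINT y|conf {p + 1..N}. F (merge {1..p} {p + 1..N} (w, y)))"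
proof -
  interpret P: pair_sigma_finite "conf {1..p}" "conf {p + 1..N}"
    by (intro pair_sigma_finite.intro prob_space_imp_sigma_finite prob_space_conf)
  have I: "{1..N} = {1..p} \<union> {p + 1..N}"
    using assms(2) by auto
  have distr: "distr (conf {1..p} \<Otimes>\<^sub>M conf {p + 1..N}) (conf {1..N}) (merge {1..p} {p + 1..N}) = conf {1..N}"
    unfolding conf_def I by (rule tori.distr_merge) auto
  have merge: "merge {1..p} {p + 1..N} \<in> conf {1..p} \<Otimes>\<^sub>M conf {p + 1..N} \<rightarrow>\<^sub>M conf {1..N}"
    unfolding conf_def I by (rule measurable_merge)
  have "integrable (conf {1..p} \<Otimes>\<^sub>M conf {p + 1..N}) (\<lambda>x. F (merge {1..p} {p + 1..N} x))"
    by (rule integrable_distr[OF merge]) (simp only: distr assms(1))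
  from P.integrable_fst'[OF this]
  show "integrable (conf {1..p}) (\<lambda>w. LINT y|conf {p + 1..N}. F (merge {1..p} {p + 1..N} (w, y)))"
    by simp
  then show "(\<lambda>w. LINT y|conf {p + 1..N}. F (merge {1..p} {p + 1..N} (w, y))) \<in> borel_measurable (conf {1..p})"
    by auto
qed

text \<open>Listing the labels in order is a measure-preserving map onto the first |P| coordinates.
  Fubini then integrates out the rest, which the phase does not see because \<open>relabel\<close>
  is zero there.\<close>

lemma
  fixes F :: "(nat \<Rightarrow> real ^ 'd) \<Rightarrow> real"
  assumes F: "integrable (conf {1..N}) F" and P: "finite P" "card P \<le> N"
  shows integrable_marginal: "integrable (conf P) (marginal N F P)"
    and fourier_coeff_marginal: "fourier_coeff P (marginal N F P) \<xi> = moment N F \<xi> P"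
proof -
  define p where "p = card P"
  define s where "s i = sorted_list_of_set P ! (i - 1)" for i
  define G where "G w = (LINT y|conf {p + 1..N}. F (merge {1..p} {p + 1..N} (w, y)))" for w
  define T where "T = (\<lambda>x :: nat \<Rightarrow> real ^ 'd. \<lambda>i\<in>{1..p}. x (s i))"
  have s: "bij_betw s {1..p} P"
    using bij_betw_sorted_list[OF P(1)] by (simp add: s_def[abs_def] p_def)
  have T_distr: "distr (conf P) (conf {1..p}) T = conf {1..p}"
    unfolding conf_def T_def using s
    by (intro distr_PiM_reindex prob_space_torus) (auto simp: bij_betw_def)
  have T [measurable]: "T \<in> conf P \<rightarrow>\<^sub>M conf {1..p}"
    unfolding conf_def T_def using s
    by (intro measurable_restrict measurable_component_singleton) (auto simp: bij_betw_def)
  have G: "integrable (conf {1..p}) G" and G_meas [measurable]: "G \<in> borel_measurable (conf {1..p})"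
    unfolding G_def[abs_def] using borel_measurable_marginal_inner[OF F] P by (auto simp: p_def)
  have marg: "marginal N F P x = G (T x)" for x
  proof -
    have "merge {1..p} {p + 1..N} (\<lambda>i. x (s i), y) = merge {1..p} {p + 1..N} (T x, y)" for y
      by (auto simp: merge_def T_def)
    then show ?thesis
      by (simp add: marginal_def G_def p_def s_def)
  qed
  show "integrable (conf P) (marginal N F P)"
    unfolding marg[abs_def] by (rule integrable_distr[OF T]) (simp only: T_distr G)
  have phase_T: "phase P \<xi> x = phase {1..p} (relabel P \<xi>) (T x)" for x
  proof -
    have "(\<Sum>k\<in>P. freq_inner (\<xi> k) (x k)) = (\<Sum>i\<in>{1..p}. freq_inner (\<xi> (s i)) (x (s i)))"
      by (rule sum.reindex_bij_betw[OF s, symmetric])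
    then show ?thesis
      by (simp add: phase_def relabel_def T_def s_def p_def)
  qed
  have phase_merge: "phase {1..p} (relabel P \<xi>) w = phase {1..N} (relabel P \<xi>) (merge {1..p} {p + 1..N} (w, y))" for w y
  proof -
    have "(\<Sum>k\<in>{1..N}. freq_inner (relabel P \<xi> k) (merge {1..p} {p + 1..N} (w, y) k))
        = (\<Sum>k\<in>{1..p}. freq_inner (relabel P \<xi> k) (merge {1..p} {p + 1..N} (w, y) k))"
      using P by (intro sum.mono_neutral_right) (auto simp: relabel_def p_def freq_inner_def)
    then show ?thesis
      by (simp add: phase_def)
  qed
  have I: "{1..N} = {1..p} \<union> {p + 1..N}"
    using P by (auto simp: p_def)
  have "fourier_coeff P (marginal N F P) \<xi>
      = (LINT x|conf P. complex_of_real (G (T x)) * cis (- phase {1..p} (relabel P \<xi>) (T x)))"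
    by (simp add: fourier_coeff_phase marg phase_T)
  also have "\<dots> = (LINT w|distr (conf P) (conf {1..p}) T.
      complex_of_real (G w) * cis (- phase {1..p} (relabel P \<xi>) w))"
    by (rule integral_distr[symmetric]) auto
  also have "\<dots> = (LINT w|conf {1..p}. complex_of_real (G w) * cis (- phase {1..p} (relabel P \<xi>) w))"
    by (simp only: T_distr)
  also have "\<dots> = (LINT w|conf {1..p}. LINT y|conf {p + 1..N}.
      complex_of_real (F (merge {1..p} {p + 1..N} (w, y))) *
      cis (- phase {1..N} (relabel P \<xi>) (merge {1..p} {p + 1..N} (w, y))))"
    unfolding G_def phase_merge[symmetric] by simp
  also have "\<dots> = fourier_coeff {1..N} F (relabel P \<xi>)"
    unfolding fourier_coeff_phase
    using integrable_fourier[OF F, of "relabel P \<xi>"] unfolding conf_def I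
    by (intro tori.product_integral_fold[symmetric]) auto
  finally show "fourier_coeff P (marginal N F P) \<xi> = moment N F \<xi> P"
    by (simp add: moment_def)
qed

lemma moment_empty:
  assumes "probability_density (conf {1..N}) F"
  shows "moment N F \<xi> {} = 1"
proof -
  have "moment N F \<xi> {} = (LINT x|conf {1..N}. complex_of_real (F x))"
    by (simp add: moment_def fourier_coeff_def relabel_def[abs_def] freq_inner_def)
  then show ?thesis
    using assms by (simp add: probability_density_def)
qed

lemma norm_moment_le:
  assumes "probability_density (conf {1..N}) F"
  shows "cmod (moment N F \<xi> A) \<le> 1"
proof -
  have "(LINT x|conf {1..N}. \<bar>F x\<bar>) = (LINT x|conf {1..N}. F x)"
    using assms by (intro integral_cong_AE) (auto simp: probability_density_def simp del: One_nat_def)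
  then show ?thesis
    using norm_fourier_coeff_le[of "{1..N}" F "relabel A \<xi>"] assms
    by (simp add: moment_def probability_density_def)
qed

lemma moment_cong:
  assumes "finite A" "\<And>k. k \<in> A \<Longrightarrow> \<xi> k = \<xi>' k"
  shows "moment N F \<xi> A = moment N F \<xi>' A"
proof -
  have "relabel A \<xi> = relabel A \<xi>'"
    using bij_betw_apply[OF bij_betw_sorted_list[OF assms(1)]] assms(2) by (auto simp: relabel_def)
  then show ?thesis
    by (simp add: moment_def)
qed

text \<open>\<open>relabel\<close> lists labels in increasing order, and an increasing map keeps
  that order, so both moments are literally the same coefficient.\<close>

lemma moment_image:
  assumes "finite A" "strict_mono_on A s"
  shows "moment N F \<xi> (s ` A) = moment N F (\<lambda>i. \<xi> (s i)) A"
proof -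
  have inj: "inj_on s A"
    using assms(2) by (rule strict_mono_on_imp_inj_on)
  have "sorted_list_of_set (s ` A) = map s (sorted_list_of_set A)"
  proof (rule sorted_list_of_set_unique[THEN iffD1])
    show "finite (s ` A)"
      using assms by simp
    have "sorted_wrt (\<lambda>x y. s x < s y) (sorted_list_of_set A)"
      using assms by (intro sorted_wrt_mono_rel[OF _ strict_sorted_list_of_set]) (auto dest: strict_mono_onD)
    then show "sorted_wrt (<) (map s (sorted_list_of_set A)) \<and>
        set (map s (sorted_list_of_set A)) = s ` A \<and> length (map s (sorted_list_of_set A)) = card (s ` A)"
      using assms inj by (simp add: sorted_wrt_map card_image)
  qed
  then have "relabel (s ` A) \<xi> = relabel A (\<lambda>i. \<xi> (s i))"
    using assms inj by (auto simp: relabel_def card_image fun_eq_iff)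
  then show ?thesis
    by (simp add: moment_def)
qed

text \<open>Under the product measure the coordinates are independent, hence so are functions of
  disjoint blocks. Independence also yields integrability of the product, which for factors that are
  merely integrable is not automatic.\<close>

lemma integral_prod_blocks:
  fixes H :: "nat set \<Rightarrow> (nat \<Rightarrow> real ^ 'd) \<Rightarrow> complex"
  assumes "finite \<pi>" "disjoint \<pi>" "{} \<notin> \<pi>" "\<And>P. P \<in> \<pi> \<Longrightarrow> finite P" "\<And>P. P \<in> \<pi> \<Longrightarrow> P \<subseteq> A" "finite A"
    and int: "\<And>P. P \<in> \<pi> \<Longrightarrow> integrable (conf P) (H P)"
    and loc: "\<And>P x. P \<in> \<pi> \<Longrightarrow> H P (restrict x P) = H P x"
  shows "integrable (conf A) (\<lambda>x. \<Prod>P\<in>\<pi>. H P x)"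
    and "(LINT x|conf A. (\<Prod>P\<in>\<pi>. H P x)) = (\<Prod>P\<in>\<pi>. LINT x|conf P. H P x)"
proof -
  interpret conf: prob_space "conf A :: (nat \<Rightarrow> real ^ 'd) measure"
    by (rule prob_space_conf)
  have distr: "distr (conf A) (conf P) (\<lambda>x. restrict x P) = conf P" if "P \<in> \<pi>" for P
    unfolding conf_def using assms(5)[OF that] assms(6) that
    by (intro product_prob_space.distr_PiM_restrict_finite) (auto intro: assms finite_subset, unfold_locales)
  have restr: "(\<lambda>x. restrict x P) \<in> conf A \<rightarrow>\<^sub>M conf P" if "P \<in> \<pi>" for P
    unfolding conf_def using assms(5)[OF that] by (rule measurable_restrict_subset)
  have meas: "H P \<in> borel_measurable (conf P)" if "P \<in> \<pi>" for P
    using int[OF that] by auto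
  have intA: "integrable (conf A) (H P)" if "P \<in> \<pi>" for P
  proof -
    have "integrable (conf A) (\<lambda>x. H P (restrict x P))"
      by (rule integrable_distr[OF restr[OF that]]) (simp add: distr int that)
    then show ?thesis
      by (simp add: loc that)
  qed
  have valA: "(LINT x|conf A. H P x) = (LINT x|conf P. H P x)" if "P \<in> \<pi>" for P
  proof -
    have "(LINT x|distr (conf A) (conf P) (\<lambda>x. restrict x P). H P x) = (LINT x|conf A. H P (restrict x P))"
      using that by (intro integral_distr restr meas)
    then show ?thesis
      by (simp add: distr loc that)
  qed
  have indep: "conf.indep_vars (\<lambda>_. borel) H \<pi>"
  proof (cases "A = {}")
    case False
    have "conf.indep_vars (\<lambda>_. torus) (\<lambda>i x :: nat \<Rightarrow> real ^ 'd. x i) A"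
    proof (rule conf.indep_vars_iff_distr_eq_PiM'[OF False, THEN iffD2])
      show "(\<lambda>x :: nat \<Rightarrow> real ^ 'd. x i) \<in> conf A \<rightarrow>\<^sub>M torus" if "i \<in> A" for i
        using that by (rule measurable_conf_component)
      have "distr (conf A) torus (\<lambda>x :: nat \<Rightarrow> real ^ 'd. x i) = torus" if "i \<in> A" for i
        unfolding conf_def using that by (intro distr_PiM_component prob_space_torus) auto
      then have "Pi\<^sub>M A (\<lambda>i. distr (conf A) torus (\<lambda>x :: nat \<Rightarrow> real ^ 'd. x i)) = conf A"
        unfolding conf_def by (intro PiM_cong) (auto simp: conf_def)
      moreover have "distr (conf A) (Pi\<^sub>M A (\<lambda>_. torus)) (\<lambda>x :: nat \<Rightarrow> real ^ 'd. \<lambda>i\<in>A. x i) = conf A"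
      proof -
        have "distr (conf A) (conf A) (\<lambda>x :: nat \<Rightarrow> real ^ 'd. restrict x A) = distr (conf A) (conf A) (\<lambda>x. x)"
          by (rule distr_cong) (auto simp: conf_def space_PiM)
        then show ?thesis
          by (simp add: conf_def)
      qed
      ultimately show "distr (conf A) (Pi\<^sub>M A (\<lambda>_. torus)) (\<lambda>x. \<lambda>i\<in>A. x i) =
          Pi\<^sub>M A (\<lambda>i. distr (conf A) torus (\<lambda>x :: nat \<Rightarrow> real ^ 'd. x i))"
        by simp
    qed
    then have "conf.indep_vars (\<lambda>P. Pi\<^sub>M P (\<lambda>_. torus)) (\<lambda>P x. restrict (\<lambda>i. x i) P) \<pi>"
    proof (rule conf.indep_vars_restrict)
      show "disjoint_family_on (\<lambda>P. P) \<pi>"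
        using assms(2) by (auto simp: disjoint_family_on_def disjoint_def)
    qed (rule assms(5))
    then have "conf.indep_vars (\<lambda>_. borel) (\<lambda>P x. H P (restrict (\<lambda>i. x i) P)) \<pi>"
      by (rule conf.indep_vars_compose2[where Y = H]) (use meas in \<open>simp add: conf_def\<close>)
    then show ?thesis
      by (rule conf.indep_vars_cong[THEN iffD1, rotated -1]) (simp_all add: loc)
  next
    \<comment> \<open>The criterion for independent coordinates wants a nonempty index set. Over an
      empty \<open>A\<close> there is no nonempty block, so the family of blocks is empty.\<close>
    case True
    then have "\<pi> = {}"
      using assms(3,5) by auto
    then show ?thesis
      by (simp add: conf.indep_vars_def conf.indep_sets_def)
  qed
  show "integrable (conf A) (\<lambda>x. \<Prod>P\<in>\<pi>. H P x)"
    using assms(1) indep intA by (rule conf.indep_vars_integrable)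
  show "(LINT x|conf A. (\<Prod>P\<in>\<pi>. H P x)) = (\<Prod>P\<in>\<pi>. LINT x|conf P. H P x)"
    using conf.indep_vars_lebesgue_integral[OF assms(1) indep intA] valA by simp
qed

text \<open>A character of all m particles factorises along every partition, so the Fourier
  transform turns each product of marginals into the product of the corresponding moments.\<close>

lemma fourier_coeff_correlation:
  assumes F: "integrable (conf {1..N}) F" and m: "m \<le> N"
  shows "fourier_coeff {1..m} (correlation N F m) \<xi> = cum (moment N F \<xi>) {1..m}"
proof -
  define c :: "nat \<Rightarrow> real" where "c n = (-1) ^ (n - 1) * fact (n - 1)" for n
  define H where "H P x = complex_of_real (marginal N F P x) * cis (- phase P \<xi> x)" for P x
  have part: "finite \<pi>" "disjoint \<pi>" "\<And>P. P \<in> \<pi> \<Longrightarrow> finite P" "\<And>P. P \<in> \<pi> \<Longrightarrow> P \<subseteq> {1..m}"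
    "\<And>P. P \<in> \<pi> \<Longrightarrow> card P \<le> N" "\<Union>\<pi> = {1..m}" "{} \<notin> \<pi>"
    if "partition_on {1..m} \<pi>" for \<pi>
  proof -
    show "finite \<pi>"
      using that by (rule finite_elements[rotated]) simp
    show "{} \<notin> \<pi>"
      using that by (rule partition_onD3)
    show "disjoint \<pi>"
      using that by (rule partition_onD2)
    show *: "\<Union>\<pi> = {1..m}"
      using partition_onD1[OF that] by simp
    show **: "P \<subseteq> {1..m}" if "P \<in> \<pi>" for P
      using that * by auto
    show "finite P" if "P \<in> \<pi>" for P
      using **[OF that] by (rule finite_subset) simp
    show "card P \<le> N" if "P \<in> \<pi>" for P
      using card_mono[OF _ **[OF that]] m by simp
  qed
  have H_loc: "H P (restrict x P) = H P x" if "finite P" for P x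
  proof -
    have "marginal N F P (restrict x P) = marginal N F P x"
    proof -
      have "merge {1..card P} {card P + 1..N} (\<lambda>i. restrict x P (sorted_list_of_set P ! (i - 1)), y)
          = merge {1..card P} {card P + 1..N} (\<lambda>i. x (sorted_list_of_set P ! (i - 1)), y)" for y
        using bij_betw_apply[OF bij_betw_sorted_list[OF that]] by (auto simp: merge_def)
      then show ?thesis
        by (simp add: marginal_def)
    qed
    moreover have "phase P \<xi> (restrict x P) = phase P \<xi> x"
      by (simp add: phase_def)
    ultimately show ?thesis
      by (simp add: H_def)
  qed
  have H_int: "integrable (conf P) (H P)" if "finite P" "card P \<le> N" for P
    unfolding H_def using integrable_marginal[OF F that] by (rule integrable_fourier)
  have H_val: "(LINT x|conf P. H P x) = moment N F \<xi> P" if "finite P" "card P \<le> N" for P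
    using fourier_coeff_marginal[OF F that] by (simp add: H_def fourier_coeff_phase)
  have prod: "complex_of_real (\<Prod>P\<in>\<pi>. marginal N F P x) * cis (- phase {1..m} \<xi> x) = (\<Prod>P\<in>\<pi>. H P x)"
    if "partition_on {1..m} \<pi>" for \<pi> x
  proof -
    have "(\<Sum>k\<in>{1..m}. freq_inner (\<xi> k) (x k)) = (\<Sum>P\<in>\<pi>. \<Sum>k\<in>P. freq_inner (\<xi> k) (x k))"
      unfolding part(6)[OF that, symmetric] using part(2,3)[OF that]
      by (intro sum.Union_disjoint_sets[symmetric, unfolded comp_def] sum.Union_disjoint[unfolded comp_def])
         (auto simp: disjoint_def)
    then have "- phase {1..m} \<xi> x = (\<Sum>P\<in>\<pi>. - phase P \<xi> x)"
      by (simp add: phase_def sum_distrib_left sum_negf)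
    moreover have "cis (\<Sum>P\<in>\<pi>. - phase P \<xi> x) = (\<Prod>P\<in>\<pi>. cis (- phase P \<xi> x))"
      using part(1)[OF that] by (induction rule: finite_induct) (auto simp: cis_mult[symmetric] simp flip: add_uminus_conv_diff)
    ultimately show ?thesis
      by (simp add: H_def prod.distrib)
  qed
  have "fourier_coeff {1..m} (correlation N F m) \<xi>
      = (LINT x|conf {1..m}. (\<Sum>\<pi> | partition_on {1..m} \<pi>. complex_of_real (c (card \<pi>)) * (\<Prod>P\<in>\<pi>. H P x)))"
    unfolding fourier_coeff_phase correlation_def
    by (rule Bochner_Integration.integral_cong[OF refl])
       (simp add: sum_distrib_right c_def mult.assoc flip: prod)
  also have "\<dots> = (\<Sum>\<pi> | partition_on {1..m} \<pi>. complex_of_real (c (card \<pi>)) * (LINT x|conf {1..m}. (\<Prod>P\<in>\<pi>. H P x)))"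
  proof -
    have "integrable (conf {1..m}) (\<lambda>x. complex_of_real (c (card \<pi>)) * (\<Prod>P\<in>\<pi>. H P x))"
      if "\<pi> \<in> {\<pi>. partition_on {1..m} \<pi>}" for \<pi>
    proof (rule integrable_mult_right, rule integral_prod_blocks(1))
      have \<pi>: "partition_on {1..m} \<pi>"
        using that by simp
      show "finite \<pi>" "disjoint \<pi>" "{} \<notin> \<pi>" "finite {1..m}"
        using part[OF \<pi>] by simp_all
      fix P assume P: "P \<in> \<pi>"
      show "finite P" "P \<subseteq> {1..m}"
        using part(3,4)[OF \<pi> P] by simp_all
      then show "integrable (conf P) (H P)" "H P (restrict x P) = H P x" for x
        using H_int H_loc part(5)[OF \<pi> P] by simp_all
    qed
    then show ?thesis
      by (subst Bochner_Integration.integral_sum) simp_all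
  qed
  also have "\<dots> = cum (moment N F \<xi>) {1..m}"
    unfolding cum_def
  proof (rule sum.cong[OF refl])
    fix \<pi> assume "\<pi> \<in> {\<pi>. partition_on {1..m} \<pi>}"
    then have \<pi>: "partition_on {1..m} \<pi>"
      by simp
    have "(LINT x|conf {1..m}. (\<Prod>P\<in>\<pi>. H P x)) = (\<Prod>P\<in>\<pi>. LINT x|conf P. H P x)"
      using part[OF \<pi>] H_int H_loc by (intro integral_prod_blocks(2)) auto
    also have "\<dots> = (\<Prod>P\<in>\<pi>. moment N F \<xi> P)"
      using part[OF \<pi>] by (intro prod.cong H_val) auto
    finally show "complex_of_real (c (card \<pi>)) * (LINT x|conf {1..m}. (\<Prod>P\<in>\<pi>. H P x)) =
        (- 1) ^ (card \<pi> - 1) * fact (card \<pi> - 1) * prod (moment N F \<xi>) \<pi>"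
      by (simp add: c_def)
  qed
  finally show ?thesis .
qed

section \<open>The kernel as a Fourier multiplier\<close>

text \<open>The domination by \<open>c p * w x\<close> makes the integrals absolutely summable. An
  enumeration \<open>g\<close> turns the unordered sum into a series, where sum and integral are
  exchanged; absolute summability then frees the result from the enumeration.\<close>

lemma has_sum_integral:
  fixes T :: "'b \<Rightarrow> 'a \<Rightarrow> complex" and g :: "nat \<Rightarrow> 'b"
  assumes g: "bij_betw g (UNIV :: nat set) UNIV"
    and int: "\<And>p. integrable M (T p)"
    and w: "integrable M w" and c: "c summable_on UNIV" "\<And>p. 0 \<le> c p"
    and bound: "\<And>p x. x \<in> space M \<Longrightarrow> norm (T p x) \<le> c p * w x"
    and sum: "\<And>x. x \<in> space M \<Longrightarrow> ((\<lambda>p. T p x) has_sum S x) UNIV"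
  shows "integrable M S" and "((\<lambda>p. LINT x|M. T p x) has_sum (LINT x|M. S x)) UNIV"
proof -
  have c': "summable (\<lambda>n. c (g n))"
    using c(1) summable_on_reindex_bij_betw[OF g, of c] by (intro summable_on_imp_summable) simp
  have "summable (\<lambda>n. norm (T (g n) x))" if "x \<in> space M" for x
    using bound[OF that] by (intro summable_comparison_test'[OF summable_mult2[OF c', of "w x"]]) auto
  then have 1: "AE x in M. summable (\<lambda>n. norm (T (g n) x))"
    by auto
  have nb: "(LINT x|M. norm (T p x)) \<le> c p * (LINT x|M. w x)" for p
  proof -
    have "(LINT x|M. norm (T p x)) \<le> (LINT x|M. c p * w x)"
      using bound int w by (intro integral_mono) auto
    then show ?thesis
      using w by simp
  qed
  have 2: "summable (\<lambda>n. LINT x|M. norm (T (g n) x))"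
    using nb by (intro summable_comparison_test'[OF summable_mult2[OF c', of "LINT x|M. w x"]]) auto
  have S: "(\<Sum>n. T (g n) x) = S x" if "x \<in> space M" for x
  proof -
    have "((\<lambda>n. T (g n) x) has_sum S x) UNIV"
      using sum[OF that] has_sum_reindex_bij_betw[OF g, of "\<lambda>p. T p x"] by simp
    then show ?thesis
      by (intro sums_unique[symmetric] has_sum_imp_sums)
  qed
  have "integrable M (\<lambda>x. \<Sum>n. T (g n) x)"
    using int 1 2 by (rule integrable_suminf)
  then show "integrable M S"
    using S Bochner_Integration.integrable_cong by metis
  have "(\<lambda>n. LINT x|M. T (g n) x) sums (LINT x|M. (\<Sum>n. T (g n) x))"
    using int 1 2 by (rule sums_integral)
  also have "(LINT x|M. (\<Sum>n. T (g n) x)) = (LINT x|M. S x)"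
    using S by (intro Bochner_Integration.integral_cong) auto
  finally have "((\<lambda>n. LINT x|M. T (g n) x) has_sum (LINT x|M. S x)) UNIV"
  proof (rule norm_summable_imp_has_sum[rotated])
    show "summable (\<lambda>n. norm (LINT x|M. T (g n) x))"
      by (rule summable_comparison_test'[OF 2]) (auto intro: integral_norm_bound)
  qed
  then show "((\<lambda>p. LINT x|M. T p x) has_sum (LINT x|M. S x)) UNIV"
    using has_sum_reindex_bij_betw[OF g, of "\<lambda>p. LINT x|M. T p x"] by simp
qed

lemma bij_nat_freq_pairs: "\<exists>g. bij_betw g (UNIV :: nat set) (UNIV :: ((int ^ 'd) \<times> (int ^ 'd)) set)"
proof -
  have "inj (\<lambda>n. ((\<chi> i. int n) :: int ^ 'd, 0 :: int ^ 'd))"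
    by (auto simp: inj_def vec_eq_iff)
  then have "infinite (UNIV :: ((int ^ 'd) \<times> (int ^ 'd)) set)"
    using finite_subset[OF subset_UNIV] range_inj_infinite by blast
  then show ?thesis
    using bij_betw_from_nat_into[of "UNIV :: ((int ^ 'd) \<times> (int ^ 'd)) set"] by blast
qed

text \<open>The bilinear pairing of a frequency with a Fourier coefficient of \<open>K\<close>: up
  to the factor 2 \<pi> i, all that remains of the divergence once it is tested against a
  character.\<close>

definition coupling ::
  "(real ^ 'd \<Rightarrow> real ^ 'd \<Rightarrow> real ^ 'd) \<Rightarrow> int ^ 'd \<Rightarrow> (int ^ 'd) \<times> (int ^ 'd) \<Rightarrow> complex" where
  "coupling K v p = (\<Sum>i\<in>UNIV. of_int (v $ i) * kernel_coeff K (fst p) (snd p) $ i)"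

definition kernel_mass :: "(real ^ 'd \<Rightarrow> real ^ 'd \<Rightarrow> real ^ 'd) \<Rightarrow> real" where
  "kernel_mass K = infsum (\<lambda>p. norm (kernel_coeff K (fst p) (snd p))) UNIV"

definition l1norm :: "int ^ 'd \<Rightarrow> real" where
  "l1norm v = (\<Sum>i\<in>UNIV. \<bar>of_int (v $ i)\<bar>)"

definition l2sq :: "int ^ 'd \<Rightarrow> real" where
  "l2sq v = (\<Sum>i\<in>UNIV. (of_int (v $ i))\<^sup>2)"

lemma l1norm_nonneg: "0 \<le> l1norm v"
  by (simp add: l1norm_def sum_nonneg)

lemma l2sq_nonneg: "0 \<le> l2sq v"
  by (simp add: l2sq_def sum_nonneg)

text \<open>This is how the dissipation absorbs the drift, uniformly in the frequency.\<close>

lemma l1norm_le_l2sq: "l1norm v \<le> l2sq v"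
  unfolding l1norm_def l2sq_def
proof (rule sum_mono)
  fix i
  have "\<bar>v $ i\<bar> * 1 \<le> \<bar>v $ i\<bar> * \<bar>v $ i\<bar>"
  proof (cases "v $ i = 0")
    case False
    then show ?thesis
      by (intro mult_left_mono) linarith+
  qed simp
  then have "\<bar>v $ i\<bar> \<le> (v $ i)\<^sup>2"
    by (simp add: power2_eq_square)
  then have "of_int \<bar>v $ i\<bar> \<le> (of_int ((v $ i)\<^sup>2) :: real)"
    by (simp only: of_int_le_iff)
  then show "\<bar>of_int (v $ i)\<bar> \<le> (of_int (v $ i) :: real)\<^sup>2"
    by simp
qed

lemma norm_coupling_le: "cmod (coupling K v p) \<le> l1norm v * norm (kernel_coeff K (fst p) (snd p))"
proof -
  have "cmod (coupling K v p) \<le> (\<Sum>i\<in>UNIV. \<bar>of_int (v $ i)\<bar> * norm (kernel_coeff K (fst p) (snd p)))"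
    unfolding coupling_def
  proof (rule sum_norm_le)
    fix i
    show "cmod (of_int (v $ i) * kernel_coeff K (fst p) (snd p) $ i)
        \<le> \<bar>of_int (v $ i)\<bar> * norm (kernel_coeff K (fst p) (snd p))"
      unfolding norm_mult norm_of_int
      by (intro mult_left_mono Finite_Cartesian_Product.norm_nth_le) auto
  qed
  then show ?thesis
    by (simp add: l1norm_def sum_distrib_right)
qed

lemma summable_kernel:
  assumes "summable_fourier_kernel K"
  shows "(\<lambda>p. norm (kernel_coeff K (fst p) (snd p))) summable_on UNIV"
  using assms by (simp add: summable_fourier_kernel_def case_prod_beta')

lemma kernel_mass_nonneg: "0 \<le> kernel_mass K"
  by (simp add: kernel_mass_def infsum_nonneg)

lemma freq_inner_diff: "freq_inner (\<xi> - \<eta>) x = freq_inner \<xi> x - freq_inner \<eta> x"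
  by (simp add: freq_inner_def left_diff_distrib sum_subtractf)

text \<open>After multiplication of h by a mode of K(x_k, x_l), the coefficient at \<xi> is read off
  from h at these frequencies. The updates are made in succession so that for k = l both
  displacements accumulate on one particle.\<close>

definition shift :: "nat \<Rightarrow> nat \<Rightarrow> 'a \<times> 'a \<Rightarrow> (nat \<Rightarrow> 'a::ab_group_add) \<Rightarrow> nat \<Rightarrow> 'a" where
  "shift k l p \<xi> = (let \<xi>' = \<xi>(k := \<xi> k - fst p) in \<xi>'(l := \<xi>' l - snd p))"

lemma phase_fun_upd:
  assumes "finite P" "k \<in> P"
  shows "phase P (\<xi>(k := \<xi> k - \<eta>)) x = phase P \<xi> x - 2 * pi * freq_inner \<eta> (x k)"
proof -
  have "(\<Sum>j\<in>P. freq_inner ((\<xi>(k := \<xi> k - \<eta>)) j) (x j))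
      = (\<Sum>j\<in>P. freq_inner (\<xi> j) (x j) - (if j = k then freq_inner \<eta> (x j) else 0))"
    by (rule sum.cong) (auto simp: freq_inner_diff)
  then show ?thesis
    using assms by (simp add: phase_def sum_subtractf right_diff_distrib)
qed

lemma phase_shift:
  assumes "finite P" "k \<in> P" "l \<in> P"
  shows "phase P (shift k l p \<xi>) x =
    phase P \<xi> x - 2 * pi * (freq_inner (fst p) (x k) + freq_inner (snd p) (x l))"
  unfolding shift_def Let_def using assms by (simp only: phase_fun_upd) (simp add: algebra_simps)

lemma has_sum_finite_sum:
  fixes f :: "'i \<Rightarrow> 'b \<Rightarrow> 'c::topological_comm_monoid_add"
  assumes "\<And>i. i \<in> I \<Longrightarrow> (f i has_sum s i) A"
  shows "((\<lambda>x. \<Sum>i\<in>I. f i x) has_sum (\<Sum>i\<in>I. s i)) A"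
  using assms by (induction I rule: infinite_finite_induct) (auto intro: has_sum_add)

lemma kernel_series:
  fixes K :: "real ^ 'd \<Rightarrow> real ^ 'd \<Rightarrow> real ^ 'd"
  assumes "summable_fourier_kernel K"
  shows "((\<lambda>p. coupling K v p * cis (2 * pi * (freq_inner (fst p) x + freq_inner (snd p) y)))
    has_sum complex_of_real (\<Sum>i\<in>UNIV. of_int (v $ i) * K x y $ i)) UNIV"
proof -
  have "((\<lambda>p. \<Sum>i\<in>UNIV. of_int (v $ i) * (kernel_coeff K (fst p) (snd p) $ i *
      cis (2 * pi * (freq_inner (fst p) x + freq_inner (snd p) y))))
    has_sum (\<Sum>i\<in>UNIV. of_int (v $ i) * complex_of_real (K x y $ i))) UNIV"
    using assms by (intro has_sum_finite_sum has_sum_cmult_right)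
      (auto simp: summable_fourier_kernel_def case_prod_beta')
  then show ?thesis
    by (simp add: coupling_def sum_distrib_right mult.assoc)
qed

text \<open>The series of \<open>K\<close> is inserted and integrated term by term; |h| times the
  summable modes of the kernel dominates.\<close>

lemma kernel_integral:
  fixes K :: "real ^ 'd \<Rightarrow> real ^ 'd \<Rightarrow> real ^ 'd"
  assumes K: "summable_fourier_kernel K" and P: "finite P" "k \<in> P" "l \<in> P"
    and h: "integrable (conf P) h"
  shows "integrable (conf P) (\<lambda>x. complex_of_real (h x * (\<Sum>i\<in>UNIV. of_int (v $ i) * K (x k) (x l) $ i))
      * cis (- phase P \<xi> x))" (is ?int)
    and "((\<lambda>p. coupling K v p * fourier_coeff P h (shift k l p \<xi>)) has_sum
      (LINT x|conf P. complex_of_real (h x * (\<Sum>i\<in>UNIV. of_int (v $ i) * K (x k) (x l) $ i))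
        * cis (- phase P \<xi> x))) UNIV" (is ?sum)
proof -
  obtain g :: "nat \<Rightarrow> (int ^ 'd) \<times> (int ^ 'd)" where g: "bij_betw g UNIV UNIV"
    using bij_nat_freq_pairs by blast
  define T where "T p x = coupling K v p * (complex_of_real (h x) * cis (- phase P (shift k l p \<xi>) x))" for p x
  have int: "integrable (conf P) (T p)" for p
    unfolding T_def using integrable_fourier[OF h] by (intro integrable_mult_right)
  have bound: "norm (T p x) \<le> l1norm v * norm (kernel_coeff K (fst p) (snd p)) * \<bar>h x\<bar>" for p x
    unfolding T_def norm_mult norm_cis norm_of_real mult_1_right
    by (intro mult_right_mono norm_coupling_le) auto
  have sum: "((\<lambda>p. T p x) has_sum (complex_of_real (h x * (\<Sum>i\<in>UNIV. of_int (v $ i) * K (x k) (x l) $ i))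
      * cis (- phase P \<xi> x))) UNIV" for x
  proof -
    have "T p x = complex_of_real (h x) * cis (- phase P \<xi> x) *
        (coupling K v p * cis (2 * pi * (freq_inner (fst p) (x k) + freq_inner (snd p) (x l))))" for p
    proof -
      have "cis (- phase P (shift k l p \<xi>) x) = cis (- phase P \<xi> x) *
          cis (2 * pi * (freq_inner (fst p) (x k) + freq_inner (snd p) (x l)))"
        by (simp add: phase_shift P cis_mult)
      then show ?thesis
        by (simp add: T_def)
    qed
    then show ?thesis
      using has_sum_cmult_right[OF kernel_series[OF K, of v "x k" "x l"],
        of "complex_of_real (h x) * cis (- phase P \<xi> x)"]
      by (simp add: mult_ac)
  qed
  note * = has_sum_integral[where T = T, OF g int _ _ _ bound sum]
  show ?int
    by (rule *) (use h summable_kernel[OF K] in \<open>auto intro!: summable_on_cmult_right mult_nonneg_nonneg l1norm_nonneg\<close>)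
  have "((\<lambda>p. LINT x|conf P. T p x) has_sum
      (LINT x|conf P. complex_of_real (h x * (\<Sum>i\<in>UNIV. of_int (v $ i) * K (x k) (x l) $ i))
        * cis (- phase P \<xi> x))) UNIV"
    by (rule *) (use h summable_kernel[OF K] in \<open>auto intro!: summable_on_cmult_right mult_nonneg_nonneg l1norm_nonneg\<close>)
  moreover have "(LINT x|conf P. T p x) = coupling K v p * fourier_coeff P h (shift k l p \<xi>)" for p
    by (simp add: T_def fourier_coeff_phase)
  ultimately show ?sum
    by simp
qed

section \<open>Sums over the modes of the kernel\<close>

definition mode_sum ::
  "(real ^ 'd \<Rightarrow> real ^ 'd \<Rightarrow> real ^ 'd) \<Rightarrow> int ^ 'd \<Rightarrow> ((int ^ 'd) \<times> (int ^ 'd) \<Rightarrow> complex) \<Rightarrow> complex" where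
  "mode_sum K v q = infsum (\<lambda>p. coupling K v p * q p) UNIV"

lemma abs_summable_mode_sum:
  assumes "summable_fourier_kernel K" "\<And>p. cmod (q p) \<le> B"
  shows "(\<lambda>p. norm (coupling K v p * q p)) summable_on UNIV"
proof (rule Infinite_Sum.abs_summable_on_comparison_test)
  show "(\<lambda>p. norm (l1norm v * norm (kernel_coeff K (fst p) (snd p)) * B)) summable_on UNIV"
    using summable_kernel[OF assms(1)]
    by (simp add: abs_mult norm_mult summable_on_cmult_left summable_on_cmult_right)
  fix p
  have "0 \<le> B"
    using order_trans[OF norm_ge_zero assms(2)] .
  then have "cmod (coupling K v p * q p) \<le> l1norm v * norm (kernel_coeff K (fst p) (snd p)) * B"
    unfolding norm_mult by (intro mult_mono norm_coupling_le assms(2)) (auto simp: l1norm_nonneg)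
  then show "norm (coupling K v p * q p) \<le> norm (l1norm v * norm (kernel_coeff K (fst p) (snd p)) * B)"
    by simp
qed

lemma norm_mode_sum_le:
  assumes "summable_fourier_kernel K" "\<And>p. cmod (q p) \<le> B"
  shows "cmod (mode_sum K v q) \<le> l1norm v * kernel_mass K * B"
proof -
  have B: "0 \<le> B"
    using order_trans[OF norm_ge_zero assms(2)] .
  have "cmod (mode_sum K v q) \<le> infsum (\<lambda>p. cmod (coupling K v p * q p)) UNIV"
    unfolding mode_sum_def using assms by (intro norm_infsum_bound abs_summable_mode_sum)
  also have "\<dots> \<le> infsum (\<lambda>p. l1norm v * B * norm (kernel_coeff K (fst p) (snd p))) UNIV"
  proof (rule infsum_mono)
    show "(\<lambda>p. cmod (coupling K v p * q p)) summable_on UNIV"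
      using abs_summable_mode_sum[OF assms] by simp
    show "(\<lambda>p. l1norm v * B * norm (kernel_coeff K (fst p) (snd p))) summable_on UNIV"
      using summable_kernel[OF assms(1)] by (rule summable_on_cmult_right)
    fix p
    have "cmod (coupling K v p * q p) \<le> l1norm v * norm (kernel_coeff K (fst p) (snd p)) * B"
      using B unfolding norm_mult by (intro mult_mono norm_coupling_le assms(2)) (auto simp: l1norm_nonneg)
    then show "cmod (coupling K v p * q p) \<le> l1norm v * B * norm (kernel_coeff K (fst p) (snd p))"
      by (simp add: mult_ac)
  qed
  also have "\<dots> = l1norm v * kernel_mass K * B"
    by (simp add: kernel_mass_def infsum_cmult_right' mult_ac)
  finally show ?thesis .
qed

text \<open>Boundedness over the modes is stable under sums and products, so every polynomial in
  moments stays where \<open>mode_sum\<close> converges absolutely and is linear.\<close>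

definition bdd :: "('a \<Rightarrow> complex) \<Rightarrow> bool" where
  "bdd q \<longleftrightarrow> (\<exists>B. \<forall>p. cmod (q p) \<le> B)"

lemma mode_sum_summable: "summable_fourier_kernel K \<Longrightarrow> bdd q \<Longrightarrow> (\<lambda>p. coupling K v p * q p) summable_on UNIV"
  unfolding bdd_def using abs_summable_mode_sum by (blast intro: abs_summable_summable)

lemma bddI: "(\<And>p. cmod (q p) \<le> B) \<Longrightarrow> bdd q"
  by (auto simp: bdd_def)

lemma bdd_const: "bdd (\<lambda>_. c)"
  by (auto simp: bdd_def)

lemma bdd_add: "bdd q \<Longrightarrow> bdd r \<Longrightarrow> bdd (\<lambda>p. q p + r p)"
  unfolding bdd_def by (meson add_mono norm_triangle_le)

lemma bdd_mult: "bdd q \<Longrightarrow> bdd r \<Longrightarrow> bdd (\<lambda>p. q p * r p)"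
proof -
  assume "bdd q" "bdd r"
  then obtain A B where "\<And>p. cmod (q p) \<le> A" "\<And>p. cmod (r p) \<le> B"
    by (auto simp: bdd_def)
  then have "cmod (q p * r p) \<le> A * B" for p
    unfolding norm_mult by (intro mult_mono) (auto intro: order_trans[OF norm_ge_zero])
  then show ?thesis
    by (rule bddI)
qed

lemma bdd_diff: "bdd q \<Longrightarrow> bdd r \<Longrightarrow> bdd (\<lambda>p. q p - r p)"
  using bdd_add[of q "\<lambda>p. (- 1) * r p"] bdd_mult[OF bdd_const, of r "- 1"] by simp

lemma bdd_sum: "(\<And>i. i \<in> I \<Longrightarrow> bdd (q i)) \<Longrightarrow> bdd (\<lambda>p. \<Sum>i\<in>I. q i p)"
  by (induction I rule: infinite_finite_induct) (auto intro: bdd_add bdd_const)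

lemma bdd_prod: "(\<And>i. i \<in> I \<Longrightarrow> bdd (q i)) \<Longrightarrow> bdd (\<lambda>p. \<Prod>i\<in>I. q i p)"
  by (induction I rule: infinite_finite_induct) (auto intro: bdd_mult bdd_const)

lemma mode_sum_add:
  assumes "summable_fourier_kernel K" "bdd q" "bdd r"
  shows "mode_sum K v (\<lambda>p. q p + r p) = mode_sum K v q + mode_sum K v r"
  unfolding mode_sum_def
  using infsum_add[OF mode_sum_summable[OF assms(1,2)] mode_sum_summable[OF assms(1,3)], of v v]
  by (simp add: distrib_left)

lemma mode_sum_cmult: "mode_sum K v (\<lambda>p. c * q p) = c * mode_sum K v q"
  unfolding mode_sum_def by (simp add: infsum_cmult_right'[symmetric] mult_ac)

lemma mode_sum_zero: "mode_sum K v (\<lambda>_. 0) = 0"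
  by (simp add: mode_sum_def)

lemma mode_sum_sum:
  assumes "summable_fourier_kernel K" "\<And>i. i \<in> I \<Longrightarrow> bdd (q i)"
  shows "mode_sum K v (\<lambda>p. \<Sum>i\<in>I. q i p) = (\<Sum>i\<in>I. mode_sum K v (q i))"
  using assms(2)
  by (induction I rule: infinite_finite_induct) (auto simp: mode_sum_zero mode_sum_add assms(1) bdd_sum)

section \<open>Testing the hierarchy against characters\<close>

text \<open>Test functions are real, so characters enter through this two-parameter family, which is
  closed under partial derivatives.\<close>

definition trig :: "nat set \<Rightarrow> (nat \<Rightarrow> int ^ 'd) \<Rightarrow> real \<Rightarrow> real \<Rightarrow> (nat \<Rightarrow> real ^ 'd) \<Rightarrow> real" where
  "trig P \<xi> a b x = a * cos (phase P \<xi> x) + b * sin (phase P \<xi> x)"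

lemma phase_translate:
  assumes "finite P" "k \<in> P"
  shows "phase P \<xi> (x(k := x k + s *\<^sub>R axis i 1)) = phase P \<xi> x + 2 * pi * of_int (\<xi> k $ i) * s"
proof -
  have 1: "freq_inner \<eta> (y + s *\<^sub>R axis i 1) = freq_inner \<eta> y + of_int (\<eta> $ i) * s" for \<eta> and y :: "real ^ 'a"
  proof -
    have "freq_inner \<eta> (y + s *\<^sub>R axis i 1)
        = (\<Sum>j\<in>UNIV. of_int (\<eta> $ j) * y $ j + (if j = i then of_int (\<eta> $ i) * s else 0))"
      unfolding freq_inner_def by (rule sum.cong) (auto simp: axis_def algebra_simps)
    then show ?thesis
      by (simp add: freq_inner_def sum.distrib)
  qed
  have "(\<Sum>j\<in>P. freq_inner (\<xi> j) ((x(k := x k + s *\<^sub>R axis i 1)) j))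
      = (\<Sum>j\<in>P. freq_inner (\<xi> j) (x j) + (if j = k then of_int (\<xi> k $ i) * s else 0))"
    by (rule sum.cong) (auto simp: 1)
  then show ?thesis
    using assms by (simp add: phase_def sum.distrib distrib_left)
qed

lemma trig_has_derivative:
  assumes "finite P" "k \<in> P"
  shows "((\<lambda>s. trig P \<xi> a b (x(k := x k + s *\<^sub>R axis i 1))) has_real_derivative
    trig P \<xi> (2 * pi * of_int (\<xi> k $ i) * b) (- (2 * pi * of_int (\<xi> k $ i) * a)) x) (at 0)"
  unfolding trig_def phase_translate[OF assms]
  by (auto intro!: derivative_eq_intros simp: algebra_simps)

lemma partial_deriv_trig:
  assumes "finite P" "k \<in> P"
  shows "partial_deriv k i (trig P \<xi> a b) =
    trig P \<xi> (2 * pi * of_int (\<xi> k $ i) * b) (- (2 * pi * of_int (\<xi> k $ i) * a))"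
  unfolding partial_deriv_def by (rule ext) (rule DERIV_imp_deriv[OF trig_has_derivative[OF assms]])

lemma continuous_on_trig: "continuous_on UNIV (trig P \<xi> a b)"
  unfolding trig_def[abs_def] phase_def freq_inner_def
  by (intro continuous_intros continuous_on_component continuous_on_product_coordinates)

lemma cont_diff_trig:
  assumes "finite P"
  shows "cont_diff P n (trig P \<xi> a b)"
proof (induction n arbitrary: a b)
  case (Suc n)
  show ?case
    unfolding cont_diff.simps
  proof (intro conjI ballI allI continuous_on_trig)
    fix k i assume k: "k \<in> P"
    show "(\<lambda>s. trig P \<xi> a b (x(k := x k + s *\<^sub>R axis i 1))) differentiable at 0" for x
      unfolding real_differentiable_def by (rule exI) (rule trig_has_derivative[OF assms k])
    show "cont_diff P n (partial_deriv k i (trig P \<xi> a b))"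
      unfolding partial_deriv_trig[OF assms k] by (rule Suc)
  qed
qed (simp add: continuous_on_trig)

lemma test_function_trig:
  assumes "finite P"
  shows "test_function P (trig P \<xi> a b)"
  unfolding test_function_def
proof (intro conjI allI impI ballI)
  fix x y :: "nat \<Rightarrow> real ^ 'a" assume "\<forall>k\<in>P. x k = y k"
  then have "phase P \<xi> x = phase P \<xi> y"
    by (simp add: phase_def)
  then show "trig P \<xi> a b x = trig P \<xi> a b y"
    by (simp add: trig_def)
next
  fix x :: "nat \<Rightarrow> real ^ 'a" and k i assume k: "k \<in> P"
  have "phase P \<xi> (x(k := x k + axis i 1)) = phase P \<xi> x + 2 * pi * of_int (\<xi> k $ i)"
    using phase_translate[OF assms k, of \<xi> x 1 i] by simp
  then show "trig P \<xi> a b (x(k := x k + axis i 1)) = trig P \<xi> a b x"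
    by (simp add: trig_def cos_add sin_add)
qed (rule cont_diff_trig[OF assms])

text \<open>The value of a real functional at the character exp(- i phase), assembled from cosine
  and sine.\<close>

definition complexify :: "(((nat \<Rightarrow> real ^ 'd) \<Rightarrow> real) \<Rightarrow> real) \<Rightarrow> nat set \<Rightarrow> (nat \<Rightarrow> int ^ 'd) \<Rightarrow> complex" where
  "complexify L P \<xi> = complex_of_real (L (trig P \<xi> 1 0)) - \<i> * complex_of_real (L (trig P \<xi> 0 1))"

lemma complexify_integral:
  assumes "integrable (conf P) h"
  shows "complexify (\<lambda>\<phi>. LINT x|conf P. h x * \<phi> x) P \<xi> = fourier_coeff P h \<xi>"
proof -
  have int: "integrable (conf P) (\<lambda>x. h x * cos (phase P \<xi> x))" "integrable (conf P) (\<lambda>x. h x * sin (phase P \<xi> x))"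
    using assms by (auto intro!: integrable_mult_bounded[where c = 1])
  have "complex_of_real (h x) * cis (- phase P \<xi> x) =
      complex_of_real (h x * cos (phase P \<xi> x)) - \<i> * complex_of_real (h x * sin (phase P \<xi> x))" for x
    by (simp add: complex_eq_iff)
  then have "fourier_coeff P h \<xi> =
      (LINT x|conf P. complex_of_real (h x * cos (phase P \<xi> x)) - \<i> * complex_of_real (h x * sin (phase P \<xi> x)))"
    by (simp only: fourier_coeff_phase)
  also have "\<dots> = complex_of_real (LINT x|conf P. h x * cos (phase P \<xi> x)) -
      \<i> * complex_of_real (LINT x|conf P. h x * sin (phase P \<xi> x))"
    using int by (simp del: of_real_mult add: Bochner_Integration.integral_diff)
  finally show ?thesis
    by (simp add: complexify_def trig_def)
qed

lemma complexify_laplacian: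
  assumes "finite P" "k \<in> P" "integrable (conf P) h"
  shows "complexify (dist_laplacian P k h) P \<xi> =
    - complex_of_real (4 * pi\<^sup>2 * l2sq (\<xi> k)) * fourier_coeff P h \<xi>"
proof -
  have "dist_laplacian P k h (trig P \<xi> a b) =
      - (4 * pi\<^sup>2 * l2sq (\<xi> k)) * (LINT x|conf P. h x * trig P \<xi> a b x)" for a b
  proof -
    have "(\<Sum>i\<in>UNIV. partial_deriv k i (partial_deriv k i (trig P \<xi> a b)) x) =
        - (4 * pi\<^sup>2 * l2sq (\<xi> k)) * trig P \<xi> a b x" for x
      unfolding partial_deriv_trig[OF assms(1,2)] l2sq_def trig_def
      by (simp add: sum_distrib_left sum_distrib_right sum_negf[symmetric] sum.distrib[symmetric] power2_eq_square algebra_simps)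
    then have "dist_laplacian P k h (trig P \<xi> a b) =
        (LINT x|conf P. - (4 * pi\<^sup>2 * l2sq (\<xi> k)) * (h x * trig P \<xi> a b x))"
      by (simp add: dist_laplacian_def mult_ac)
    then show ?thesis
      by (simp only: integral_mult_right_zero)
  qed
  then show ?thesis
    unfolding complexify_integral[OF assms(3), symmetric]
    by (simp add: complexify_def algebra_simps)
qed

lemma borel_measurable_nth:
  fixes F :: "'a \<Rightarrow> real ^ 'd"
  assumes "F \<in> borel_measurable M"
  shows "(\<lambda>x. F x $ i) \<in> borel_measurable M"
proof -
  have "(\<lambda>v :: real ^ 'd. v $ i) \<in> borel_measurable borel"
    by (intro borel_measurable_continuous_onI continuous_intros)
  then show ?thesis
    using assms by (rule measurable_compose[rotated])
qed

text \<open>Differentiating the character brings out its frequency and leaves a scalar integrand.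
  The identity for \<open>q\<close> is asked only almost everywhere because in \<open>op_H\<close>
  the integral over the extra particle may fail to exist on a null set of the others.\<close>

lemma complexify_div:
  assumes P: "finite P" "k \<in> P" and q: "integrable (conf P) q"
    and eq: "AE x in conf P. q x = (\<Sum>i\<in>UNIV. of_int (\<xi> k $ i) * F x $ i)"
    and F: "F \<in> borel_measurable (conf P)"
  shows "complexify (dist_div P k F) P \<xi> = 2 * pi * \<i> * fourier_coeff P q \<xi>"
proof -
  have phase: "trig P \<xi> a b \<in> borel_measurable (conf P)" for a b
    unfolding trig_def[abs_def] by measurable
  have "dist_div P k F (trig P \<xi> a b) = - (2 * pi) * (LINT x|conf P. q x * trig P \<xi> b (- a) x)" for a b
  proof -
    have *: "F x \<bullet> (\<chi> i. partial_deriv k i (trig P \<xi> a b) x) =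
        2 * pi * ((\<Sum>i\<in>UNIV. of_int (\<xi> k $ i) * F x $ i) * trig P \<xi> b (- a) x)" for x
      unfolding partial_deriv_trig[OF P] inner_vec_def
      by (simp add: trig_def sum_distrib_left sum_distrib_right algebra_simps sum.distrib sum_subtractf)
    have "(LINT x|conf P. F x \<bullet> (\<chi> i. partial_deriv k i (trig P \<xi> a b) x)) =
        (LINT x|conf P. 2 * pi * (q x * trig P \<xi> b (- a) x))"
      unfolding *
    proof (rule integral_cong_AE)
      show "AE x in conf P. 2 * pi * ((\<Sum>i\<in>UNIV. of_int (\<xi> k $ i) * F x $ i) * trig P \<xi> b (- a) x) =
          2 * pi * (q x * trig P \<xi> b (- a) x)"
        using eq by eventually_elim simp
      have "(\<lambda>x. F x $ i) \<in> borel_measurable (conf P)" for i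
        using F by (rule borel_measurable_nth)
      then show "(\<lambda>x. 2 * pi * ((\<Sum>i\<in>UNIV. of_int (\<xi> k $ i) * F x $ i) * trig P \<xi> b (- a) x))
          \<in> borel_measurable (conf P)"
        using phase by (intro borel_measurable_times borel_measurable_const borel_measurable_sum)
      show "(\<lambda>x. 2 * pi * (q x * trig P \<xi> b (- a) x)) \<in> borel_measurable (conf P)"
        using phase q by (intro borel_measurable_times borel_measurable_const) auto
    qed
    then show ?thesis
      unfolding dist_div_def by (simp only: integral_mult_right_zero)
  qed
  then have "complexify (dist_div P k F) P \<xi> =
      - (2 * pi) * (complex_of_real (LINT x|conf P. q x * trig P \<xi> 0 (- 1) x) -
         \<i> * complex_of_real (LINT x|conf P. q x * trig P \<xi> 1 0 x))"
    unfolding complexify_def by (simp add: algebra_simps)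
  also have "(LINT x|conf P. q x * trig P \<xi> 0 (- 1) x) = - (LINT x|conf P. q x * trig P \<xi> 0 1 x)"
    by (simp add: trig_def)
  also have "- (2 * pi) * (complex_of_real (- (LINT x|conf P. q x * trig P \<xi> 0 1 x)) -
         \<i> * complex_of_real (LINT x|conf P. q x * trig P \<xi> 1 0 x)) =
      2 * pi * \<i> * complexify (\<lambda>\<phi>. LINT x|conf P. q x * \<phi> x) P \<xi>"
    by (simp add: complexify_def algebra_simps)
  finally show ?thesis
    using complexify_integral[OF q] by simp
qed


lemma
  fixes K :: "real ^ 'd \<Rightarrow> real ^ 'd \<Rightarrow> real ^ 'd"
  assumes K: "summable_fourier_kernel K" and P: "finite P" "k \<in> P" "l \<in> P"
    and h: "integrable (conf P) h"
  shows integrable_kernel_combination: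
      "integrable (conf P) (\<lambda>x. h x * (\<Sum>i\<in>UNIV. of_int (v $ i) * K (x k) (x l) $ i))"
    and integrable_kernel: "integrable (conf P) (\<lambda>x. h x *\<^sub>R K (x k) (x l))"
proof -
  \<comment> \<open>Frequency zero makes the phase disappear from \<open>kernel_integral\<close>;
    unit vectors for \<open>v\<close> then give the components of the vector field.\<close>
  have 1: "integrable (conf P) (\<lambda>x. h x * (\<Sum>i\<in>UNIV. of_int (v $ i) * K (x k) (x l) $ i))" for v
  proof -
    have "phase P (\<lambda>_. 0 :: int ^ 'd) x = 0" for x
      by (simp add: phase_def freq_inner_def)
    then have "complex_integrable (conf P) (\<lambda>x. complex_of_real (h x * (\<Sum>i\<in>UNIV. of_int (v $ i) * K (x k) (x l) $ i)))"
      using kernel_integral(1)[OF assms, of v "\<lambda>_. 0"] by simp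
    then show ?thesis
      by (simp only: complex_of_real_integrable_eq)
  qed
  then show "integrable (conf P) (\<lambda>x. h x * (\<Sum>i\<in>UNIV. of_int (v $ i) * K (x k) (x l) $ i))" .
  have "integrable (conf P) (\<lambda>x. h x * K (x k) (x l) $ i)" for i
  proof -
    have "(\<Sum>j\<in>UNIV. of_int ((axis i 1 :: int ^ 'd) $ j) * K (x k) (x l) $ j) = K (x k) (x l) $ i" for x
    proof -
      have "(\<Sum>j\<in>UNIV. of_int ((axis i 1 :: int ^ 'd) $ j) * K (x k) (x l) $ j)
          = (\<Sum>j\<in>UNIV. if j = i then K (x k) (x l) $ j else 0)"
        by (rule sum.cong) (auto simp: axis_def)
      then show ?thesis
        by simp
    qed
    then show ?thesis
      using 1[of "axis i 1"] by simp
  qed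
  then have "integrable (conf P) (\<lambda>x. \<Sum>i\<in>UNIV. (h x * K (x k) (x l) $ i) *\<^sub>R (axis i 1 :: real ^ 'd))"
    by (intro Bochner_Integration.integrable_sum integrable_scaleR_left)
  moreover have "(\<Sum>i\<in>UNIV. (h x * K (x k) (x l) $ i) *\<^sub>R (axis i 1 :: real ^ 'd)) = h x *\<^sub>R K (x k) (x l)" for x
    by (subst basis_expansion[of "h x *\<^sub>R K (x k) (x l)", symmetric]) (simp add: scalar_mult_eq_scaleR)
  ultimately show "integrable (conf P) (\<lambda>x. h x *\<^sub>R K (x k) (x l))"
    by simp
qed

lemma mode_sum_kernel:
  assumes "summable_fourier_kernel K" "finite P" "k \<in> P" "l \<in> P" "integrable (conf P) h"
  shows "fourier_coeff P (\<lambda>x. h x * (\<Sum>i\<in>UNIV. of_int (v $ i) * K (x k) (x l) $ i)) \<xi> =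
    mode_sum K v (\<lambda>p. fourier_coeff P h (shift k l p \<xi>))"
  unfolding mode_sum_def fourier_coeff_phase[of _ "\<lambda>x. h x * _ x"]
  by (rule infsumI[OF kernel_integral(2)[OF assms], symmetric])

lemma complexify_op_S:
  fixes K :: "real ^ 'd \<Rightarrow> real ^ 'd \<Rightarrow> real ^ 'd"
  assumes "summable_fourier_kernel K" "finite P" "k \<in> P" "l \<in> P" "integrable (conf P) h"
  shows "complexify (op_S K P k l h) P \<xi> =
    2 * pi * \<i> * mode_sum K (\<xi> k) (\<lambda>p. fourier_coeff P h (shift k l p \<xi>))"
  unfolding op_S_def mode_sum_kernel[OF assms, symmetric]
  using assms integrable_kernel[OF assms]
  by (intro complexify_div integrable_kernel_combination)
     (auto simp: sum_distrib_left mult_ac)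

lemma
  fixes g :: "(nat \<Rightarrow> real ^ 'd) \<Rightarrow> 'b::{banach,second_countable_topology}"
  assumes "finite P" "z \<notin> P" "integrable (conf (insert z P)) g"
  shows AE_integrable_insert: "AE x in conf P. integrable torus (\<lambda>y. g (x(z := y)))"
    and integrable_insert: "integrable (conf P) (\<lambda>x. LINT y|torus. g (x(z := y)))"
proof -
  let ?T = "\<lambda>(y, x :: nat \<Rightarrow> real ^ 'd). x(z := y)"
  interpret P: pair_sigma_finite "torus :: (real ^ 'd) measure" "conf P"
    by (intro pair_sigma_finite.intro prob_space_imp_sigma_finite prob_space_conf prob_space_torus)
  have T: "?T \<in> torus \<Otimes>\<^sub>M conf P \<rightarrow>\<^sub>M conf (insert z P)"
    unfolding conf_def using measurable_add_dim[of z P "\<lambda>_. torus"]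
    by (subst measurable_pair_swap_iff) (simp add: case_prod_beta')
  have "distr (torus \<Otimes>\<^sub>M conf P) (conf (insert z P)) ?T = conf (insert z P)"
    unfolding conf_def by (intro distr_pair_PiM_eq_PiM prob_space_torus)
  then have "integrable (torus \<Otimes>\<^sub>M conf P) (\<lambda>w. g (?T w))"
    by (intro integrable_distr[OF T]) (simp only: assms(3))
  then have "integrable (torus \<Otimes>\<^sub>M conf P) (case_prod (\<lambda>y x. g (x(z := y))))"
    by (simp add: case_prod_beta')
  then show "AE x in conf P. integrable torus (\<lambda>y. g (x(z := y)))"
    "integrable (conf P) (\<lambda>x. LINT y|torus. g (x(z := y)))"
    by (rule P.AE_integrable_snd, rule P.integrable_snd)
qed

text \<open>Integrating over the extra particle amounts to giving it frequency zero, and the kernel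
  mode then displaces this zero. Thus the integral over the extra particle becomes a coefficient
  with one particle more.\<close>

lemma complexify_op_H:
  fixes K :: "real ^ 'd \<Rightarrow> real ^ 'd \<Rightarrow> real ^ 'd"
  assumes K: "summable_fourier_kernel K" and P: "finite P" "k \<in> P" "star \<notin> P"
    and h: "integrable (conf (insert star P)) h"
  shows "complexify (op_H K (insert star P) k h) P \<xi> =
    2 * pi * \<i> * mode_sum K (\<xi> k) (\<lambda>p. fourier_coeff (insert star P) h (shift k star p (\<xi>(star := 0))))"
proof -
  define v where "v = \<xi> k"
  define Q where "Q x = h x * (\<Sum>i\<in>UNIV. of_int (v $ i) * K (x k) (x star) $ i)" for x
  define V where "V x = h x *\<^sub>R K (x k) (x star)" for x
  have k: "k \<noteq> star"
    using P by auto
  have Q: "integrable (conf (insert star P)) Q" and V: "integrable (conf (insert star P)) V"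
    unfolding Q_def V_def using K P h by (auto intro!: integrable_kernel_combination integrable_kernel)
  have op: "op_H K (insert star P) k h = dist_div P k (\<lambda>x. LINT y|torus. V (x(star := y)))"
    using P k by (simp add: op_H_def V_def)
  have "complexify (dist_div P k (\<lambda>x. LINT y|torus. V (x(star := y)))) P \<xi> =
      2 * pi * \<i> * fourier_coeff P (\<lambda>x. LINT y|torus. Q (x(star := y))) \<xi>"
  proof (rule complexify_div[OF P(1,2)])
    show "integrable (conf P) (\<lambda>x. LINT y|torus. Q (x(star := y)))"
      using P Q by (intro integrable_insert)
    show "(\<lambda>x. LINT y|torus. V (x(star := y))) \<in> borel_measurable (conf P)"
      using integrable_insert[OF P(1,3) V] by auto
    show "AE x in conf P. (LINT y|torus. Q (x(star := y))) =
        (\<Sum>i\<in>UNIV. of_int (\<xi> k $ i) * (LINT y|torus. V (x(star := y))) $ i)"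
      using AE_integrable_insert[OF P(1,3) V]
    proof eventually_elim
      fix x assume int: "integrable torus (\<lambda>y. V (x(star := y)))"
      have comp: "integrable torus (\<lambda>y. V (x(star := y)) $ i)" for i
        using integrable_bounded_linear[OF bounded_linear_vec_nth int] .
      have "(\<Sum>i\<in>UNIV. of_int (\<xi> k $ i) * (LINT y|torus. V (x(star := y))) $ i)
          = (\<Sum>i\<in>UNIV. of_int (v $ i) * (LINT y|torus. V (x(star := y)) $ i))"
        by (simp add: v_def integral_bounded_linear[OF bounded_linear_vec_nth int])
      also have "\<dots> = (LINT y|torus. (\<Sum>i\<in>UNIV. of_int (v $ i) * V (x(star := y)) $ i))"
        using comp by (subst Bochner_Integration.integral_sum) auto
      also have "\<dots> = (LINT y|torus. Q (x(star := y)))"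
        by (simp add: Q_def V_def sum_distrib_left mult_ac)
      finally show "(LINT y|torus. Q (x(star := y))) =
        (\<Sum>i\<in>UNIV. of_int (\<xi> k $ i) * (LINT y|torus. V (x(star := y))) $ i)" ..
    qed
  qed
  also have "fourier_coeff P (\<lambda>x. LINT y|torus. Q (x(star := y))) \<xi> =
      fourier_coeff (insert star P) Q (\<xi>(star := 0))"
  proof -
    have ph: "phase (insert star P) (\<xi>(star := 0)) (x(star := y)) = phase P \<xi> x" for x y
    proof -
      have "(\<Sum>j\<in>P. freq_inner ((\<xi>(star := 0)) j) ((x(star := y)) j)) = (\<Sum>j\<in>P. freq_inner (\<xi> j) (x j))"
        using P(3) by (intro sum.cong) auto
      then show ?thesis
        using P by (simp add: phase_def freq_inner_def[of 0])
    qed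
    have "fourier_coeff (insert star P) Q (\<xi>(star := 0)) =
        (LINT x|conf P. LINT y|torus. complex_of_real (Q (x(star := y))) * cis (- phase P \<xi> x))"
      using integrable_fourier[OF Q, of "\<xi>(star := 0)"] P
      unfolding fourier_coeff_phase conf_def by (subst tori.product_integral_insert) (simp_all add: ph)
    then show ?thesis
      by (simp add: fourier_coeff_phase)
  qed
  also have "\<dots> = mode_sum K v (\<lambda>p. fourier_coeff (insert star P) h (shift k star p (\<xi>(star := 0))))"
    unfolding Q_def using K P h by (intro mode_sum_kernel) auto
  finally show ?thesis
    by (simp only: op v_def)
qed


section \<open>The hierarchy in Fourier variables\<close>

lemma complexify_diff: "complexify (\<lambda>\<phi>. L \<phi> - L' \<phi>) P \<xi> = complexify L P \<xi> - complexify L' P \<xi>"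
  by (simp add: complexify_def algebra_simps)

lemma complexify_cmult: "complexify (\<lambda>\<phi>. c * L \<phi>) P \<xi> = complex_of_real c * complexify L P \<xi>"
  by (simp add: complexify_def algebra_simps)

lemma complexify_sum: "complexify (\<lambda>\<phi>. \<Sum>i\<in>I. L i \<phi>) P \<xi> = (\<Sum>i\<in>I. complexify (L i) P \<xi>)"
  by (simp add: complexify_def sum_subtractf sum_distrib_left)

definition mode_flow :: "nat \<Rightarrow> ((nat \<Rightarrow> real ^ 'd) \<Rightarrow> real) \<Rightarrow> (nat \<Rightarrow> int ^ 'd) \<Rightarrow> nat \<Rightarrow>
    (int ^ 'd) \<times> (int ^ 'd) \<Rightarrow> nat set \<Rightarrow> complex" where
  "mode_flow N F \<xi> k p = flow N k star (moment N F (shift k k p \<xi>)) (\<lambda>l. moment N F (shift k l p \<xi>))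
     (moment N F (shift k star p (\<xi>(star := 0))))"

definition moment_rhs :: "(real ^ 'd \<Rightarrow> real ^ 'd \<Rightarrow> real ^ 'd) \<Rightarrow> real \<Rightarrow> nat \<Rightarrow>
    ((nat \<Rightarrow> real ^ 'd) \<Rightarrow> real) \<Rightarrow> (nat \<Rightarrow> int ^ 'd) \<Rightarrow> nat set \<Rightarrow> complex" where
  "moment_rhs K \<sigma> N F \<xi> A =
     - complex_of_real (4 * pi\<^sup>2 * \<sigma> * (\<Sum>k\<in>A. l2sq (\<xi> k))) * moment N F \<xi> A -
     2 * pi * \<i> * (\<Sum>k\<in>A. mode_sum K (\<xi> k) (\<lambda>p. mode_flow N F \<xi> k p A))"

lemma bdd_moment:
  "probability_density (conf {1..N}) F \<Longrightarrow> bdd (\<lambda>p. moment N F (X p) A)"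
  by (rule bddI[where B = 1]) (rule norm_moment_le)

lemma complexify_hierarchy:
  fixes K :: "real ^ 'd \<Rightarrow> real ^ 'd \<Rightarrow> real ^ 'd"
  assumes K: "summable_fourier_kernel K" and F: "probability_density (conf {1..N}) F" and j: "j \<in> {1..N}"
  shows "complexify (\<lambda>\<phi>. \<sigma> * (\<Sum>k=1..j. dist_laplacian {1..j} k (marginal N F {1..j}) \<phi>)
      - 1 / real N * (\<Sum>k=1..j. \<Sum>l=1..j. op_S K {1..j} k l (marginal N F {1..j}) \<phi>)
      - (real N - real j) / real N *
        (\<Sum>k=1..j. op_H K ({1..j} \<union> {star}) k (marginal N F ({1..j} \<union> {star})) \<phi>)) {1..j} \<xi>
    = moment_rhs K \<sigma> N F \<xi> {1..j}"
proof -
  define A where "A = {1..j}"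
  have A: "finite A" "card A = j" "star \<notin> A" "card A \<le> N"
    using j by (auto simp: A_def star_def)
  have int: "integrable (conf {1..N}) F"
    using F by (simp add: probability_density_def)
  have mA: "integrable (conf A) (marginal N F A)" "fourier_coeff A (marginal N F A) \<zeta> = moment N F \<zeta> A" for \<zeta>
    using integrable_marginal[OF int A(1,4)] fourier_coeff_marginal[OF int A(1,4)] by auto
  have lap: "complexify (dist_laplacian A k (marginal N F A)) A \<xi> =
      - complex_of_real (4 * pi\<^sup>2 * l2sq (\<xi> k)) * moment N F \<xi> A" if "k \<in> A" for k
    using complexify_laplacian[OF A(1) that mA(1)] by (simp add: mA)
  have S: "complexify (op_S K A k l (marginal N F A)) A \<xi> =
      2 * pi * \<i> * mode_sum K (\<xi> k) (\<lambda>p. moment N F (shift k l p \<xi>) A)" if "k \<in> A" "l \<in> A" for k l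
    using complexify_op_S[OF K A(1) that mA(1)] by (simp add: mA)
  \<comment> \<open>For j = N the marginal of N + 1 particles is meaningless, but its coefficient is
    zero.\<close>
  have H: "complex_of_real ((real N - real j) / real N) *
        complexify (op_H K (insert star A) k (marginal N F (insert star A))) A \<xi> =
      2 * pi * \<i> * (((of_nat N - of_nat j) / of_nat N) *
        mode_sum K (\<xi> k) (\<lambda>p. moment N F (shift k star p (\<xi>(star := 0))) (insert star A)))"
    if "k \<in> A" for k
  proof (cases "j = N")
    case False
    then have c: "card (insert star A) \<le> N" "finite (insert star A)"
      using A j by auto
    have "complexify (op_H K (insert star A) k (marginal N F (insert star A))) A \<xi> =
      2 * pi * \<i> * mode_sum K (\<xi> k) (\<lambda>p. moment N F (shift k star p (\<xi>(star := 0))) (insert star A))"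
      using complexify_op_H[OF K A(1) that A(3) integrable_marginal[OF int c(2,1)]]
      by (simp add: fourier_coeff_marginal[OF int c(2,1)])
    then show ?thesis
      by (simp add: mult_ac)
  qed simp
  have flow: "mode_sum K (\<xi> k) (\<lambda>p. mode_flow N F \<xi> k p A) =
      1 / of_nat N * (\<Sum>l\<in>A. mode_sum K (\<xi> k) (\<lambda>p. moment N F (shift k l p \<xi>) A)) +
      ((of_nat N - of_nat j) / of_nat N) *
        mode_sum K (\<xi> k) (\<lambda>p. moment N F (shift k star p (\<xi>(star := 0))) (insert star A))"
    if k: "k \<in> A" for k
  proof -
    have "mode_flow N F \<xi> k p A = 1 / of_nat N * (\<Sum>l\<in>A. moment N F (shift k l p \<xi>) A) +
      ((of_nat N - of_nat j) / of_nat N) * moment N F (shift k star p (\<xi>(star := 0))) (insert star A)" for p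
      unfolding mode_flow_def flow_def A(2) using sum.remove[OF A(1) k, of "\<lambda>l. moment N F (shift k l p \<xi>) A"] by simp
    moreover have "bdd (\<lambda>p. \<Sum>l\<in>A. moment N F (shift k l p \<xi>) A)"
      "bdd (\<lambda>p. moment N F (shift k star p (\<xi>(star := 0))) (insert star A))"
      using F by (auto intro: bdd_sum bdd_moment)
    ultimately show ?thesis
      using F by (simp only: mode_sum_add[OF K] mode_sum_cmult mode_sum_sum[OF K] bdd_mult bdd_const bdd_moment)
  qed
  have "complexify (\<lambda>\<phi>. \<sigma> * (\<Sum>k\<in>A. dist_laplacian A k (marginal N F A) \<phi>)
      - 1 / real N * (\<Sum>k\<in>A. \<Sum>l\<in>A. op_S K A k l (marginal N F A) \<phi>)
      - (real N - real j) / real N * (\<Sum>k\<in>A. op_H K (insert star A) k (marginal N F (insert star A)) \<phi>)) A \<xi>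
    = complex_of_real \<sigma> * (\<Sum>k\<in>A. complexify (dist_laplacian A k (marginal N F A)) A \<xi>)
      - complex_of_real (1 / real N) * (\<Sum>k\<in>A. \<Sum>l\<in>A. complexify (op_S K A k l (marginal N F A)) A \<xi>)
      - (\<Sum>k\<in>A. complex_of_real ((real N - real j) / real N) *
          complexify (op_H K (insert star A) k (marginal N F (insert star A))) A \<xi>)"
    by (simp only: complexify_diff complexify_cmult complexify_sum sum_distrib_left)
  also have "(\<Sum>k\<in>A. complexify (dist_laplacian A k (marginal N F A)) A \<xi>) =
      - complex_of_real (4 * pi\<^sup>2 * (\<Sum>k\<in>A. l2sq (\<xi> k))) * moment N F \<xi> A"
    by (simp add: lap sum_distrib_left sum_distrib_right sum_negf)
  also have "(\<Sum>k\<in>A. \<Sum>l\<in>A. complexify (op_S K A k l (marginal N F A)) A \<xi>) =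
      2 * pi * \<i> * (\<Sum>k\<in>A. \<Sum>l\<in>A. mode_sum K (\<xi> k) (\<lambda>p. moment N F (shift k l p \<xi>) A))"
    by (simp add: S sum_distrib_left)
  also have "(\<Sum>k\<in>A. complex_of_real ((real N - real j) / real N) *
        complexify (op_H K (insert star A) k (marginal N F (insert star A))) A \<xi>) =
      2 * pi * \<i> * (\<Sum>k\<in>A. ((of_nat N - of_nat j) / of_nat N) *
        mode_sum K (\<xi> k) (\<lambda>p. moment N F (shift k star p (\<xi>(star := 0))) (insert star A)))"
    unfolding sum_distrib_left by (rule sum.cong[OF refl]) (rule H)
  also have "complex_of_real \<sigma> * (- complex_of_real (4 * pi\<^sup>2 * (\<Sum>k\<in>A. l2sq (\<xi> k))) * moment N F \<xi> A) -
      complex_of_real (1 / real N) * (2 * pi * \<i> * (\<Sum>k\<in>A. \<Sum>l\<in>A. mode_sum K (\<xi> k) (\<lambda>p. moment N F (shift k l p \<xi>) A))) -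
      2 * pi * \<i> * (\<Sum>k\<in>A. ((of_nat N - of_nat j) / of_nat N) *
        mode_sum K (\<xi> k) (\<lambda>p. moment N F (shift k star p (\<xi>(star := 0))) (insert star A)))
      = moment_rhs K \<sigma> N F \<xi> A"
    unfolding moment_rhs_def
    by (simp add: flow sum.distrib sum_distrib_left algebra_simps)
  finally show ?thesis
    by (simp add: A_def)
qed

text \<open>Cosine and sine of the phase are admissible test functions; the two real equations
  combine into the complex one.\<close>

lemma moment_has_integral:
  fixes K :: "real ^ 'd \<Rightarrow> real ^ 'd \<Rightarrow> real ^ 'd"
  assumes K: "summable_fourier_kernel K" and f: "\<And>t. 0 \<le> t \<Longrightarrow> probability_density (conf {1..N}) (f t)"
    and sol: "bbgky_solution K \<sigma> \<rho>\<^sub>0 N f" and j: "j \<in> {1..N}" and t: "0 \<le> t"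
  shows "((\<lambda>s. moment_rhs K \<sigma> N (f s) \<xi> {1..j}) has_integral
    (moment N (f t) \<xi> {1..j} - moment N (f 0) \<xi> {1..j})) {0..t}"
proof -
  define L where "L s \<phi> = \<sigma> * (\<Sum>k=1..j. dist_laplacian {1..j} k (marginal N (f s) {1..j}) \<phi>)
      - 1 / real N * (\<Sum>k=1..j. \<Sum>l=1..j. op_S K {1..j} k l (marginal N (f s) {1..j}) \<phi>)
      - (real N - real j) / real N *
        (\<Sum>k=1..j. op_H K ({1..j} \<union> {star}) k (marginal N (f s) ({1..j} \<union> {star})) \<phi>)" for s \<phi>
  define D where "D \<phi> = pairing {1..j} (marginal N (f t) {1..j}) \<phi> - pairing {1..j} (marginal N (f 0) {1..j}) \<phi>" for \<phi>
  have weak: "((\<lambda>s. L s \<phi>) has_integral D \<phi>) {0..t}" if "test_function {1..j} \<phi>" for \<phi>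
    using sol j t that unfolding bbgky_solution_def L_def D_def by blast
  have trig: "test_function {1..j} (trig {1..j} \<xi> a b)" for a b
    by (rule test_function_trig) simp
  have "((\<lambda>s. complexify (L s) {1..j} \<xi>) has_integral complexify D {1..j} \<xi>) {0..t}"
    unfolding complexify_def
    by (intro has_integral_diff has_integral_mult_right has_integral_of_real weak trig)
  then have "((\<lambda>s. moment_rhs K \<sigma> N (f s) \<xi> {1..j}) has_integral complexify D {1..j} \<xi>) {0..t}"
  proof (rule has_integral_eq[rotated])
    fix s assume "s \<in> {0..t}"
    then show "complexify (L s) {1..j} \<xi> = moment_rhs K \<sigma> N (f s) \<xi> {1..j}"
      unfolding L_def by (intro complexify_hierarchy K f j) auto
  qed
  moreover have "complexify D {1..j} \<xi> = moment N (f t) \<xi> {1..j} - moment N (f 0) \<xi> {1..j}"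
  proof -
    have "complexify (pairing {1..j} (marginal N (f s) {1..j})) {1..j} \<xi> = moment N (f s) \<xi> {1..j}" if "0 \<le> s" for s
    proof -
      have "integrable (conf {1..N}) (f s)" "finite {1..j}" "card {1..j} \<le> N"
        using f[OF that] j by (auto simp: probability_density_def)
      then show ?thesis
        unfolding pairing_def
        by (subst complexify_integral) (auto simp: integrable_marginal fourier_coeff_marginal)
    qed
    then show ?thesis
      unfolding D_def complexify_diff using t by simp
  qed
  ultimately show ?thesis
    by (simp only:)
qed

section \<open>Evolution of the cumulants\<close>

lemma moment_rhs_empty: "moment_rhs K \<sigma> N F \<xi> {} = 0"
  by (simp add: moment_rhs_def)

text \<open>The hierarchy is given only for the label sets 1, ..., j, while the cumulant calculus
  needs their subsets too. An increasing map that fixes 0 keeps the extra label the least one, so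
  the moments with the extra particle are carried over as well.\<close>

lemma moment_rhs_relabel:
  assumes s: "strict_mono_on (insert 0 {1..j}) s" "s 0 = 0"
  shows "moment_rhs K \<sigma> N F \<xi> (s ` {1..j}) = moment_rhs K \<sigma> N F (\<lambda>i. \<xi> (s i)) {1..j}"
proof -
  let ?A = "{1..j}" and ?\<xi> = "\<lambda>i. \<xi> (s i)"
  have inj: "inj_on s (insert 0 ?A)"
    using s(1) by (rule strict_mono_on_imp_inj_on)
  have injA: "inj_on s ?A"
    using inj by (rule inj_on_subset) auto
  have monoA: "strict_mono_on ?A s"
    using s(1) by (rule monotone_on_subset) auto
  have eq: "s m = s i \<longleftrightarrow> m = i" if "m \<in> insert 0 ?A" "i \<in> insert 0 ?A" for m i
    by (rule inj_on_eq_iff[OF inj that])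
  have flow: "mode_flow N F \<xi> (s i) p (s ` ?A) = mode_flow N F ?\<xi> i p ?A" if i: "i \<in> ?A" for i p
  proof -
    have 1: "moment N F (shift (s i) (s l) p \<xi>) (s ` ?A) = moment N F (shift i l p ?\<xi>) ?A" if "l \<in> ?A" for l
    proof -
      have "moment N F (shift (s i) (s l) p \<xi>) (s ` ?A) = moment N F (\<lambda>m. shift (s i) (s l) p \<xi> (s m)) ?A"
        using monoA by (intro moment_image) auto
      also have "\<dots> = moment N F (shift i l p ?\<xi>) ?A"
        using i that eq by (intro moment_cong) (auto simp: shift_def)
      finally show ?thesis .
    qed
    have "moment N F (shift (s i) 0 p (\<xi>(0 := 0))) (s ` insert 0 ?A) =
        moment N F (\<lambda>m. shift (s i) 0 p (\<xi>(0 := 0)) (s m)) (insert 0 ?A)"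
      using s(1) by (intro moment_image) auto
    also have "\<dots> = moment N F (shift i 0 p (?\<xi>(0 := 0))) (insert 0 ?A)"
    proof (rule moment_cong)
      fix m assume m: "m \<in> insert 0 ?A"
      have "s m = 0 \<longleftrightarrow> m = 0" "s m = s i \<longleftrightarrow> m = i" "s i \<noteq> 0"
        using eq[OF m, of 0] eq[OF m, of i] eq[of i 0] i s(2) by auto
      then show "shift (s i) 0 p (\<xi>(0 := 0)) (s m) = shift i 0 p (?\<xi>(0 := 0)) m"
        using i by (auto simp: shift_def)
    qed simp
    finally have 2: "moment N F (shift (s i) 0 p (\<xi>(0 := 0))) (insert 0 (s ` ?A)) =
        moment N F (shift i 0 p (?\<xi>(0 := 0))) (insert 0 ?A)"
      using s(2) by simp
    have "(\<Sum>l\<in>s ` ?A - {s i}. moment N F (shift (s i) l p \<xi>) (s ` ?A)) =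
        (\<Sum>l\<in>?A - {i}. moment N F (shift i l p ?\<xi>) ?A)"
    proof -
      have "s ` ?A - {s i} = s ` (?A - {i})"
        using i inj_on_image_set_diff[OF injA, of ?A "{i}"] by simp
      then have "(\<Sum>l\<in>s ` ?A - {s i}. moment N F (shift (s i) l p \<xi>) (s ` ?A)) =
          (\<Sum>l\<in>?A - {i}. moment N F (shift (s i) (s l) p \<xi>) (s ` ?A))"
        using inj_on_subset[OF injA, of "?A - {i}"] by (simp add: sum.reindex)
      then show ?thesis
        by (simp add: 1)
    qed
    then show ?thesis
      unfolding mode_flow_def flow_def star_def using 1[OF i] 2 by (simp add: card_image[OF injA])
  qed
  have "moment N F \<xi> (s ` ?A) = moment N F ?\<xi> ?A"
    using monoA by (intro moment_image) auto
  then show ?thesis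
    unfolding moment_rhs_def by (simp add: sum.reindex[OF injA] flow)
qed

lemma ex_relabelling:
  assumes "finite A" "(0::nat) \<notin> A"
  obtains s where "strict_mono_on (insert 0 {1..card A}) s" "s 0 = 0" "A = s ` {1..card A}"
proof -
  let ?s = "\<lambda>i. if i = 0 then 0 else sorted_list_of_set A ! (i - 1)"
  have "?s ` {1..card A} = (\<lambda>i. sorted_list_of_set A ! (i - 1)) ` {1..card A}"
    by (rule image_cong) auto
  also have "\<dots> = A"
    using bij_betw_sorted_list[OF assms(1)] by (simp add: bij_betw_def)
  finally have im: "A = ?s ` {1..card A}" ..
  have "strict_mono_on (insert 0 {1..card A}) ?s"
  proof (rule strict_mono_onI)
    fix i j assume ij: "i \<in> insert 0 {1..card A}" "j \<in> insert 0 {1..card A}" "i < j"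
    show "?s i < ?s j"
    proof (cases "i = 0")
      case True
      have "?s j \<in> ?s ` {1..card A}"
        using ij by (intro imageI) auto
      then have "?s j \<in> A"
        using im by simp
      with assms(2) have "?s j \<noteq> 0"
        by metis
      then show ?thesis
        using True by simp
    next
      case False
      then show ?thesis
        using ij strict_sorted_list_of_set[of A] sorted_wrt_nth_less[of "(<)" "sorted_list_of_set A" "i - 1" "j - 1"]
        by auto
    qed
  qed
  then show ?thesis
    using that[of ?s] im by simp
qed

section \<open>Continuity in time, measured in L1\<close>

definition l1dist :: "nat \<Rightarrow> ((nat \<Rightarrow> real ^ 'd) \<Rightarrow> real) \<Rightarrow> ((nat \<Rightarrow> real ^ 'd) \<Rightarrow> real) \<Rightarrow> real" where
  "l1dist N F F' = (LINT x|conf {1..N}. \<bar>F x - F' x\<bar>)"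

lemma l1dist_nonneg: "0 \<le> l1dist N F F'"
  by (simp add: l1dist_def)

text \<open>One modulus of continuity serves every frequency and every label set; the continuity
  argument rests on this uniformity.\<close>

lemma norm_moment_diff_le:
  assumes "probability_density (conf {1..N}) F" "probability_density (conf {1..N}) F'"
  shows "cmod (moment N F \<xi> A - moment N F' \<xi> A) \<le> l1dist N F F'"
proof -
  have "moment N F \<xi> A - moment N F' \<xi> A = fourier_coeff {1..N} (\<lambda>x. F x - F' x) (relabel A \<xi>)"
    using assms by (simp add: moment_def fourier_coeff_diff probability_density_def)
  then show ?thesis
    by (simp add: l1dist_def norm_fourier_coeff_le)
qed

lemma norm_mode_flow_diff_le:
  assumes F: "probability_density (conf {1..N}) F" "probability_density (conf {1..N}) F'"
    and A: "finite A" "card A \<le> N" "k \<in> A"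
  shows "cmod (mode_flow N F \<xi> k p A - mode_flow N F' \<xi> k p A) \<le> real (card A + 1) * l1dist N F F'"
proof -
  let ?d = "l1dist N F F'"
  define S where "S F = moment N F (shift k k p \<xi>) A + (\<Sum>l\<in>A - {k}. moment N F (shift k l p \<xi>) A)"
    for F :: "(nat \<Rightarrow> real ^ 'a) \<Rightarrow> real"
  define c :: complex where "c = (of_nat N - of_nat (card A)) / of_nat N"
  have N: "0 < N"
    using A card_gt_0_iff[of A] by auto
  have c: "cmod c \<le> 1"
  proof -
    have "c = of_real ((real N - real (card A)) / real N)"
      by (simp add: c_def)
    then have "cmod c = \<bar>(real N - real (card A)) / real N\<bar>"
      by (simp only: norm_of_real)
    then show ?thesis
      using A N by simp
  qed
  have "S F - S F' = (\<Sum>l\<in>A. moment N F (shift k l p \<xi>) A - moment N F' (shift k l p \<xi>) A)"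
    unfolding S_def sum_subtractf using A by (simp add: sum.remove[of A k])
  then have S: "cmod (S F - S F') \<le> real (card A) * ?d"
    using norm_moment_diff_le[OF F] by (simp add: sum_norm_bound)
  define X where "X = 1 / of_nat N * (S F - S F')"
  define Y where "Y = c * (moment N F (shift k star p (\<xi>(star := 0))) (insert star A) -
      moment N F' (shift k star p (\<xi>(star := 0))) (insert star A))"
  have "cmod X \<le> 1 * cmod (S F - S F')"
    unfolding X_def norm_mult using N by (intro mult_right_mono) (auto simp: norm_divide)
  with S have X: "cmod X \<le> real (card A) * ?d"
    by simp
  have "cmod Y \<le> 1 * ?d"
    unfolding Y_def norm_mult using c norm_moment_diff_le[OF F] by (intro mult_mono) auto
  then have "cmod (X + Y) \<le> real (card A) * ?d + ?d"
    using X by (intro norm_triangle_le add_mono) auto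
  moreover have "mode_flow N F \<xi> k p A - mode_flow N F' \<xi> k p A = X + Y"
    unfolding mode_flow_def flow_def S_def c_def X_def Y_def by (simp add: algebra_simps diff_divide_distrib)
  ultimately show ?thesis
    by (simp add: distrib_right)
qed

lemma bdd_mode_flow:
  assumes "probability_density (conf {1..N}) F"
  shows "bdd (\<lambda>p. mode_flow N F \<xi> k p A)"
  unfolding mode_flow_def flow_def using assms
  by (intro bdd_add bdd_mult bdd_const bdd_sum bdd_moment)

lemma mode_sum_diff:
  assumes "summable_fourier_kernel K" "bdd q" "bdd r"
  shows "mode_sum K v (\<lambda>p. q p - r p) = mode_sum K v q - mode_sum K v r"
  using mode_sum_add[OF assms(1,2) bdd_mult[OF bdd_const assms(3), of "- 1"]]
    mode_sum_cmult[of K v "- 1" r] by simp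

text \<open>The constant grows with \<xi>, which is harmless: it only has to give continuity in time
  of the right-hand side at a fixed frequency.\<close>

lemma norm_moment_rhs_diff_le:
  assumes K: "summable_fourier_kernel K"
    and F: "probability_density (conf {1..N}) F" "probability_density (conf {1..N}) F'"
    and A: "finite A" "card A \<le> N"
  shows "cmod (moment_rhs K \<sigma> N F \<xi> A - moment_rhs K \<sigma> N F' \<xi> A) \<le>
    (\<bar>4 * pi\<^sup>2 * \<sigma> * (\<Sum>k\<in>A. l2sq (\<xi> k))\<bar> +
     2 * pi * (\<Sum>k\<in>A. l1norm (\<xi> k) * kernel_mass K * real (card A + 1))) * l1dist N F F'"
proof -
  let ?d = "l1dist N F F'"
  let ?\<nu> = "4 * pi\<^sup>2 * \<sigma> * (\<Sum>k\<in>A. l2sq (\<xi> k))"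
  have "cmod (mode_sum K (\<xi> k) (\<lambda>p. mode_flow N F \<xi> k p A) - mode_sum K (\<xi> k) (\<lambda>p. mode_flow N F' \<xi> k p A))
      \<le> l1norm (\<xi> k) * kernel_mass K * real (card A + 1) * ?d" if "k \<in> A" for k
  proof -
    have "cmod (mode_sum K (\<xi> k) (\<lambda>p. mode_flow N F \<xi> k p A - mode_flow N F' \<xi> k p A))
        \<le> l1norm (\<xi> k) * kernel_mass K * (real (card A + 1) * ?d)"
      by (intro norm_mode_sum_le K norm_mode_flow_diff_le F A that)
    then show ?thesis
      by (simp only: mode_sum_diff[OF K bdd_mode_flow[OF F(1)] bdd_mode_flow[OF F(2)]] mult.assoc)
  qed
  then have 1: "cmod ((\<Sum>k\<in>A. mode_sum K (\<xi> k) (\<lambda>p. mode_flow N F \<xi> k p A)) -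
      (\<Sum>k\<in>A. mode_sum K (\<xi> k) (\<lambda>p. mode_flow N F' \<xi> k p A)))
      \<le> (\<Sum>k\<in>A. l1norm (\<xi> k) * kernel_mass K * real (card A + 1)) * ?d"
    unfolding sum_subtractf[symmetric] sum_distrib_right by (intro sum_norm_le)
  have eq: "moment_rhs K \<sigma> N F \<xi> A - moment_rhs K \<sigma> N F' \<xi> A =
      - complex_of_real ?\<nu> * (moment N F \<xi> A - moment N F' \<xi> A) -
      2 * pi * \<i> * ((\<Sum>k\<in>A. mode_sum K (\<xi> k) (\<lambda>p. mode_flow N F \<xi> k p A)) -
      (\<Sum>k\<in>A. mode_sum K (\<xi> k) (\<lambda>p. mode_flow N F' \<xi> k p A)))"
    unfolding moment_rhs_def by (simp add: algebra_simps)
  have "cmod (moment_rhs K \<sigma> N F \<xi> A - moment_rhs K \<sigma> N F' \<xi> A) \<le> \<bar>?\<nu>\<bar> * ?d +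
      2 * pi * ((\<Sum>k\<in>A. l1norm (\<xi> k) * kernel_mass K * real (card A + 1)) * ?d)"
    unfolding eq
  proof (intro norm_triangle_le_diff add_mono)
    show "cmod (- complex_of_real ?\<nu> * (moment N F \<xi> A - moment N F' \<xi> A)) \<le> \<bar>?\<nu>\<bar> * ?d"
      unfolding norm_mult norm_minus_cancel norm_of_real
      using norm_moment_diff_le[OF F] by (intro mult_left_mono) auto
    show "cmod (2 * pi * \<i> * ((\<Sum>k\<in>A. mode_sum K (\<xi> k) (\<lambda>p. mode_flow N F \<xi> k p A)) -
        (\<Sum>k\<in>A. mode_sum K (\<xi> k) (\<lambda>p. mode_flow N F' \<xi> k p A)))) \<le>
        2 * pi * ((\<Sum>k\<in>A. l1norm (\<xi> k) * kernel_mass K * real (card A + 1)) * ?d)"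
      unfolding norm_mult[of "2 * pi * \<i>"] using 1 by (simp add: norm_mult)
  qed
  then show ?thesis
    by (simp add: algebra_simps)
qed

lemma l1dist_tendsto_0:
  assumes f: "\<And>t. 0 \<le> t \<Longrightarrow> probability_density (conf {1..N}) (f t)"
    and energy: "energy_class {1..N} f" and t: "0 \<le> t"
  shows "((\<lambda>s. l1dist N (f s) (f t)) \<longlongrightarrow> 0) (at t within {0..})"
proof -
  interpret conf: prob_space "conf {1..N} :: (nat \<Rightarrow> real ^ 'a) measure"
    by (rule prob_space_conf)
  have le: "l1dist N (f s) (f t) \<le> sqrt (LINT x|conf {1..N}. (f s x - f t x)\<^sup>2)" if s: "0 \<le> s" for s
  proof -
    let ?u = "\<lambda>x. \<bar>f s x - f t x\<bar>"
    have sq: "integrable (conf {1..N}) (\<lambda>x. (f r x)\<^sup>2)" and m [measurable]: "f r \<in> borel_measurable (conf {1..N})"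
      if "0 \<le> r" for r
      using energy that by (auto simp: energy_class_def square_integrable_def)
    have u: "integrable (conf {1..N}) ?u"
      using f[OF s] f[OF t] by (auto simp: probability_density_def)
    have "integrable (conf {1..N}) (\<lambda>x. (f s x - f t x)\<^sup>2)"
    proof (rule Bochner_Integration.integrable_bound)
      show "integrable (conf {1..N}) (\<lambda>x. 2 * (f s x)\<^sup>2 + 2 * (f t x)\<^sup>2)"
        using sq s t by auto
      have "(a - b)\<^sup>2 \<le> 2 * a\<^sup>2 + 2 * b\<^sup>2" for a b :: real
        using zero_le_power2[of "a + b"] by (simp add: power2_eq_square algebra_simps)
      then show "AE x in conf {1..N}. norm ((f s x - f t x)\<^sup>2) \<le> norm (2 * (f s x)\<^sup>2 + 2 * (f t x)\<^sup>2)"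
        by simp
      show "(\<lambda>x. (f s x - f t x)\<^sup>2) \<in> borel_measurable (conf {1..N})"
        using m[OF s] m[OF t] by measurable
    qed
    \<comment> \<open>On a probability space Cauchy-Schwarz is the nonnegativity of the variance,
      here of |f s - f t|.\<close>
    then have "0 \<le> (LINT x|conf {1..N}. (f s x - f t x)\<^sup>2) - (l1dist N (f s) (f t))\<^sup>2"
      using conf.variance_positive[of ?u] conf.variance_eq[OF u] by (simp add: l1dist_def)
    then show ?thesis
      by (intro real_le_rsqrt) simp
  qed
  have lim: "((\<lambda>s. sqrt (LINT x|conf {1..N}. (f s x - f t x)\<^sup>2)) \<longlongrightarrow> sqrt 0) (at t within {0..})"
    using energy t by (intro tendsto_real_sqrt) (auto simp: energy_class_def)
  show ?thesis
  proof (rule tendsto_sandwich[OF _ _ tendsto_const])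
    show "\<forall>\<^sub>F s in at t within {0..}. 0 \<le> l1dist N (f s) (f t)"
      by (simp add: l1dist_nonneg)
    show "\<forall>\<^sub>F s in at t within {0..}. l1dist N (f s) (f t) \<le> sqrt (LINT x|conf {1..N}. (f s x - f t x)\<^sup>2)"
      using le by (auto simp: eventually_at_filter)
  qed (use lim in simp)
qed

lemma continuous_on_moment_rhs:
  assumes K: "summable_fourier_kernel K"
    and f: "\<And>t. 0 \<le> t \<Longrightarrow> probability_density (conf {1..N}) (f t)"
    and energy: "energy_class {1..N} f" and A: "finite A" "card A \<le> N"
  shows "continuous_on {0..} (\<lambda>t. moment_rhs K \<sigma> N (f t) \<xi> A)"
  unfolding continuous_on_def
proof
  fix t :: real assume "t \<in> {0..}"
  then have t: "0 \<le> t"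
    by simp
  obtain C where C: "\<And>s. 0 \<le> s \<Longrightarrow>
      cmod (moment_rhs K \<sigma> N (f s) \<xi> A - moment_rhs K \<sigma> N (f t) \<xi> A) \<le> C * l1dist N (f s) (f t)"
    using norm_moment_rhs_diff_le[OF K f f[OF t] A] by metis
  have "((\<lambda>s. C * l1dist N (f s) (f t)) \<longlongrightarrow> 0) (at t within {0..})"
    using tendsto_mult_right_zero[OF l1dist_tendsto_0[OF f energy t]] by simp
  then have "((\<lambda>s. moment_rhs K \<sigma> N (f s) \<xi> A - moment_rhs K \<sigma> N (f t) \<xi> A) \<longlongrightarrow> 0) (at t within {0..})"
    by (rule Lim_null_comparison[rotated]) (use C in \<open>auto simp: eventually_at_filter\<close>)
  then show "((\<lambda>t. moment_rhs K \<sigma> N (f t) \<xi> A) \<longlongrightarrow> moment_rhs K \<sigma> N (f t) \<xi> A) (at t within {0..})"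
    by (simp add: LIM_zero_iff)
qed

text \<open>The weak form only gives an integral identity in time. As its integrand is continuous,
  the fundamental theorem of calculus makes it a genuine derivative, one-sided at the ends.\<close>

lemma moment_has_derivative:
  fixes K :: "real ^ 'd \<Rightarrow> real ^ 'd \<Rightarrow> real ^ 'd"
  assumes K: "summable_fourier_kernel K"
    and f: "\<And>t. 0 \<le> t \<Longrightarrow> probability_density (conf {1..N}) (f t)"
    and energy: "energy_class {1..N} f" and sol: "bbgky_solution K \<sigma> \<rho>\<^sub>0 N f"
    and A: "finite A" "0 \<notin> A" "card A \<le> N" and t: "t \<in> {0..T}"
  shows "((\<lambda>t. moment N (f t) \<xi> A) has_vector_derivative moment_rhs K \<sigma> N (f t) \<xi> A) (at t within {0..T})"
proof -
  have int: "((\<lambda>s. moment_rhs K \<sigma> N (f s) \<xi> A) has_integral (moment N (f u) \<xi> A - moment N (f 0) \<xi> A)) {0..u}"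
    if u: "0 \<le> u" for u
  proof (cases "A = {}")
    case True
    then show ?thesis
      using f[OF u] f[of 0] by (simp add: moment_rhs_empty moment_empty)
  next
    case False
    then have j: "card A \<in> {1..N}"
      using A card_gt_0_iff[of A] by auto
    obtain s where s: "strict_mono_on (insert 0 {1..card A}) s" "s 0 = 0" and As: "A = s ` {1..card A}"
      using ex_relabelling[OF A(1,2)] .
    have "strict_mono_on {1..card A} s"
      using s(1) by (rule monotone_on_subset) auto
    then have m: "moment N F \<xi> A = moment N F (\<lambda>i. \<xi> (s i)) {1..card A}" for F
      by (subst As) (rule moment_image, auto)
    have "moment_rhs K \<sigma> N F \<xi> A = moment_rhs K \<sigma> N F (\<lambda>i. \<xi> (s i)) {1..card A}" for F
      by (subst As) (rule moment_rhs_relabel[OF s])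
    then show ?thesis
      unfolding m using moment_has_integral[OF K f sol j u] by simp
  qed
  have "((\<lambda>u. integral {0..u} (\<lambda>s. moment_rhs K \<sigma> N (f s) \<xi> A)) has_vector_derivative
      moment_rhs K \<sigma> N (f t) \<xi> A) (at t within {0..T})"
    using continuous_on_subset[OF continuous_on_moment_rhs[OF K f energy A(1,3)], of "{0..T}"] t
    by (intro integral_has_vector_derivative) auto
  then have "((\<lambda>u. moment N (f 0) \<xi> A + integral {0..u} (\<lambda>s. moment_rhs K \<sigma> N (f s) \<xi> A)) has_vector_derivative
      0 + moment_rhs K \<sigma> N (f t) \<xi> A) (at t within {0..T})"
    by (intro has_vector_derivative_add has_vector_derivative_const)
  then have "((\<lambda>u. moment N (f 0) \<xi> A + integral {0..u} (\<lambda>s. moment_rhs K \<sigma> N (f s) \<xi> A)) has_vector_derivative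
      moment_rhs K \<sigma> N (f t) \<xi> A) (at t within {0..T})"
    by simp
  then show ?thesis
  proof (rule has_vector_derivative_transform[OF t, rotated])
    fix u assume "u \<in> {0..T}"
    then show "moment N (f u) \<xi> A = moment N (f 0) \<xi> A + integral {0..u} (\<lambda>s. moment_rhs K \<sigma> N (f s) \<xi> A)"
      using integral_unique[OF int, of u] by simp
  qed
qed

section \<open>The cumulant equations\<close>

lemma bdd_conv: "(\<And>B. bdd (\<lambda>p. f p B)) \<Longrightarrow> (\<And>B. bdd (\<lambda>p. g p B)) \<Longrightarrow> bdd (\<lambda>p. conv (f p) (g p) A)"
  unfolding conv_def by (intro bdd_sum bdd_mult)

lemma bdd_cum: "(\<And>B. bdd (\<lambda>p. M p B)) \<Longrightarrow> bdd (\<lambda>p. cum (M p) A)"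
  unfolding cum_def by (intro bdd_sum bdd_mult bdd_prod bdd_const)

lemma bdd_cum_pair: "(\<And>B. bdd (\<lambda>p. M p B)) \<Longrightarrow> bdd (\<lambda>p. cum_pair (M p) k l A)"
  unfolding cum_pair_def by (intro bdd_add bdd_conv bdd_cum)

definition mode_cum_flow :: "nat \<Rightarrow> ((nat \<Rightarrow> real ^ 'd) \<Rightarrow> real) \<Rightarrow> (nat \<Rightarrow> int ^ 'd) \<Rightarrow> nat \<Rightarrow>
    (int ^ 'd) \<times> (int ^ 'd) \<Rightarrow> nat set \<Rightarrow> complex" where
  "mode_cum_flow N F \<xi> k p = cum_flow N k star (moment N F \<xi>) (moment N F (shift k k p \<xi>))
     (\<lambda>l. moment N F (shift k l p \<xi>)) (moment N F (shift k star p (\<xi>(star := 0))))"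

definition cum_rhs :: "(real ^ 'd \<Rightarrow> real ^ 'd \<Rightarrow> real ^ 'd) \<Rightarrow> real \<Rightarrow> nat \<Rightarrow>
    ((nat \<Rightarrow> real ^ 'd) \<Rightarrow> real) \<Rightarrow> (nat \<Rightarrow> int ^ 'd) \<Rightarrow> nat set \<Rightarrow> complex" where
  "cum_rhs K \<sigma> N F \<xi> A =
     - complex_of_real (4 * pi\<^sup>2 * \<sigma> * (\<Sum>k\<in>A. l2sq (\<xi> k))) * cum (moment N F \<xi>) A -
     2 * pi * \<i> * (\<Sum>k\<in>A. mode_sum K (\<xi> k) (\<lambda>p. mode_cum_flow N F \<xi> k p (A - {k})))"

lemma bdd_mode_cum_flow:
  assumes "probability_density (conf {1..N}) F"
  shows "bdd (\<lambda>p. mode_cum_flow N F \<xi> k p A)"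
  unfolding mode_cum_flow_def cum_flow_def using bdd_moment[OF assms]
  by (intro bdd_add bdd_diff bdd_mult bdd_const bdd_sum bdd_cum bdd_cum_pair bdd_conv) auto

lemma mode_flow_eq_conv:
  assumes F: "probability_density (conf {1..N}) F" and A: "finite A" "0 \<notin> A" "k \<in> A"
  shows "mode_flow N F \<xi> k p A = conv (moment N F \<xi>) (mode_cum_flow N F \<xi> k p) (A - {k})"
proof -
  have fin: "finite C" if "C \<subseteq> A" for C
    using that A(1) by (rule finite_subset)
  have "mode_flow N F \<xi> k p (insert k (A - {k})) = conv (moment N F \<xi>) (mode_cum_flow N F \<xi> k p) (A - {k})"
    unfolding mode_flow_def mode_cum_flow_def
  proof (rule flow_eq_conv)
    show "moment N F \<xi> {} = 1"
      using F by (rule moment_empty)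
    show "moment N F (shift k k p \<xi>) C = moment N F \<xi> C" if "C \<subseteq> A - {k}" for C
      using that fin[of C] by (intro moment_cong) (auto simp: shift_def)
    show "moment N F (shift k l p \<xi>) C = moment N F \<xi> C" if "C \<subseteq> A - {k} - {l}" for C l
      using that fin[of C] by (intro moment_cong) (auto simp: shift_def)
    show "moment N F (shift k star p (\<xi>(star := 0))) C = moment N F \<xi> C" if "C \<subseteq> A - {k}" for C
      using that A fin[of C] by (intro moment_cong) (auto simp: shift_def star_def)
  qed (use A in \<open>auto simp: star_def intro!: gr0I\<close>)
  then show ?thesis
    using A by (simp add: insert_absorb)
qed

text \<open>The dissipation factors by \<open>moment_weight\<close>, the interaction by
  \<open>mode_flow_eq_conv\<close> and \<open>sum_conv_remove\<close>. What multiplies the moments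
  is then the candidate for the derivative of the cumulants.\<close>

lemma moment_rhs_eq_conv:
  assumes K: "summable_fourier_kernel K" and F: "probability_density (conf {1..N}) F"
    and A: "finite A" "0 \<notin> A"
  shows "moment_rhs K \<sigma> N F \<xi> A = conv (moment N F \<xi>) (cum_rhs K \<sigma> N F \<xi>) A"
proof -
  let ?M = "moment N F \<xi>"
  have "mode_sum K (\<xi> k) (\<lambda>p. mode_flow N F \<xi> k p A) =
      conv ?M (\<lambda>C. mode_sum K (\<xi> k) (\<lambda>p. mode_cum_flow N F \<xi> k p C)) (A - {k})" if "k \<in> A" for k
  proof -
    have "mode_sum K (\<xi> k) (\<lambda>p. mode_flow N F \<xi> k p A) =
        mode_sum K (\<xi> k) (\<lambda>p. \<Sum>B\<in>Pow (A - {k}). ?M B * mode_cum_flow N F \<xi> k p (A - {k} - B))"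
      by (simp only: mode_flow_eq_conv[OF F A that] conv_def)
    also have "\<dots> = (\<Sum>B\<in>Pow (A - {k}). mode_sum K (\<xi> k) (\<lambda>p. ?M B * mode_cum_flow N F \<xi> k p (A - {k} - B)))"
      using bdd_mode_cum_flow[OF F] by (intro mode_sum_sum[OF K] bdd_mult bdd_const) auto
    finally show ?thesis
      by (simp only: mode_sum_cmult conv_def)
  qed
  then have "(\<Sum>k\<in>A. mode_sum K (\<xi> k) (\<lambda>p. mode_flow N F \<xi> k p A)) =
      (\<Sum>k\<in>A. conv ?M (\<lambda>C. mode_sum K (\<xi> k) (\<lambda>p. mode_cum_flow N F \<xi> k p C)) (A - {k}))"
    by (rule sum.cong[OF refl])
  also have "\<dots> = conv ?M (\<lambda>C. \<Sum>k\<in>C. mode_sum K (\<xi> k) (\<lambda>p. mode_cum_flow N F \<xi> k p (C - {k}))) A"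
    using A(1) by (rule sum_conv_remove)
  finally have 1: "(\<Sum>k\<in>A. mode_sum K (\<xi> k) (\<lambda>p. mode_flow N F \<xi> k p A)) =
      conv ?M (\<lambda>C. \<Sum>k\<in>C. mode_sum K (\<xi> k) (\<lambda>p. mode_cum_flow N F \<xi> k p (C - {k}))) A" .
  have 2: "(\<Sum>k\<in>A. complex_of_real (l2sq (\<xi> k))) * ?M A =
      conv ?M (\<lambda>B. (\<Sum>k\<in>B. complex_of_real (l2sq (\<xi> k))) * cum ?M B) A"
    using A(1) moment_empty[OF F] by (rule moment_weight)
  have "moment_rhs K \<sigma> N F \<xi> A = - complex_of_real (4 * pi\<^sup>2 * \<sigma>) * ((\<Sum>k\<in>A. complex_of_real (l2sq (\<xi> k))) * ?M A) -
      2 * pi * \<i> * (\<Sum>k\<in>A. mode_sum K (\<xi> k) (\<lambda>p. mode_flow N F \<xi> k p A))"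
    by (simp add: moment_rhs_def mult.assoc)
  also have "\<dots> = conv ?M (\<lambda>B. - complex_of_real (4 * pi\<^sup>2 * \<sigma>) * ((\<Sum>k\<in>B. complex_of_real (l2sq (\<xi> k))) * cum ?M B) -
      2 * pi * \<i> * (\<Sum>k\<in>B. mode_sum K (\<xi> k) (\<lambda>p. mode_cum_flow N F \<xi> k p (B - {k})))) A"
    unfolding 1 2 conv_diff_right conv_cmult_right ..
  also have "\<dots> = conv ?M (cum_rhs K \<sigma> N F \<xi>) A"
    by (intro conv_cong refl) (simp add: cum_rhs_def mult.assoc)
  finally show ?thesis .
qed

lemma differentiable_cum:
  fixes M :: "real \<Rightarrow> 'a set \<Rightarrow> complex"
  assumes "\<And>P. P \<subseteq> A \<Longrightarrow> (\<lambda>t. M t P) differentiable (at t within S)"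
  shows "(\<lambda>t. cum (M t) A) differentiable (at t within S)"
proof -
  have prod: "(\<lambda>t. \<Prod>P\<in>\<pi>. M t P) differentiable (at t within S)" if "\<And>P. P \<in> \<pi> \<Longrightarrow> P \<subseteq> A" for \<pi>
    using that by (induction \<pi> rule: infinite_finite_induct) (auto intro!: differentiable_mult assms)
  show ?thesis
  proof (cases "finite {\<pi>. partition_on A \<pi>}")
    case True
    then show ?thesis
      unfolding cum_def
      by (intro differentiable_sum ballI differentiable_mult differentiable_const prod)
         (auto dest: partition_onD1)
  qed (simp add: cum_def)
qed

text \<open>The partition sum only shows that a derivative exists. Its value comes from
  differentiating \<open>moment_insert\<close>, which presents the derivative of the moments as M
  \<kappa>', and cancelling M against \<open>moment_rhs_eq_conv\<close>.\<close>

lemma cum_has_derivative: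
  fixes K :: "real ^ 'd \<Rightarrow> real ^ 'd \<Rightarrow> real ^ 'd"
  assumes K: "summable_fourier_kernel K"
    and f: "\<And>t. 0 \<le> t \<Longrightarrow> probability_density (conf {1..N}) (f t)"
    and energy: "energy_class {1..N} f" and sol: "bbgky_solution K \<sigma> \<rho>\<^sub>0 N f"
    and A: "finite A" "0 \<notin> A" "card A \<le> N" and t: "t \<in> {0..T}" and T: "0 < T"
  shows "((\<lambda>t. cum (moment N (f t) \<xi>) A) has_vector_derivative cum_rhs K \<sigma> N (f t) \<xi> A) (at t within {0..T})"
proof -
  let ?F = "at t within {0..T}"
  let ?M = "\<lambda>t. moment N (f t) \<xi>"
  define d\<kappa> where "d\<kappa> B = vector_derivative (\<lambda>t. cum (?M t) B) ?F" for B
  have ft: "probability_density (conf {1..N}) (f t)"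
    using f t by simp
  have sub: "finite B" "0 \<notin> B" "card B \<le> N" if "B \<subseteq> A" for B
    using that A card_mono[OF A(1) that] by (auto intro: finite_subset)
  have dM: "((\<lambda>t. ?M t B) has_vector_derivative moment_rhs K \<sigma> N (f t) \<xi> B) ?F" if "B \<subseteq> A" for B
    using sub[OF that] by (intro moment_has_derivative[OF K f energy sol] t)
  have d\<kappa>: "((\<lambda>t. cum (?M t) B) has_vector_derivative d\<kappa> B) ?F" if "B \<subseteq> A" for B
  proof -
    have "(\<lambda>t. cum (?M t) B) differentiable ?F"
      using that by (intro differentiable_cum differentiableI_vector[OF dM]) auto
    then show ?thesis
      unfolding d\<kappa>_def by (simp add: vector_derivative_works)
  qed
  \<comment> \<open>On a one-point interval derivatives would not be unique; this is where
    \<open>0 < T\<close> enters.\<close>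
  have nontriv: "?F \<noteq> bot"
    using t T by (simp add: trivial_limit_within islimpt_Icc)
  have uniq: "D = D'" if "(g has_vector_derivative D) ?F" "(g has_vector_derivative D') ?F"
    for g :: "real \<Rightarrow> complex" and D D'
    using vector_derivative_unique_within[OF nontriv that] .
  have H: "moment_rhs K \<sigma> N (f t) \<xi> B = conv (?M t) d\<kappa> B" if B: "B \<subseteq> A" for B
  proof (rule moment_derivative[where dM = "moment_rhs K \<sigma> N (f t) \<xi>"])
    show "finite B"
      using sub[OF B] by simp
    show "?M t {} = 1"
      using ft by (rule moment_empty)
    show "moment_rhs K \<sigma> N (f t) \<xi> {} = 0"
      by (rule moment_rhs_empty)
    show "d\<kappa> {} = 0"
      using d\<kappa>[of "{}"] by (intro uniq[of "\<lambda>t. 1"]) (auto simp: cum_empty)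
    fix C k assume C: "insert k C \<subseteq> B" "k \<notin> C"
    have CA: "insert k D \<subseteq> A" "D \<subseteq> A" if "D \<subseteq> C" for D
      using that C B by auto
    have "((\<lambda>t. conv (?M t) (\<lambda>D. cum (?M t) (insert k D)) C) has_vector_derivative
        (\<Sum>D\<in>Pow C. ?M t D * d\<kappa> (insert k (C - D)) + moment_rhs K \<sigma> N (f t) \<xi> D * cum (?M t) (insert k (C - D)))) ?F"
      unfolding conv_def
      by (intro has_vector_derivative_sum has_vector_derivative_mult dM d\<kappa> CA) auto
    moreover have "((\<lambda>t. conv (?M t) (\<lambda>D. cum (?M t) (insert k D)) C) has_vector_derivative
        moment_rhs K \<sigma> N (f t) \<xi> (insert k C)) ?F"
    proof (rule has_vector_derivative_transform[OF t _ dM])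
      fix u assume "u \<in> {0..T}"
      then show "conv (?M u) (\<lambda>D. cum (?M u) (insert k D)) C = ?M u (insert k C)"
        using C sub[OF CA(2)[OF subset_refl]] f by (intro moment_insert[symmetric] moment_empty) auto
    qed (use CA in auto)
    ultimately have "moment_rhs K \<sigma> N (f t) \<xi> (insert k C) =
        (\<Sum>D\<in>Pow C. ?M t D * d\<kappa> (insert k (C - D)) + moment_rhs K \<sigma> N (f t) \<xi> D * cum (?M t) (insert k (C - D)))"
      by (rule uniq[rotated])
    then show "moment_rhs K \<sigma> N (f t) \<xi> (insert k C) =
        conv (moment_rhs K \<sigma> N (f t) \<xi>) (\<lambda>D. cum (?M t) (insert k D)) C + conv (?M t) (\<lambda>D. d\<kappa> (insert k D)) C"
      by (simp add: conv_def sum.distrib)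
  qed
  have "conv (?M t) d\<kappa> B = conv (?M t) (cum_rhs K \<sigma> N (f t) \<xi>) B" if "B \<subseteq> A" for B
    by (rule trans[OF H[OF that, symmetric] moment_rhs_eq_conv[OF K ft sub(1)[OF that] sub(2)[OF that]]])
  from conv_cancel[of A "?M t" d\<kappa> "cum_rhs K \<sigma> N (f t) \<xi>" A, OF A(1) moment_empty[OF ft] this]
  have "d\<kappa> A = cum_rhs K \<sigma> N (f t) \<xi> A"
    by simp
  then show ?thesis
    using d\<kappa>[of A] by simp
qed

section \<open>A priori bound and continuity argument\<close>

text \<open>With the integrating factor exp(\<nu> t) the growth is at most \<nu> B exp(\<nu> t),
  whose integral is B exp(\<nu> T) - B. The rate \<nu> may be zero, as at frequency zero; then y' =
  0 and y stays 0.\<close>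

lemma damped_bound:
  fixes y :: "real \<Rightarrow> complex"
  assumes deriv: "\<And>t. t \<in> {0..T} \<Longrightarrow> (y has_vector_derivative y' t) (at t within {0..T})"
    and bound: "\<And>t. t \<in> {0..T} \<Longrightarrow> cmod (y' t + of_real \<nu> * y t) \<le> \<nu> * B"
    and "y 0 = 0" "0 < T" "0 \<le> B"
  shows "cmod (y T) \<le> B"
proof -
  define z where "z t = of_real (exp (\<nu> * t)) * y t" for t
  have dexp: "((\<lambda>t. exp (\<nu> * t)) has_real_derivative \<nu> * exp (\<nu> * t)) (at t within S)" for t S
    by (auto intro!: derivative_eq_intros)
  have dz: "(z has_vector_derivative of_real (exp (\<nu> * t)) * (y' t + of_real \<nu> * y t)) (at t within {0..T})"
    if "t \<in> {0..T}" for t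
    unfolding z_def
    by (rule has_vector_derivative_eq_rhs, rule has_vector_derivative_mult[OF has_vector_derivative_of_real[OF dexp] deriv[OF that]])
       (simp add: algebra_simps)
  have "cmod (z T - z 0) \<le> B * exp (\<nu> * T) - B * exp (\<nu> * 0)"
  proof (rule differentiable_bound_general[OF \<open>0 < T\<close>])
    show "continuous_on {0..T} z"
      using dz by (rule continuous_on_vector_derivative)
    show "continuous_on {0..T} (\<lambda>t. B * exp (\<nu> * t))"
      by (intro continuous_intros)
    fix t assume t: "0 < t" "t < T"
    then show "(z has_vector_derivative of_real (exp (\<nu> * t)) * (y' t + of_real \<nu> * y t)) (at t)"
      using dz[of t] by (simp add: at_within_Icc_at)
    show "((\<lambda>t. B * exp (\<nu> * t)) has_vector_derivative B * (\<nu> * exp (\<nu> * t))) (at t)"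
      by (intro has_vector_derivative_mult_right dexp[unfolded has_real_derivative_iff_has_vector_derivative])
    have "cmod (of_real (exp (\<nu> * t)) * (y' t + of_real \<nu> * y t)) \<le> exp (\<nu> * t) * (\<nu> * B)"
      unfolding norm_mult using bound[of t] t by (auto intro!: mult_left_mono)
    then show "cmod (of_real (exp (\<nu> * t)) * (y' t + of_real \<nu> * y t)) \<le> B * (\<nu> * exp (\<nu> * t))"
      by (simp add: mult_ac)
  qed
  moreover have "cmod (z T - z 0) = exp (\<nu> * T) * cmod (y T)"
    using \<open>y 0 = 0\<close> by (simp add: z_def norm_mult)
  ultimately have "exp (\<nu> * T) * cmod (y T) \<le> exp (\<nu> * T) * B"
    using \<open>0 \<le> B\<close> mult.commute[of B "exp (\<nu> * T)"]
    by (simp only: mult_zero_right exp_zero mult_1_right)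
  then show ?thesis
    by simp
qed

text \<open>The continuity argument tracks the sets 1, ..., n at all frequencies, while the
  nonlinear estimate also meets sets with gaps and with the extra label 0. Renaming in increasing
  order changes only the frequencies, and all of these are covered.\<close>

lemma small_cum_relabel:
  assumes F: "probability_density (conf {1..N}) F"
    and small: "\<And>n \<xi>. n \<in> {1..N} \<Longrightarrow> cmod (cum (moment N F \<xi>) {1..n}) \<le> cum_bound N n"
  shows "small_cum N (moment N F \<xi>)"
  unfolding small_cum_def
proof (intro allI impI)
  fix A :: "nat set" assume A: "finite A" "A \<noteq> {}" "card A \<le> N"
  let ?s = "\<lambda>i. sorted_list_of_set A ! (i - 1)"
  have bij: "bij_betw ?s {1..card A} A"
    using bij_betw_sorted_list[OF A(1)] .
  have mono: "strict_mono_on {1..card A} ?s"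
    using strict_sorted_list_of_set[of A]
    by (intro strict_mono_onI) (auto intro!: sorted_wrt_nth_less[of "(<)"])
  have "cum (moment N F (\<lambda>i. \<xi> (?s i))) {1..card A} = cum (moment N F \<xi>) (?s ` {1..card A})"
  proof (rule cum_image)
    fix B assume B: "B \<subseteq> {1..card A}"
    show "moment N F (\<lambda>i. \<xi> (?s i)) B = moment N F \<xi> (?s ` B)"
      using finite_subset[OF B] monotone_on_subset[OF mono B] by (intro moment_image[symmetric]) auto
  qed (use bij F in \<open>auto simp: bij_betw_def moment_empty\<close>)
  then have "cum (moment N F \<xi>) A = cum (moment N F (\<lambda>i. \<xi> (?s i))) {1..card A}"
    using bij by (simp add: bij_betw_def)
  moreover have "card A \<in> {1..N}"
    using A card_gt_0_iff[of A] by auto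
  ultimately show "cmod (cum (moment N F \<xi>) A) \<le> cum_bound N (card A)"
    using small by simp
qed

text \<open>\<open>damped_bound\<close> wants the drift bounded by a multiple of the rate \<nu>,
  uniformly in \<xi>. \<open>l1norm_le_l2sq\<close> provides this particle by particle, zero
  frequencies contributing nothing on either side.\<close>

lemma norm_cum_rhs_plus_le:
  fixes \<xi> :: "nat \<Rightarrow> int ^ 'd"
  assumes K: "summable_fourier_kernel K" and F: "probability_density (conf {1..N}) F"
    and small: "\<And>\<zeta>. small_cum N (moment N F \<zeta>)"
    and \<sigma>: "307 * kernel_mass K < \<sigma>"
    and A: "finite A" "0 \<notin> A" "card A \<le> N"
  defines "\<nu> \<equiv> 4 * pi\<^sup>2 * \<sigma> * (\<Sum>k\<in>A. l2sq (\<xi> k))"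
  shows "cmod (cum_rhs K \<sigma> N F \<xi> A + of_real \<nu> * cum (moment N F \<xi>) A) \<le> \<nu> * (cum_bound N (card A) / 2)"
proof -
  let ?b = "cum_bound N (card A)"
  let ?l = "\<Sum>k\<in>A. l2sq (\<xi> k)"
  have l: "0 \<le> ?l"
    by (simp add: sum_nonneg l2sq_nonneg)
  have flow: "cmod (mode_cum_flow N F \<xi> k p (A - {k})) \<le> 307 * ?b" if "k \<in> A" for k p
  proof -
    have card: "Suc (card (A - {k})) = card A"
      using that A by (intro card_Suc_Diff1) auto
    have "cmod (mode_cum_flow N F \<xi> k p (A - {k})) \<le> 307 * cum_bound N (Suc (card (A - {k})))"
      unfolding mode_cum_flow_def using that A card
      by (intro norm_cum_flow_le small) (auto simp: star_def intro!: gr0I)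
    then show ?thesis
      by (simp add: card)
  qed
  have "cmod (\<Sum>k\<in>A. mode_sum K (\<xi> k) (\<lambda>p. mode_cum_flow N F \<xi> k p (A - {k})))
      \<le> (\<Sum>k\<in>A. l2sq (\<xi> k) * kernel_mass K * (307 * ?b))"
  proof (rule sum_norm_le)
    fix k assume "k \<in> A"
    then have "cmod (mode_sum K (\<xi> k) (\<lambda>p. mode_cum_flow N F \<xi> k p (A - {k})))
        \<le> l1norm (\<xi> k) * kernel_mass K * (307 * ?b)"
      by (intro norm_mode_sum_le K flow)
    also have "\<dots> \<le> l2sq (\<xi> k) * kernel_mass K * (307 * ?b)"
      using l1norm_le_l2sq kernel_mass_nonneg[of K] cum_bound_nonneg[of N "card A"]
      by (intro mult_right_mono) auto
    finally show "cmod (mode_sum K (\<xi> k) (\<lambda>p. mode_cum_flow N F \<xi> k p (A - {k})))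
        \<le> l2sq (\<xi> k) * kernel_mass K * (307 * ?b)" .
  qed
  also have "\<dots> = (307 * kernel_mass K) * (?l * ?b)"
    by (simp add: sum_distrib_left sum_distrib_right mult_ac)
  also have "\<dots> \<le> \<sigma> * (?l * ?b)"
    using \<sigma> l cum_bound_nonneg[of N "card A"] by (intro mult_right_mono) auto
  finally have 1: "cmod (\<Sum>k\<in>A. mode_sum K (\<xi> k) (\<lambda>p. mode_cum_flow N F \<xi> k p (A - {k}))) \<le> \<sigma> * (?l * ?b)" .
  have \<sigma>0: "0 \<le> \<sigma>"
    using \<sigma> kernel_mass_nonneg[of K] by linarith
  have "cum_rhs K \<sigma> N F \<xi> A + of_real \<nu> * cum (moment N F \<xi>) A =
      - (2 * pi * \<i>) * (\<Sum>k\<in>A. mode_sum K (\<xi> k) (\<lambda>p. mode_cum_flow N F \<xi> k p (A - {k})))"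
    by (simp add: cum_rhs_def \<nu>_def)
  then have "cmod (cum_rhs K \<sigma> N F \<xi> A + of_real \<nu> * cum (moment N F \<xi>) A) =
      2 * pi * cmod (\<Sum>k\<in>A. mode_sum K (\<xi> k) (\<lambda>p. mode_cum_flow N F \<xi> k p (A - {k})))"
    by (simp add: norm_mult)
  also have "\<dots> \<le> 2 * pi * (\<sigma> * (?l * ?b))"
    using 1 by (intro mult_left_mono) auto
  \<comment> \<open>The drift carries 2 \<pi> and the damping 4 \<pi>^2. Giving away one factor
    \<pi> makes the drift half of the damping, hence the 1 / 2 in the conclusion.\<close>
  also have "\<dots> \<le> 2 * pi * pi * (\<sigma> * (?l * ?b))"
    using pi_gt3 \<sigma>0 l cum_bound_nonneg[of N "card A"] by (intro mult_right_mono) auto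
  also have "\<dots> = \<nu> * (?b / 2)"
    by (simp add: \<nu>_def power2_eq_square)
  finally show ?thesis .
qed

section \<open>Chaotic initial data\<close>

lemma moment_initial:
  fixes \<rho>\<^sub>0 :: "real ^ 'd \<Rightarrow> real"
  assumes F: "integrable (conf {1..N}) F" and \<rho>: "integrable torus \<rho>\<^sub>0" and j: "j \<le> N"
    and init: "AE x in conf {1..j}. marginal N F {1..j} x = (\<Prod>k=1..j. \<rho>\<^sub>0 (x k))"
  shows "moment N F \<xi> {1..j} =
    (\<Prod>k=1..j. LINT y|torus. complex_of_real (\<rho>\<^sub>0 y) * cis (- (2 * pi * freq_inner (\<xi> k) y)))"
proof -
  have meas: "(\<lambda>x. \<Prod>k=1..j. \<rho>\<^sub>0 (x k)) \<in> borel_measurable (conf {1..j})"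
    using \<rho> by (intro borel_measurable_prod measurable_compose[OF measurable_conf_component]) auto
  have marg: "integrable (conf {1..j}) (marginal N F {1..j})"
    using integrable_marginal[OF F, of "{1..j}"] j by simp
  have cis_prod: "cis (\<Sum>k\<in>A. u k) = (\<Prod>k\<in>A. cis (u k))" for A :: "nat set" and u
    by (induction A rule: infinite_finite_induct) (auto simp: cis_mult[symmetric])
  have "moment N F \<xi> {1..j} = (LINT x|conf {1..j}. complex_of_real (marginal N F {1..j} x) * cis (- phase {1..j} \<xi> x))"
    using fourier_coeff_marginal[OF F, of "{1..j}" \<xi>] j by (simp add: fourier_coeff_phase)
  also have "\<dots> = (LINT x|conf {1..j}. complex_of_real (\<Prod>k=1..j. \<rho>\<^sub>0 (x k)) * cis (- phase {1..j} \<xi> x))"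
    using init marg meas by (intro integral_cong_AE) (auto intro: borel_measurable_integrable simp del: of_real_prod)
  also have "\<dots> = (LINT x|conf {1..j}. (\<Prod>k=1..j. complex_of_real (\<rho>\<^sub>0 (x k)) * cis (- (2 * pi * freq_inner (\<xi> k) (x k)))))"
    by (simp add: phase_def sum_distrib_left prod.distrib cis_prod flip: sum_negf)
  also have "\<dots> = (\<Prod>k=1..j. LINT y|torus. complex_of_real (\<rho>\<^sub>0 y) * cis (- (2 * pi * freq_inner (\<xi> k) y)))"
    unfolding conf_def
  proof (rule tori.product_integral_prod)
    fix k
    have "(\<lambda>y. cis (- (2 * pi * freq_inner (\<xi> k) y))) \<in> borel_measurable torus"
      by (rule measurable_torusI) measurable
    then show "integrable torus (\<lambda>y. complex_of_real (\<rho>\<^sub>0 y) * cis (- (2 * pi * freq_inner (\<xi> k) y)))"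
      using \<rho> by (intro integrable_mult_bounded[where c = 1]) auto
  qed simp
  finally show ?thesis .
qed

text \<open>Initially every moment is a product of one-particle factors, so the last particle splits
  off and \<open>cum_eq_0_of_factor\<close> applies; \<open>2 \<le> n\<close> leaves other particles
  to split it from.\<close>

lemma cum_initial:
  fixes \<rho>\<^sub>0 :: "real ^ 'd \<Rightarrow> real"
  assumes F: "probability_density (conf {1..N}) F" and \<rho>: "integrable torus \<rho>\<^sub>0"
    and init: "\<And>j. j \<in> {1..N} \<Longrightarrow> AE x in conf {1..j}. marginal N F {1..j} x = (\<Prod>k=1..j. \<rho>\<^sub>0 (x k))"
    and n: "2 \<le> n" "n \<le> N"
  shows "cum (moment N F \<xi>) {1..n} = 0"
proof -
  define r where "r \<eta> = (LINT y|torus. complex_of_real (\<rho>\<^sub>0 y) * cis (- (2 * pi * freq_inner \<eta> y)))" for \<eta> :: "int ^ 'd"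
  have int: "integrable (conf {1..N}) F"
    using F by (simp add: probability_density_def)
  have prod: "moment N F \<xi> A = (\<Prod>k\<in>A. r (\<xi> k))" if A: "finite A" "0 \<notin> A" "card A \<le> N" for A
  proof (cases "A = {}")
    case False
    then have j: "card A \<in> {1..N}"
      using A card_gt_0_iff[of A] by auto
    obtain s where s: "strict_mono_on (insert 0 {1..card A}) s" "A = s ` {1..card A}"
      using ex_relabelling[OF A(1,2)] by metis
    have mono: "strict_mono_on {1..card A} s"
      using s(1) by (rule monotone_on_subset) auto
    then have "moment N F \<xi> A = moment N F (\<lambda>i. \<xi> (s i)) {1..card A}"
      by (subst s(2)) (rule moment_image, auto)
    also have "\<dots> = (\<Prod>i=1..card A. r (\<xi> (s i)))"
      unfolding r_def using j by (intro moment_initial[OF int \<rho>] init) auto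
    also have "\<dots> = (\<Prod>k\<in>s ` {1..card A}. r (\<xi> k))"
      using strict_mono_on_imp_inj_on[OF mono] by (simp add: prod.reindex)
    finally show ?thesis
      using s(2) by simp
  qed (simp add: moment_empty[OF F])
  have n': "{1..n} = insert n {1..n - 1}"
    using n by auto
  show ?thesis
    unfolding n'
  proof (rule cum_eq_0_of_factor)
    show "moment N F \<xi> (insert n A) = moment N F \<xi> A * r (\<xi> n)" if "A \<subseteq> {1..n - 1}" for A
    proof -
      have A: "finite A" "0 \<notin> A" "n \<notin> A" "card A \<le> n - 1"
        using that finite_subset[OF that] card_mono[OF _ that] n by auto
      then show ?thesis
        using n by (simp add: prod mult.commute)
    qed
  qed (use n in \<open>auto simp: moment_empty[OF F]\<close>)
qed

text \<open>Moments have modulus at most 1, so a product changes by no more than the sum of the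
  changes of its factors. The constant depends on \<open>A\<close> only and not on \<xi>.\<close>

lemma norm_cum_diff_le:
  assumes "probability_density (conf {1..N}) F" "probability_density (conf {1..N}) F'" "finite A"
  shows "cmod (cum (moment N F \<xi>) A - cum (moment N F' \<xi>) A) \<le>
    (\<Sum>\<pi> | partition_on A \<pi>. fact (card \<pi> - 1) * real (card \<pi>)) * l1dist N F F'"
proof -
  have "cmod (cum (moment N F \<xi>) A - cum (moment N F' \<xi>) A) \<le>
      (\<Sum>\<pi> | partition_on A \<pi>. fact (card \<pi> - 1) * real (card \<pi>) * l1dist N F F')"
    unfolding cum_def sum_subtractf[symmetric] right_diff_distrib[symmetric]
  proof (rule sum_norm_le)
    fix \<pi>
    have "cmod (prod (moment N F \<xi>) \<pi> - prod (moment N F' \<xi>) \<pi>) \<le> (\<Sum>P\<in>\<pi>. cmod (moment N F \<xi> P - moment N F' \<xi> P))"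
      using assms by (intro norm_prod_diff norm_moment_le)
    also have "\<dots> \<le> real (card \<pi>) * l1dist N F F'"
      using assms by (intro sum_bounded_above norm_moment_diff_le)
    finally show "cmod ((- 1) ^ (card \<pi> - 1) * fact (card \<pi> - 1) *
        (prod (moment N F \<xi>) \<pi> - prod (moment N F' \<xi>) \<pi>)) \<le> fact (card \<pi> - 1) * real (card \<pi>) * l1dist N F F'"
      by (simp add: norm_mult norm_power mult.assoc)
  qed
  then show ?thesis
    by (simp add: sum_distrib_right)
qed


lemma cum_singleton: "M {} = 1 \<Longrightarrow> cum M {k} = M {k}"
  using moment_insert[of "{}" k M] by simp

text \<open>
  As long as the bound holds, the damping improves it by a factor of two. The bound therefore holds
  for all times, because it holds at time zero and the coefficients are continuous in time, uniformly
  in the frequency.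
\<close>

lemma norm_cum_le:
  fixes K :: "real ^ 'd \<Rightarrow> real ^ 'd \<Rightarrow> real ^ 'd"
  assumes K: "summable_fourier_kernel K" and \<sigma>: "307 * kernel_mass K < \<sigma>"
    and f: "\<And>t. 0 \<le> t \<Longrightarrow> probability_density (conf {1..N}) (f t)"
    and energy: "energy_class {1..N} f" and sol: "bbgky_solution K \<sigma> \<rho>\<^sub>0 N f"
    and \<rho>: "integrable torus \<rho>\<^sub>0"
    and n: "n \<in> {1..N}" and t: "0 \<le> t"
  shows "cmod (cum (moment N (f t) \<xi>) {1..n}) \<le> cum_bound N n"
proof -
  let ?\<kappa> = "\<lambda>t \<xi> n. cum (moment N (f t) \<xi>) {1..n}"
  define good where "good t \<longleftrightarrow> (\<forall>n\<in>{1..N}. \<forall>\<xi>. cmod (?\<kappa> t \<xi> n) \<le> cum_bound N n)" for t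
  define half where "half t \<longleftrightarrow> (\<forall>n\<in>{1..N}. \<forall>\<xi>. cmod (?\<kappa> t \<xi> n) \<le> cum_bound N n / 2)" for t
  \<comment> \<open>Order one does not start from zero, so the damping estimate does not apply to
    it. But it is a moment, hence at most 1, and the bound for it is 2.\<close>
  have one: "cmod (?\<kappa> t \<xi> 1) \<le> cum_bound N 1 / 2" if "0 \<le> t" for t \<xi>
    using norm_moment_le[OF f[OF that], of \<xi> "{1}"] moment_empty[OF f[OF that]]
    by (simp add: cum_singleton cum_bound_def)
  have half0: "half 0"
    unfolding half_def
  proof (intro ballI allI)
    fix n \<xi> assume n: "n \<in> {1..N}"
    show "cmod (?\<kappa> 0 \<xi> n) \<le> cum_bound N n / 2"
    proof (cases "n = 1")
      case False
      have "?\<kappa> 0 \<xi> n = 0"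
        using sol n False by (intro cum_initial[OF f \<rho>]) (auto simp: bbgky_solution_def)
      then show ?thesis
        by (simp add: cum_bound_nonneg)
    qed (use one in simp)
  qed
  have half_good: "good t" if "half t" for t
    unfolding good_def
  proof (intro ballI allI)
    fix n \<xi> assume "n \<in> {1..N}"
    then have "cmod (?\<kappa> t \<xi> n) \<le> cum_bound N n / 2"
      using that by (auto simp: half_def)
    then show "cmod (?\<kappa> t \<xi> n) \<le> cum_bound N n"
      using cum_bound_nonneg[of N n] by linarith
  qed
  have improve: "half T" if "0 \<le> T" and good: "\<And>s. s \<in> {0..T} \<Longrightarrow> good s" for T
  proof (cases "T = 0")
    case False
    then have T: "0 < T"
      using that by simp
    show ?thesis
      unfolding half_def
    proof (intro ballI allI)
      fix n and \<xi> :: "nat \<Rightarrow> int ^ 'd"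
      assume n: "n \<in> {1..N}"
      define \<nu> where "\<nu> = 4 * pi\<^sup>2 * \<sigma> * (\<Sum>k=1..n. l2sq (\<xi> k))"
      show "cmod (?\<kappa> T \<xi> n) \<le> cum_bound N n / 2"
      proof (cases "n = 1")
        case False
        show ?thesis
        proof (rule damped_bound[where \<nu> = \<nu> and y = "\<lambda>t. ?\<kappa> t \<xi> n"])
          show "((\<lambda>t. ?\<kappa> t \<xi> n) has_vector_derivative cum_rhs K \<sigma> N (f t) \<xi> {1..n}) (at t within {0..T})"
            if "t \<in> {0..T}" for t
            using n by (intro cum_has_derivative[OF K f energy sol] that T) auto
          show "cmod (cum_rhs K \<sigma> N (f t) \<xi> {1..n} + of_real \<nu> * ?\<kappa> t \<xi> n) \<le> \<nu> * (cum_bound N n / 2)"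
            if t: "t \<in> {0..T}" for t
          proof -
            have "small_cum N (moment N (f t) \<zeta>)" for \<zeta>
              using good[OF t] f t by (intro small_cum_relabel) (auto simp: good_def)
            then show ?thesis
              using norm_cum_rhs_plus_le[OF K f _ \<sigma>, of t "{1..n}" \<xi>] t n by (simp add: \<nu>_def)
          qed
          show "?\<kappa> 0 \<xi> n = 0"
            using sol n False by (intro cum_initial[OF f \<rho>]) (auto simp: bbgky_solution_def)
        qed (use T in \<open>auto simp: cum_bound_nonneg\<close>)
      qed (use one T in simp)
    qed
  qed (use half0 in simp)
  \<comment> \<open>The radius is common to the infinitely many frequencies; only the finitely many
    orders n are treated one by one.\<close>
  have near: "\<exists>\<delta>>0. \<forall>s\<ge>0. \<bar>s - t\<bar> < \<delta> \<longrightarrow> (\<forall>n\<in>{1..N}. \<forall>\<xi>. cmod (?\<kappa> s \<xi> n - ?\<kappa> t \<xi> n) \<le> cum_bound N n / 2)"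
    if t: "0 \<le> t" for t
  proof -
    have "\<forall>\<^sub>F s in at t within {0..}. \<forall>n\<in>{1..N}. \<forall>\<xi>. cmod (?\<kappa> s \<xi> n - ?\<kappa> t \<xi> n) \<le> cum_bound N n / 2"
    proof (rule eventually_ball_finite, simp, rule ballI)
      fix n assume n: "n \<in> {1..N}"
      define L :: real where "L = (\<Sum>\<pi> | partition_on {1..n} \<pi>. fact (card \<pi> - 1) * real (card \<pi>))"
      have "((\<lambda>s. L * l1dist N (f s) (f t)) \<longlongrightarrow> 0) (at t within {0..})"
        using tendsto_mult_right_zero[OF l1dist_tendsto_0[OF f energy t]] by simp
      moreover have "0 < cum_bound N n / 2"
        using n cum_bound_pos[of N n] by auto
      ultimately have "\<forall>\<^sub>F s in at t within {0..}. L * l1dist N (f s) (f t) < cum_bound N n / 2"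
        by (rule order_tendstoD)
      moreover have "\<forall>\<^sub>F s in at t within {0..}. 0 \<le> s"
        by (simp add: eventually_at_filter)
      ultimately show "\<forall>\<^sub>F s in at t within {0..}. \<forall>\<xi>. cmod (?\<kappa> s \<xi> n - ?\<kappa> t \<xi> n) \<le> cum_bound N n / 2"
      proof eventually_elim
        case (elim s)
        show ?case
        proof
          fix \<xi>
          have "cmod (?\<kappa> s \<xi> n - ?\<kappa> t \<xi> n) \<le> L * l1dist N (f s) (f t)"
            unfolding L_def using elim t by (intro norm_cum_diff_le f) auto
          then show "cmod (?\<kappa> s \<xi> n - ?\<kappa> t \<xi> n) \<le> cum_bound N n / 2"
            using elim by simp
        qed
      qed
    qed
    then obtain \<delta> where \<delta>: "0 < \<delta>" and near: "\<And>s. s \<in> {0..} \<Longrightarrow> s \<noteq> t \<Longrightarrow> dist s t < \<delta> \<Longrightarrow>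
        \<forall>n\<in>{1..N}. \<forall>\<xi>. cmod (?\<kappa> s \<xi> n - ?\<kappa> t \<xi> n) \<le> cum_bound N n / 2"
      unfolding eventually_at by blast
    show ?thesis
    proof (intro exI[of _ \<delta>] conjI \<delta> allI impI)
      fix s assume s: "0 \<le> s" "\<bar>s - t\<bar> < \<delta>"
      show "\<forall>n\<in>{1..N}. \<forall>\<xi>. cmod (?\<kappa> s \<xi> n - ?\<kappa> t \<xi> n) \<le> cum_bound N n / 2"
      proof (cases "s = t")
        case False
        then show ?thesis
          using near[of s] s by (simp add: dist_real_def)
      qed (simp add: cum_bound_nonneg)
    qed
  qed
  \<comment> \<open>The disjunction lets one closeness statement serve in both directions of
    time.\<close>
  have propagate: "good s'" if "half s" and
    "\<forall>n\<in>{1..N}. \<forall>\<xi>. cmod (?\<kappa> s' \<xi> n - ?\<kappa> s \<xi> n) \<le> cum_bound N n / 2 \<or>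
       cmod (?\<kappa> s \<xi> n - ?\<kappa> s' \<xi> n) \<le> cum_bound N n / 2" for s s'
    unfolding good_def
  proof (intro ballI allI)
    fix n \<xi> assume "n \<in> {1..N}"
    then have "cmod (?\<kappa> s' \<xi> n - ?\<kappa> s \<xi> n) \<le> cum_bound N n / 2" "cmod (?\<kappa> s \<xi> n) \<le> cum_bound N n / 2"
      using that by (auto simp: half_def norm_minus_commute)
    then show "cmod (?\<kappa> s' \<xi> n) \<le> cum_bound N n"
      using norm_triangle_sub[of "?\<kappa> s' \<xi> n" "?\<kappa> s \<xi> n"] by linarith
  qed
  have "good t"
  proof (rule ccontr)
    assume bad: "\<not> good t"
    define B where "B = {s. 0 \<le> s \<and> \<not> good s}"
    define T where "T = Inf B"
    have B: "B \<noteq> {}" "bdd_below B"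
      using bad t by (auto simp: B_def intro!: bdd_belowI[of _ 0])
    have T0: "0 \<le> T"
      unfolding T_def using B by (intro cInf_greatest) (auto simp: B_def)
    have before: "good s" if "0 \<le> s" "s < T" for s
      using cInf_lower[OF _ B(2), of s] that by (auto simp: B_def T_def)
    obtain \<delta> where \<delta>: "0 < \<delta>" and close: "\<And>s. 0 \<le> s \<Longrightarrow> \<bar>s - T\<bar> < \<delta> \<Longrightarrow>
        \<forall>n\<in>{1..N}. \<forall>\<xi>. cmod (?\<kappa> s \<xi> n - ?\<kappa> T \<xi> n) \<le> cum_bound N n / 2"
      using near[OF T0] by blast
    \<comment> \<open>The infimum of the bad times may itself be bad a priori. If T > 0, an earlier
      time s close to T has half the bound by \<open>improve\<close>, and closeness carries the full
      bound to T.\<close>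
    have "good T"
    proof (cases "T = 0")
      case False
      define s where "s = max 0 (T - \<delta> / 2)"
      have s: "0 \<le> s" "s < T" "\<bar>s - T\<bar> < \<delta>"
        using False T0 \<delta> by (auto simp: s_def max_def)
      have "half s"
        using s before by (intro improve) auto
      then show ?thesis
        by (rule propagate) (use close[OF s(1,3)] in blast)
    qed (use half_good half0 in simp)
    with before have "half T"
      by (intro improve T0) (metis atLeastAtMost_iff order_le_less)
    \<comment> \<open>A bad time this soon after T contradicts closeness to T, where half the bound
      now holds.\<close>
    obtain s where s: "s \<in> B" "s < T + \<delta>"
      using cInf_lessD[OF B(1), of "T + \<delta>"] \<delta> by (auto simp: T_def)
    then have "T \<le> s" "0 \<le> s"
      using cInf_lower[OF s(1) B(2)] by (auto simp: T_def B_def)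
    then have "\<bar>s - T\<bar> < \<delta>"
      using s(2) by simp
    have "good s"
      using \<open>half T\<close> by (rule propagate) (use close[OF \<open>0 \<le> s\<close> \<open>\<bar>s - T\<bar> < \<delta>\<close>] in blast)
    with s(1) show False
      by (simp add: B_def)
  qed
  then show ?thesis
    using n by (simp add: good_def)
qed

theorem theorem1p4:
  fixes K :: "real ^ 'd \<Rightarrow> real ^ 'd \<Rightarrow> real ^ 'd"
  assumes "summable_fourier_kernel K"
  shows "\<exists>C::real. \<forall>(\<rho>\<^sub>0 :: real ^ 'd \<Rightarrow> real) (\<sigma>::real) (N::nat)
            (f :: real \<Rightarrow> (nat \<Rightarrow> real ^ 'd) \<Rightarrow> real).
          square_integrable torus \<rho>\<^sub>0 \<longrightarrow> probability_density torus \<rho>\<^sub>0 \<longrightarrow>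
          \<sigma> > C \<longrightarrow> N \<ge> 1 \<longrightarrow>
          (\<forall>t\<ge>0. probability_density (conf {1..N}) (f t) \<and> exchangeable N (f t)) \<longrightarrow>
          energy_class {1..N} f \<longrightarrow>
          bbgky_solution K \<sigma> \<rho>\<^sub>0 N f \<longrightarrow>
          (\<forall>m\<in>{1..N}. \<forall>t\<ge>0.
            fourier_sup_norm {1..m} (correlation N (f t) m)
              \<le> ennreal (2 * fact (m - 1) / (real m ^ 2 * real N ^ (m - 1))))"
proof (intro exI[of _ "307 * kernel_mass K"] allI impI ballI)
  fix \<rho>\<^sub>0 :: "real ^ 'd \<Rightarrow> real" and \<sigma> t :: real and N m :: nat and f :: "real \<Rightarrow> (nat \<Rightarrow> real ^ 'd) \<Rightarrow> real"
  assume \<rho>: "probability_density torus \<rho>\<^sub>0" and \<sigma>: "307 * kernel_mass K < \<sigma>"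
    and f: "\<forall>t\<ge>0. probability_density (conf {1..N}) (f t) \<and> exchangeable N (f t)"
    and energy: "energy_class {1..N} f" and sol: "bbgky_solution K \<sigma> \<rho>\<^sub>0 N f"
    and m: "m \<in> {1..N}" and t: "0 \<le> t"
  have ft: "integrable (conf {1..N}) (f t)"
    using f t by (simp add: probability_density_def)
  have "cmod (fourier_coeff {1..m} (correlation N (f t) m) \<xi>) \<le> 2 * fact (m - 1) / (real m ^ 2 * real N ^ (m - 1))" for \<xi>
    using norm_cum_le[OF assms \<sigma> _ energy sol _ m t, of \<xi>] f \<rho> m
    by (simp add: fourier_coeff_correlation[OF ft] cum_bound_def probability_density_def)
  then show "fourier_sup_norm {1..m} (correlation N (f t) m)
      \<le> ennreal (2 * fact (m - 1) / (real m ^ 2 * real N ^ (m - 1)))"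
    unfolding fourier_sup_norm_def by (intro SUP_least ennreal_leI)
qed

end
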